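(* Let $X_0=(x_0,y_0)\in N_\psi$ and let $\psi$ be a local minimizer of $J$ in $B_{R_0}(X_0)$. For $0<r<R_0/2$ let $$\mathcal D_{X_0,\psi}(r):=r^{-2}\int_{B_r(X_0)}\Big(\frac1x|\nabla\psi|^2-xyI_{\{\psi>0\}}-x\psi f(\psi)\Big)dX-r^{-3}\int_{\partial B_r(X_0)}\frac1x\psi^2\,d\mathcal H^1 .$$ Then for a.e. $r\in(0,R_0/2)$, $$\frac{d\mathcal D_{X_0,\psi}(r)}{dr}=2r^{-2}\int_{\partial B_r(X_0)}\frac1x\Big(\nabla\psi\cdot\nu-\frac{\psi}{r}\Big)^2d\mathcal H^1+r^{-4}\int_{\partial B_r(X_0)}\frac{x-x_0}{x^2}\psi^2\,d\mathcal H^1-r^{-3}J_0(r)-r^{-3}K_1(r),$$ where $\nu$ is the outward unit normal vector on $\partial B_r(X_0)$, $$J_0(r):=\int_{B_r(X_0)}\Big[\frac{x-x_0}{x^2}|\nabla\psi|^2+\big((x-x_0)y+(y-y_0)x\big)I_{\{\psi>0\}}\Big]dX,$$ $$K_1(r):=\int_{B_r(X_0)}\big(2F(\psi)(x-x_0)+4xF(\psi)\big)dX-r\int_{\partial B_r(X_0)}\big(2xF(\psi)-x\psi f(\psi)\big)d\mathcal H^1 .$$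
   Context: Points are $X=(x,y)\in\mathbb R^2$, $dX=dx\,dy$, $B_r(X_0)$ is the open disc, $I_A$ is the characteristic function of $A$. Vorticity: $f\in C^{1,\beta}(\mathbb R)$, $\beta\in(0,1)$, and there is a constant $F_0\ge0$ with $0\le f(z)\le F_0$ for $z\le0$ and $-F_0\le f'(z)\le0$ for all $z\in\mathbb R$; $F(z):=\int_0^z f(s)\,ds$. $\Omega$ is a connected, relatively open subset of $\{x\ge0\}$, $\psi$ is a function on $\Omega$, and its free boundary $\Omega\cap\partial\{\psi>0\}$ is contained in $\{x\ge0,\ y\le0\}$. The set of non-degenerate points is $N_\psi:=\{(x_0,y_0)\in\Omega\cap\partial\{\psi>0\}: x_0>0,\ y_0<0\}$. For $X_0=(x_0,y_0)\in N_\psi$ put $R_0:=\frac12\min\{\frac{x_0}{2},-\frac{y_0}{2}\}$; it is understood that $B_{R_0}(X_0)\subset\Omega$. Functional: $J(\psi):=\int_{B_{R_0}(X_0)}\big(\frac1x|\nabla\psi|^2-2xF(\psi)-xyI_{\{\psi>0\}}\big)dX$ on $W^{1,2}_{\rm w}(B_{R_0}(X_0))$, the space of $g$ with $\int\frac1x(|g|^2+|\nabla g|^2)dX<\infty$ (equivalent to $W^{1,2}$ here). $\psi$ is a local minimizer of $J$ in $B_{R_0}(X_0)$ if $J(\psi)\le J(\phi)$ for all $\phi\in W^{1,2}_{\rm w}(B_{R_0}(X_0))$ with $\phi=\psi$ on $\partial B_{R_0}(X_0)$ in the trace sense; minimizers are taken with nonnegative trace on $\partial B_{R_0}(X_0)$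 and are identified with their continuous representative. *)

theory Defs
  imports "HOL-Analysis.Analysis"
begin

text \<open>Points \<open>X = (x, y)\<close> of the plane are pairs with \<open>x = fst X\<close> and \<open>y = snd X\<close>; the norm and
  the inner product on \<^typ>\<open>real \<times> real\<close> are the Euclidean ones.\<close>


subsection \<open>The vorticity function\<close>

text \<open>The Hoelder condition is local, which is the weaker reading of \<open>C\<^sup>1\<^sup>,\<^sup>\<beta>(\<real>)\<close>.\<close>

definition C1_holder :: "real \<Rightarrow> (real \<Rightarrow> real) \<Rightarrow> bool" where
  "C1_holder \<beta> f \<longleftrightarrow>
     (\<forall>z. f differentiable (at z)) \<and>
     (\<forall>a b. \<exists>C. \<forall>s\<in>{a..b}. \<forall>t\<in>{a..b}. \<bar>deriv f s - deriv f t\<bar> \<le> C * \<bar>s - t\<bar> powr \<beta>)"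

text \<open>The integral is oriented, so the value for \<open>z < 0\<close> is minus the integral over \<open>[z, 0]\<close>.\<close>

definition prim :: "(real \<Rightarrow> real) \<Rightarrow> real \<Rightarrow> real" where
  "prim f z = (LBINT s=0..z. f s)"


subsection \<open>Integration over circles\<close>

definition circ :: "real \<times> real \<Rightarrow> real \<Rightarrow> real \<Rightarrow> real \<times> real" where
  "circ X\<^sub>0 r \<theta> = X\<^sub>0 + r *\<^sub>R (cos \<theta>, sin \<theta>)"

text \<open>The integral over the circle of centre \<open>X\<^sub>0\<close> and radius \<open>r > 0\<close> with respect to its arc
  length, that is, to one-dimensional Hausdorff measure.\<close>

definition circle_integral :: "real \<times> real \<Rightarrow> real \<Rightarrow> (real \<times> real \<Rightarrow> real) \<Rightarrow> real" where
  "circle_integral X\<^sub>0 r g = (LINT \<theta>:{0..2*pi}|lebesgue. g (circ X\<^sub>0 r \<theta>) * r)"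

definition circle_L2 :: "real \<times> real \<Rightarrow> real \<Rightarrow> (real \<times> real \<Rightarrow> real) \<Rightarrow> bool" where
  "circle_L2 X\<^sub>0 r h \<longleftrightarrow>
     set_borel_measurable lebesgue {0..2*pi} (\<lambda>\<theta>. h (circ X\<^sub>0 r \<theta>)) \<and>
     set_integrable lebesgue {0..2*pi} (\<lambda>\<theta>. (h (circ X\<^sub>0 r \<theta>))\<^sup>2)"


subsection \<open>Weak gradients, the weighted Sobolev space and traces\<close>

text \<open>\<open>C\<^sup>1\<close> test functions with compact support in \<open>S\<close>, together with their gradient.\<close>

definition test_fun :: "(real \<times> real) set \<Rightarrow> (real \<times> real \<Rightarrow> real) \<Rightarrow>
    (real \<times> real \<Rightarrow> real \<times> real) \<Rightarrow> bool" where
  "test_fun S \<eta> D\<eta> \<longleftrightarrow>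
     (\<forall>X. (\<eta> has_derivative (\<lambda>v. D\<eta> X \<bullet> v)) (at X)) \<and> continuous_on UNIV D\<eta> \<and>
     (\<exists>K. compact K \<and> K \<subseteq> S \<and> (\<forall>X. X \<notin> K \<longrightarrow> \<eta> X = 0))"

text \<open>A gradient is determined only almost everywhere; \<open>Dg\<close> is any representative. The
  integration-by-parts identity is vector valued and comprises both partial derivatives.\<close>

definition weak_gradient :: "(real \<times> real) set \<Rightarrow> (real \<times> real \<Rightarrow> real) \<Rightarrow>
    (real \<times> real \<Rightarrow> real \<times> real) \<Rightarrow> bool" where
  "weak_gradient S g Dg \<longleftrightarrow>
     (\<forall>K. compact K \<and> K \<subseteq> S \<longrightarrow> set_integrable lebesgue K g \<and> set_integrable lebesgue K Dg) \<and>
     (\<forall>\<eta> D\<eta>. test_fun S \<eta> D\<eta> \<longrightarrow>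
        (LINT X:S|lebesgue. g X *\<^sub>R D\<eta> X) = - (LINT X:S|lebesgue. \<eta> X *\<^sub>R Dg X))"

definition W12w :: "(real \<times> real) set \<Rightarrow> (real \<times> real \<Rightarrow> real) \<Rightarrow>
    (real \<times> real \<Rightarrow> real \<times> real) \<Rightarrow> bool" where
  "W12w S g Dg \<longleftrightarrow>
     set_borel_measurable lebesgue S g \<and> set_borel_measurable lebesgue S Dg \<and>
     weak_gradient S g Dg \<and>
     set_integrable lebesgue S (\<lambda>X. 1 / fst X * ((g X)\<^sup>2 + (norm (Dg X))\<^sup>2))"

text \<open>The graph of the trace operator on \<open>W12w\<close> of a disc: the closure of the restriction map on
  the functions of this space that are continuous up to the boundary.\<close>

definition has_trace :: "real \<times> real \<Rightarrow> real \<Rightarrow> (real \<times> real \<Rightarrow> real) \<Rightarrow>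
    (real \<times> real \<Rightarrow> real \<times> real) \<Rightarrow> (real \<times> real \<Rightarrow> real) \<Rightarrow> bool" where
  "has_trace X\<^sub>0 R g Dg h \<longleftrightarrow>
     W12w (ball X\<^sub>0 R) g Dg \<and> circle_L2 X\<^sub>0 R h \<and>
     (\<exists>u Du.
        (\<forall>n::nat. continuous_on (cball X\<^sub>0 R) (u n) \<and> W12w (ball X\<^sub>0 R) (u n) (Du n)) \<and>
        (\<lambda>n. LINT X:ball X\<^sub>0 R|lebesgue.
               1 / fst X * ((u n X - g X)\<^sup>2 + (norm (Du n X - Dg X))\<^sup>2)) \<longlonglongrightarrow> 0 \<and>
        (\<lambda>n. circle_integral X\<^sub>0 R (\<lambda>X. (u n X - h X)\<^sup>2)) \<longlonglongrightarrow> 0)"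

definition same_trace :: "real \<times> real \<Rightarrow> real \<Rightarrow> (real \<times> real \<Rightarrow> real) \<Rightarrow>
    (real \<times> real \<Rightarrow> real \<times> real) \<Rightarrow> (real \<times> real \<Rightarrow> real) \<Rightarrow>
    (real \<times> real \<Rightarrow> real \<times> real) \<Rightarrow> bool" where
  "same_trace X\<^sub>0 R g Dg k Dk \<longleftrightarrow> (\<exists>h. has_trace X\<^sub>0 R g Dg h \<and> has_trace X\<^sub>0 R k Dk h)"

definition nonneg_trace :: "real \<times> real \<Rightarrow> real \<Rightarrow> (real \<times> real \<Rightarrow> real) \<Rightarrow>
    (real \<times> real \<Rightarrow> real \<times> real) \<Rightarrow> bool" where
  "nonneg_trace X\<^sub>0 R g Dg \<longleftrightarrow>
     (\<exists>h. has_trace X\<^sub>0 R g Dg h \<and>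
          (AE \<theta> in lebesgue. \<theta> \<in> {0..2*pi} \<longrightarrow> 0 \<le> h (circ X\<^sub>0 R \<theta>)))"


subsection \<open>The functional and its local minimizers\<close>

definition J_fun :: "(real \<Rightarrow> real) \<Rightarrow> real \<times> real \<Rightarrow> real \<Rightarrow> (real \<times> real \<Rightarrow> real) \<Rightarrow>
    (real \<times> real \<Rightarrow> real \<times> real) \<Rightarrow> real" where
  "J_fun f X\<^sub>0 R \<psi> D\<psi> =
     (LINT X:ball X\<^sub>0 R|lebesgue.
        1 / fst X * (norm (D\<psi> X))\<^sup>2 - 2 * fst X * prim f (\<psi> X)
        - fst X * snd X * indicator {Y. 0 < \<psi> Y} X)"

definition local_minimizer :: "(real \<Rightarrow> real) \<Rightarrow> real \<times> real \<Rightarrow> real \<Rightarrow> (real \<times> real \<Rightarrow> real) \<Rightarrow>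
    (real \<times> real \<Rightarrow> real \<times> real) \<Rightarrow> bool" where
  "local_minimizer f X\<^sub>0 R \<psi> D\<psi> \<longleftrightarrow>
     W12w (ball X\<^sub>0 R) \<psi> D\<psi> \<and>
     (\<forall>\<phi> D\<phi>. W12w (ball X\<^sub>0 R) \<phi> D\<phi> \<and> same_trace X\<^sub>0 R \<phi> D\<phi> \<psi> D\<psi> \<longrightarrow>
        J_fun f X\<^sub>0 R \<psi> D\<psi> \<le> J_fun f X\<^sub>0 R \<phi> D\<phi>)"


subsection \<open>The free boundary\<close>

definition free_boundary :: "(real \<times> real) set \<Rightarrow> (real \<times> real \<Rightarrow> real) \<Rightarrow> (real \<times> real) set" where
  "free_boundary \<Omega> \<psi> = \<Omega> \<inter> frontier {X \<in> \<Omega>. 0 < \<psi> X}"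

definition nondegenerate_points :: "(real \<times> real) set \<Rightarrow> (real \<times> real \<Rightarrow> real) \<Rightarrow>
    (real \<times> real) set" where
  "nondegenerate_points \<Omega> \<psi> = {X \<in> free_boundary \<Omega> \<psi>. 0 < fst X \<and> snd X < 0}"


subsection \<open>The quantities in the monotonicity formula\<close>

definition D_fun :: "(real \<Rightarrow> real) \<Rightarrow> real \<times> real \<Rightarrow> (real \<times> real \<Rightarrow> real) \<Rightarrow>
    (real \<times> real \<Rightarrow> real \<times> real) \<Rightarrow> real \<Rightarrow> real" where
  "D_fun f X\<^sub>0 \<psi> D\<psi> r =
     1 / r^2 * (LINT X:ball X\<^sub>0 r|lebesgue.
        1 / fst X * (norm (D\<psi> X))\<^sup>2 - fst X * snd X * indicator {Y. 0 < \<psi> Y} X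
        - fst X * \<psi> X * f (\<psi> X))
     - 1 / r^3 * circle_integral X\<^sub>0 r (\<lambda>X. 1 / fst X * (\<psi> X)\<^sup>2)"

definition J0_fun :: "real \<times> real \<Rightarrow> (real \<times> real \<Rightarrow> real) \<Rightarrow>
    (real \<times> real \<Rightarrow> real \<times> real) \<Rightarrow> real \<Rightarrow> real" where
  "J0_fun X\<^sub>0 \<psi> D\<psi> r =
     (LINT X:ball X\<^sub>0 r|lebesgue.
        (fst X - fst X\<^sub>0) / (fst X)\<^sup>2 * (norm (D\<psi> X))\<^sup>2
        + ((fst X - fst X\<^sub>0) * snd X + (snd X - snd X\<^sub>0) * fst X) * indicator {Y. 0 < \<psi> Y} X)"

definition K1_fun :: "(real \<Rightarrow> real) \<Rightarrow> real \<times> real \<Rightarrow> (real \<times> real \<Rightarrow> real) \<Rightarrow> real \<Rightarrow> real" where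
  "K1_fun f X\<^sub>0 \<psi> r =
     (LINT X:ball X\<^sub>0 r|lebesgue.
        2 * prim f (\<psi> X) * (fst X - fst X\<^sub>0) + 4 * fst X * prim f (\<psi> X))
     - r * circle_integral X\<^sub>0 r (\<lambda>X. 2 * fst X * prim f (\<psi> X) - fst X * \<psi> X * f (\<psi> X))"

end

theory Submission
  imports Defs
begin

text \<open>
  Let \<open>Z = X - X0\<close> and let \<open>\<kappa>\<close> be a radial cut-off vanishing near the boundary of the disc. Comparing
  \<open>\<psi>\<close> with \<open>(1 + e \<kappa>) \<psi>\<close>, which has the same positivity set, and with \<open>\<psi> \<circ> S\<^sub>e\<inverse>\<close> for the radial shift
  \<open>S\<^sub>e X = X0 + (1 + e \<kappa>) Z\<close>, the first variation vanishes in both cases. Both identities are linear in \<open>\<kappa>\<close>.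
  For \<open>\<kappa> = max 0 (\<alpha> - |Z|\<^sup>2) ^ 3\<close> one differentiates them three times in \<open>\<alpha>\<close>, the last time by
  polar coordinates and the Lebesgue differentiation theorem; this gives, for almost every \<open>r\<close>, two identities
  between integrals over the disc and over the circle of radius \<open>r\<close>: the energy identity and the Pohozaev identity.

  The circle integral of \<open>\<psi>\<^sup>2 / x\<close> is differentiated with the weak gradient alone: for smooth \<open>P\<close> the field
  \<open>P (Z / |Z|) Z / |Z|\<^sup>2\<close> is divergence free, which computes the increment in \<open>r\<close> of \<open>\<psi>\<close> tested on
  the circle with \<open>P\<close>, and by the Stone-Weierstrass theorem continuous weights are allowed; the weight that
  is needed is the sum of the values of \<open>\<psi>\<close> on the two circles, times \<open>1 / x\<close>. The formula is then algebra.
\<close>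


subsection \<open>Change of variables in the plane\<close>

text \<open>Two tools are missing: an Euler-Lagrange equation across the free boundary, because the
  indicator term is not differentiable under general perturbations, and pointwise derivatives of
  \<open>\<psi>\<close>, because \<open>D\<psi>\<close> is any representative of the weak gradient.
  The competitors are chosen to tame the indicator: a positive factor leaves it alone, and once the
  shift is undone by a change of variables only smooth coefficients depend on \<open>e\<close>. With
  the indicator of a disc as \<open>\<kappa>\<close>, each variation would relate an integral over
  the disc to one over its boundary. The third power is a compromise: it is smooth enough for the
  cut-off, the shift and the cofactors of its derivative to be admissible, and after two derivatives
  in \<open>\<alpha>\<close> the factor that comes from \<open>\<kappa>'\<close> is an indicator.
  Integrability of an expression in \<open>D\<psi>\<close> on one given circle is not known; polar
  coordinates supply it for almost every radius. Together with Lebesgue differentiation this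
  produces the exceptional radii of the statement.\<close>

lemma lebesgue_measure_preserving:
  fixes T :: "'a::euclidean_space \<Rightarrow> 'b::euclidean_space"
  assumes T: "T \<in> borel_measurable borel" and eq: "distr lborel borel T = lborel"
  shows "T \<in> lebesgue \<rightarrow>\<^sub>M lebesgue" "distr lebesgue lebesgue T = lebesgue"
proof -
  have T': "T \<in> lebesgue \<rightarrow>\<^sub>M lborel"
    using T by (simp add: measurable_completion)
  have d: "distr lebesgue lborel T = lborel"
    using T eq by (subst distr_completion) (auto cong: distr_cong)
  \<comment> \<open>Preimages of null sets are null because \<open>T\<close> preserves the measure,
    so measurability survives the completion of the target.\<close>
  show "T \<in> lebesgue \<rightarrow>\<^sub>M lebesgue"
    by (rule completion.measurable_completion2[OF T']) (simp add: d)
  show "distr lebesgue lebesgue T = lebesgue"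
    using completion.completion_distr_eq[OF T'] by (simp add: d)
qed

lemma integrable_measure_preserving:
  fixes T :: "'a::euclidean_space \<Rightarrow> 'b::euclidean_space" and f :: "'b \<Rightarrow> 'c::{banach, second_countable_topology}"
  assumes T: "T \<in> borel_measurable borel" and eq: "distr lborel borel T = lborel"
    and f: "integrable lebesgue f"
  shows "integrable lebesgue (\<lambda>x. f (T x))" "(LINT x|lebesgue. f (T x)) = (LINT x|lebesgue. f x)"
proof -
  note * = lebesgue_measure_preserving[OF T eq]
  show "integrable lebesgue (\<lambda>x. f (T x))"
    using integrable_distr[OF *(1), of f] f by (simp add: *(2))
  have "f \<in> borel_measurable lebesgue" using f by auto
  from integral_distr[OF *(1) this] show "(LINT x|lebesgue. f (T x)) = (LINT x|lebesgue. f x)"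
    by (simp add: *(2))
qed

text \<open>The change of variables theorem is stated over \<open>real^'n\<close>; two mutually
  inverse linear isometries carry it to the plane.\<close>

definition pair_of_vec :: "real^2 \<Rightarrow> real \<times> real" where
  "pair_of_vec v = (v $ 1, v $ 2)"

definition vec_of_pair :: "real \<times> real \<Rightarrow> real^2" where
  "vec_of_pair p = vector [fst p, snd p]"

lemma vec_of_pair_nth [simp]: "vec_of_pair p $ 1 = fst p" "vec_of_pair p $ 2 = snd p"
  by (simp_all add: vec_of_pair_def)

lemma vec_pair_inverse [simp]: "pair_of_vec (vec_of_pair p) = p" "vec_of_pair (pair_of_vec v) = v"
  by (simp_all add: pair_of_vec_def vec_eq_iff forall_2)

lemma bounded_linear_pair_of_vec: "bounded_linear pair_of_vec"
  unfolding pair_of_vec_def by (intro bounded_linear_Pair bounded_linear_vec_nth)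

lemma bounded_linear_vec_of_pair: "bounded_linear vec_of_pair"
  by (auto intro!: linear_conv_bounded_linear[THEN iffD1] linearI
      simp: vec_eq_iff forall_2)

lemma prod_Basis_real2: "(\<Prod>b\<in>Basis. (v::real^2) \<bullet> b) = v $ 1 * v $ 2"
proof -
  have B: "(Basis :: (real^2) set) = {axis 1 1, axis 2 1}"
    by (auto simp: Basis_vec_def UNIV_2)
  have "axis 1 (1::real) \<noteq> (axis 2 1 :: real^2)" by (simp add: axis_eq_axis)
  then show ?thesis unfolding B by (simp add: inner_axis)
qed

lemma prod_Basis_pair: "(\<Prod>b\<in>Basis. (v::real\<times>real) \<bullet> b) = fst v * snd v"
proof -
  have B: "(Basis :: (real\<times>real) set) = {(1,0), (0,1)}"
    by (auto simp: Basis_prod_def)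
  show ?thesis unfolding B by (simp add: inner_prod_def)
qed

lemma ball_Basis_real2: "(\<forall>b\<in>Basis. P (b::real^2)) \<longleftrightarrow> P (axis 1 1) \<and> P (axis 2 1)"
  by (auto simp: Basis_vec_def forall_2)

lemma ball_Basis_pair: "(\<forall>b\<in>Basis. P (b::real\<times>real)) \<longleftrightarrow> P (1,0) \<and> P (0,1)"
  by (auto simp: Basis_prod_def)

text \<open>Lebesgue measure is determined by its values on boxes, and a box corresponds to a box
  with the same side lengths.\<close>

lemma lborel_pair_of_vec: "distr lborel borel pair_of_vec = lborel"
proof (rule lborel_eqI[symmetric])
  have m [measurable]: "pair_of_vec \<in> borel_measurable borel"
    using bounded_linear_pair_of_vec by (intro borel_measurable_continuous_onI linear_continuous_on)
  fix l u :: "real \<times> real" assume lu: "\<And>b. b \<in> Basis \<Longrightarrow> l \<bullet> b \<le> u \<bullet> b"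
  have "pair_of_vec -` box l u = box (vec_of_pair l) (vec_of_pair u)"
    by (auto simp: box_def pair_of_vec_def inner_axis inner_prod_def ball_Basis_real2 ball_Basis_pair)
  moreover have "\<forall>b\<in>Basis. vec_of_pair l \<bullet> b \<le> vec_of_pair u \<bullet> b"
    using lu[of "(1,0)"] lu[of "(0,1)"]
    unfolding ball_Basis_real2 by (auto simp: inner_axis inner_prod_def Basis_prod_def)
  ultimately show "emeasure (distr lborel borel pair_of_vec) (box l u) = (\<Prod>b\<in>Basis. (u - l) \<bullet> b)"
    by (simp add: emeasure_distr emeasure_lborel_box prod_Basis_real2 prod_Basis_pair)
qed simp

lemma lborel_vec_of_pair: "distr lborel borel vec_of_pair = lborel"
proof (rule lborel_eqI[symmetric])
  have m [measurable]: "vec_of_pair \<in> borel_measurable borel"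
    using bounded_linear_vec_of_pair by (intro borel_measurable_continuous_onI linear_continuous_on)
  fix l u :: "real^2" assume lu: "\<And>b. b \<in> Basis \<Longrightarrow> l \<bullet> b \<le> u \<bullet> b"
  have "vec_of_pair -` box l u = box (pair_of_vec l) (pair_of_vec u)"
    by (auto simp: box_def pair_of_vec_def inner_axis inner_prod_def ball_Basis_real2 ball_Basis_pair)
  moreover have "\<forall>b\<in>Basis. pair_of_vec l \<bullet> b \<le> pair_of_vec u \<bullet> b"
    using lu[of "axis 1 1"] lu[of "axis 2 1"]
    unfolding ball_Basis_pair by (auto simp: inner_axis inner_prod_def pair_of_vec_def)
  ultimately show "emeasure (distr lborel borel vec_of_pair) (box l u) = (\<Prod>b\<in>Basis. (u - l) \<bullet> b)"
    by (simp add: emeasure_distr emeasure_lborel_box prod_Basis_real2 prod_Basis_pair pair_of_vec_def)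
qed simp

lemma borel_measurable_pair_vec:
  "pair_of_vec \<in> borel_measurable borel" "vec_of_pair \<in> borel_measurable borel"
  by (intro borel_measurable_continuous_onI linear_continuous_on bounded_linear_pair_of_vec
      bounded_linear_vec_of_pair)+

lemma set_integral_pair_of_vec:
  fixes f :: "real \<times> real \<Rightarrow> 'c::{banach, second_countable_topology}"
  shows "set_integrable lebesgue (pair_of_vec -` S) (\<lambda>v. f (pair_of_vec v)) \<longleftrightarrow> set_integrable lebesgue S f"
    and "(LINT v:pair_of_vec -` S|lebesgue. f (pair_of_vec v)) = (LINT x:S|lebesgue. f x)"
proof -
  let ?g = "\<lambda>x. indicator S x *\<^sub>R f x"
  have 1: "(\<lambda>v. indicator (pair_of_vec -` S) v *\<^sub>R f (pair_of_vec v)) = (\<lambda>v. ?g (pair_of_vec v))"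
    by (auto simp: indicator_def)
  have *: "integrable lebesgue (\<lambda>v. ?g (pair_of_vec v)) \<longleftrightarrow> integrable lebesgue ?g"
    using integrable_measure_preserving(1)[OF borel_measurable_pair_vec(1) lborel_pair_of_vec, of ?g]
      integrable_measure_preserving(1)[OF borel_measurable_pair_vec(2) lborel_vec_of_pair, of "\<lambda>v. ?g (pair_of_vec v)"]
    by auto
  then show "set_integrable lebesgue (pair_of_vec -` S) (\<lambda>v. f (pair_of_vec v)) \<longleftrightarrow> set_integrable lebesgue S f"
    unfolding set_integrable_def 1 .
  show "(LINT v:pair_of_vec -` S|lebesgue. f (pair_of_vec v)) = (LINT x:S|lebesgue. f x)"
    unfolding set_lebesgue_integral_def 1
    using integrable_measure_preserving(2)[OF borel_measurable_pair_vec(1) lborel_pair_of_vec, of ?g] *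
    by (cases "integrable lebesgue ?g") (auto simp: not_integrable_integral_eq)
qed

text \<open>The change of variables theorem takes vector-valued integrands; a scalar one enters it
  as a vector of length one.\<close>

lemma set_integral_vec1:
  fixes f :: "'a::euclidean_space \<Rightarrow> real"
  shows "set_integrable lebesgue S (\<lambda>x. vec (f x) :: real^1) \<longleftrightarrow> set_integrable lebesgue S f"
    and "set_integrable lebesgue S f \<Longrightarrow>
      (LINT x:S|lebesgue. (vec (f x) :: real^1)) = vec (LINT x:S|lebesgue. f x)"
proof -
  have bl: "bounded_linear (\<lambda>r::real. vec r :: real^1)"
    by (auto intro!: linear_conv_bounded_linear[THEN iffD1] linearI simp: vec_eq_iff)
  have e: "(\<lambda>x. indicator S x *\<^sub>R (vec (f x) :: real^1)) = (\<lambda>x. vec (indicator S x *\<^sub>R f x))"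
    by (auto simp: vec_eq_iff)
  show "set_integrable lebesgue S (\<lambda>x. vec (f x) :: real^1) \<longleftrightarrow> set_integrable lebesgue S f"
    unfolding set_integrable_def e
    using integrable_bounded_linear[OF bl, of lebesgue "\<lambda>x. indicator S x *\<^sub>R f x"]
      integrable_bounded_linear[OF bounded_linear_vec_nth, of lebesgue "\<lambda>x. vec (indicator S x *\<^sub>R f x) :: real^1" 1]
    by auto
  show "(LINT x:S|lebesgue. (vec (f x) :: real^1)) = vec (LINT x:S|lebesgue. f x)" 
    if "set_integrable lebesgue S f"
    using that integral_bounded_linear[OF bl, of lebesgue "\<lambda>x. indicator S x *\<^sub>R f x"]
    unfolding set_lebesgue_integral_def e set_integrable_def by simp
qed

text \<open>\<open>jac\<close> is the modulus of the determinant whose columns are the images of the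
  unit vectors. Derivatives are taken within \<open>S\<close>, so that a half-open rectangle of
  polar coordinates is allowed.\<close>

lemma change_of_variables_plane:
  fixes g :: "real \<times> real \<Rightarrow> real \<times> real" and f :: "real \<times> real \<Rightarrow> real"
  assumes S: "S \<in> sets lebesgue"
    and der: "\<And>x. x \<in> S \<Longrightarrow> (g has_derivative g' x) (at x within S)"
    and inj: "inj_on g S"
    and jac: "\<And>x. x \<in> S \<Longrightarrow>
      jac x = \<bar>fst (g' x (1,0)) * snd (g' x (0,1)) - fst (g' x (0,1)) * snd (g' x (1,0))\<bar>"
  shows "set_integrable lebesgue S (\<lambda>x. jac x * f (g x)) \<longleftrightarrow> set_integrable lebesgue (g ` S) f"
    and "(LINT x:S|lebesgue. jac x * f (g x)) = (LINT x:g ` S|lebesgue. f x)"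
proof -
  let ?S = "pair_of_vec -` S"
  define G where "G = (\<lambda>v. vec_of_pair (g (pair_of_vec v)))"
  define G' where "G' = (\<lambda>v w. vec_of_pair (g' (pair_of_vec v) (pair_of_vec w)))"
  let ?F = "\<lambda>v. vec (f (pair_of_vec v)) :: real^1"
  have mp: "pair_of_vec \<in> lebesgue \<rightarrow>\<^sub>M lebesgue"
    by (rule lebesgue_measure_preserving[OF borel_measurable_pair_vec(1) lborel_pair_of_vec])
  have S': "?S \<in> sets lebesgue"
    using measurable_sets[OF mp S] by simp
  have der': "(G has_derivative G' v) (at v within ?S)" if "v \<in> ?S" for v
  proof -
    have 1: "(pair_of_vec has_derivative pair_of_vec) (at v within ?S)"
      by (rule bounded_linear_imp_has_derivative[OF bounded_linear_pair_of_vec])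
    have "(g has_derivative g' (pair_of_vec v)) (at (pair_of_vec v) within pair_of_vec ` ?S)"
      using that by (intro has_derivative_subset[OF der]) auto
    from has_derivative_in_compose[OF 1 this]
    have "((\<lambda>v. g (pair_of_vec v)) has_derivative (\<lambda>w. g' (pair_of_vec v) (pair_of_vec w))) (at v within ?S)" .
    from bounded_linear.has_derivative[OF bounded_linear_vec_of_pair this]
    show ?thesis by (simp add: G_def G'_def)
  qed
  have inj': "inj_on G ?S"
    using inj unfolding inj_on_def G_def by (metis vec_pair_inverse vimageD)
  have img: "G ` ?S = pair_of_vec -` (g ` S)"
  proof (intro equalityI subsetI)
    fix v assume "v \<in> pair_of_vec -` (g ` S)"
    then obtain x where v: "pair_of_vec v = g x" and x: "x \<in> S" by auto
    have "v = G (vec_of_pair x)"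
      unfolding G_def by (metis v vec_pair_inverse)
    with x show "v \<in> G ` ?S" by auto
  qed (auto simp: G_def)
  have det: "\<bar>det (matrix (G' v))\<bar> = jac (pair_of_vec v)" if "v \<in> ?S" for v
  proof -
    have "pair_of_vec (axis 1 1) = (1,0)" "pair_of_vec (axis 2 1) = (0,1)"
      by (auto simp: pair_of_vec_def axis_def)
    then show ?thesis using that jac[of "pair_of_vec v"]
      by (simp add: det_2 matrix_def G'_def mult.commute)
  qed
  \<comment> \<open>The value \<open>b\<close> is free: putting the actual integral of one side for
    it yields the equivalence of integrability and the equality of the integrals at once.\<close>
  have cov: "(\<lambda>x. \<bar>det (matrix (G' x))\<bar> *\<^sub>R ?F(G x)) absolutely_integrable_on ?S \<and>
           integral ?S (\<lambda>x. \<bar>det (matrix (G' x))\<bar> *\<^sub>R ?F(G x)) = b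
     \<longleftrightarrow> ?F absolutely_integrable_on (G ` ?S) \<and> integral (G ` ?S) ?F = b" for b
    by (rule has_absolute_integral_change_of_variables[OF S' der' inj'])
  have si: "set_integrable lebesgue ?S (\<lambda>x. \<bar>det (matrix (G' x))\<bar> *\<^sub>R ?F(G x)) \<longleftrightarrow>
     set_integrable lebesgue ?S (\<lambda>v. (\<lambda>x. vec (jac x * f (g x)) :: real^1) (pair_of_vec v))"
    unfolding set_integrable_def
    by (intro Bochner_Integration.integrable_cong) (auto simp: det G_def vec_eq_iff indicator_def)
  have li: "(LINT x:?S|lebesgue. \<bar>det (matrix (G' x))\<bar> *\<^sub>R ?F(G x)) =
     (LINT v:?S|lebesgue. (\<lambda>x. vec (jac x * f (g x)) :: real^1) (pair_of_vec v))"
    unfolding set_lebesgue_integral_def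
    by (intro Bochner_Integration.integral_cong) (auto simp: det G_def vec_eq_iff indicator_def)
  have L: "set_integrable lebesgue S (\<lambda>x. jac x * f (g x)) \<longleftrightarrow>
      (\<lambda>x. \<bar>det (matrix (G' x))\<bar> *\<^sub>R ?F(G x)) absolutely_integrable_on ?S"
    unfolding si by (rule trans[OF set_integral_vec1(1)[symmetric]
          set_integral_pair_of_vec(1)[of S "\<lambda>x. vec (jac x * f (g x)) :: real^1", symmetric]])
  have R: "set_integrable lebesgue (g ` S) f \<longleftrightarrow> ?F absolutely_integrable_on (G ` ?S)"
    unfolding img by (rule trans[OF set_integral_vec1(1)[symmetric]
          set_integral_pair_of_vec(1)[of "g ` S" "\<lambda>x. vec (f x) :: real^1", symmetric]])
  show 1: "set_integrable lebesgue S (\<lambda>x. jac x * f (g x)) \<longleftrightarrow> set_integrable lebesgue (g ` S) f"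
    unfolding L R using cov by blast
  show "(LINT x:S|lebesgue. jac x * f (g x)) = (LINT x:g ` S|lebesgue. f x)"
  proof (cases "set_integrable lebesgue S (\<lambda>x. jac x * f (g x))")
    case True
    with 1 have True': "set_integrable lebesgue (g ` S) f" by simp
    have "(vec (LINT x:S|lebesgue. jac x * f (g x)) :: real^1) =
       integral ?S (\<lambda>x. \<bar>det (matrix (G' x))\<bar> *\<^sub>R ?F(G x))"
      using set_lebesgue_integral_eq_integral(2)[OF True[unfolded L]]
      unfolding li set_integral_pair_of_vec(2)[of S "\<lambda>x. vec (jac x * f (g x)) :: real^1"]
      by (simp add: set_integral_vec1(2)[OF True])
    also have "\<dots> = integral (G ` ?S) ?F"
      using cov True[unfolded L] by blast
    also have "\<dots> = vec (LINT x:g ` S|lebesgue. f x)"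
      using set_lebesgue_integral_eq_integral(2)[OF True'[unfolded R]]
      unfolding img set_integral_pair_of_vec(2)[of "g ` S" "\<lambda>x. vec (f x) :: real^1"]
      by (simp add: set_integral_vec1(2)[OF True'])
    finally show ?thesis by (simp add: vec_eq_iff)
  next
    case False
    \<comment> \<open>Without integrability both sides have the default value 0, so the equation
      needs no integrability hypothesis.\<close>
    then have "\<not> set_integrable lebesgue (g ` S) f" using 1 by simp
    with False show ?thesis
      by (simp add: set_lebesgue_integral_def set_integrable_def not_integrable_integral_eq)
  qed
qed


subsection \<open>Polar coordinates\<close>

text \<open>A consequence of completeness: preimages under \<open>f\<close> and \<open>g\<close>
  differ by a subset of a null set.\<close>

lemma borel_measurable_AE_cong:
  fixes f g :: "'a::euclidean_space \<Rightarrow> 'b::topological_space"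
  assumes f: "f \<in> borel_measurable lebesgue" and eq: "AE x in lebesgue. f x = g x"
  shows "g \<in> borel_measurable lebesgue"
proof (rule measurableI)
  fix A :: "'b set" assume "A \<in> sets borel"
  then have A: "f -` A \<inter> space lebesgue \<in> sets lebesgue"
    using f by (rule measurable_sets[rotated])
  have "AE x in lebesgue. x \<in> f -` A \<inter> space lebesgue \<longleftrightarrow> x \<in> g -` A \<inter> space lebesgue"
    using eq by eventually_elim auto
  then show "g -` A \<inter> space lebesgue \<in> sets lebesgue"
    by (rule completion.in_sets_AE[OF _ A]) auto
qed auto

lemma integral_lebesgue_AE_cong:
  fixes f g :: "'a::euclidean_space \<Rightarrow> 'b::{banach, second_countable_topology}"
  assumes "integrable lebesgue f" "AE x in lebesgue. f x = g x"
  shows "integrable lebesgue g" "(LINT x|lebesgue. g x) = (LINT x|lebesgue. f x)"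
proof -
  have m: "g \<in> borel_measurable lebesgue" "f \<in> borel_measurable lebesgue"
    using borel_measurable_AE_cong[OF _ assms(2)] assms(1) by auto
  show "integrable lebesgue g"
    using integrable_cong_AE_imp[OF assms(1) m(1)] assms(2) by auto
  show "(LINT x|lebesgue. g x) = (LINT x|lebesgue. f x)"
    using assms(2) by (intro integral_cong_AE m) auto
qed

text \<open>\<open>lebesgue\<close> on the plane is a completion and not a product measure. Fubini's
  theorem is applied to a Borel representative \<open>k\<close> of \<open>h\<close>; almost every
  slice of the null set where they differ is null, so the conclusions return to \<open>h\<close>
  slice by slice.\<close>

lemma Fubini_lebesgue:
  fixes h :: "real \<times> real \<Rightarrow> real"
  assumes h: "integrable lebesgue h"
  shows "AE x in lebesgue. integrable lebesgue (\<lambda>y. h (x, y))"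
    and "integrable lebesgue (\<lambda>x. LINT y|lebesgue. h (x, y))"
    and "(LINT x|lebesgue. LINT y|lebesgue. h (x, y)) = (LINT z|lebesgue. h z)"
proof -
  have hm: "h \<in> borel_measurable lebesgue" using h by auto
  obtain k where k [measurable]: "k \<in> borel_measurable lborel" and hk: "AE z in lborel. h z = k z"
    using completion_ex_borel_measurable_real[OF hm] by auto
  have hk': "AE z in lebesgue. h z = k z" using hk by (rule AE_completion)
  have "integrable lebesgue k"
    by (rule integral_lebesgue_AE_cong(1)[OF h hk'])
  then have "integrable lborel k" by (simp add: integrable_completion)
  then have k2: "integrable (lborel \<Otimes>\<^sub>M lborel) k" by (simp add: lborel_prod)
  have ae: "AE x in lborel. AE y in lborel. h (x, y) = k (x, y)"
    by (rule lborel_pair.AE_pair[of "\<lambda>z. h z = k z", unfolded lborel_prod, OF hk])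
  have ae_int: "AE x in lborel. integrable lborel (\<lambda>y. k (x, y))"
    using lborel_pair.AE_integrable_fst'[OF k2] .
  have km: "(\<lambda>y. k (x, y)) \<in> borel_measurable lborel" for x
    by simp
  have *: "integrable lebesgue (\<lambda>y. h (x, y)) \<and>
      (LINT y|lborel. k (x, y)) = (LINT y|lebesgue. h (x, y))"
    if "AE y in lborel. h (x, y) = k (x, y)" "integrable lborel (\<lambda>y. k (x, y))" for x
  proof -
    have a: "AE y in lebesgue. k (x, y) = h (x, y)"
      using AE_completion[OF that(1)] by eventually_elim auto
    have b: "integrable lebesgue (\<lambda>y. k (x, y))"
      using that(2) km by (simp add: integrable_completion)
    show ?thesis
      using integral_lebesgue_AE_cong[OF b a] km by (simp add: integral_completion)
  qed
  from ae ae_int have ae2: "AE x in lborel. integrable lebesgue (\<lambda>y. h (x, y)) \<and>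
      (LINT y|lborel. k (x, y)) = (LINT y|lebesgue. h (x, y))"
    by eventually_elim (rule *)
  show "AE x in lebesgue. integrable lebesgue (\<lambda>y. h (x, y))"
    using AE_completion[OF ae2] by eventually_elim auto
  have i: "integrable lborel (\<lambda>x. LINT y|lborel. k (x, y))"
    using lborel_pair.integrable_fst'[OF k2] .
  then have i': "integrable lebesgue (\<lambda>x. LINT y|lborel. k (x, y))"
    by (subst integrable_completion) auto
  have a: "AE x in lebesgue. (LINT y|lborel. k (x, y)) = (LINT y|lebesgue. h (x, y))"
    using AE_completion[OF ae2] by eventually_elim auto
  note ii = integral_lebesgue_AE_cong[OF i' a]
  show "integrable lebesgue (\<lambda>x. LINT y|lebesgue. h (x, y))" by (rule ii(1))
  have "(LINT x|lebesgue. LINT y|lebesgue. h (x, y)) = (LINT x|lborel. LINT y|lborel. k (x, y))"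
    using i by (simp add: ii(2) integral_completion)
  also have "\<dots> = (LINT z|lborel. k z)"
    using lborel_pair.integral_fst'[OF k2] by (simp add: lborel_prod)
  also have "\<dots> = (LINT z|lebesgue. k z)"
    by (simp add: integral_completion)
  also have "\<dots> = (LINT z|lebesgue. h z)"
    by (rule integral_lebesgue_AE_cong(2)[OF h hk'])
  finally show "(LINT x|lebesgue. LINT y|lebesgue. h (x, y)) = (LINT z|lebesgue. h z)" .
qed

section \<open>The polar map and integration over discs\<close>

lemma has_derivative_circ:
  "((\<lambda>p. circ X0 (fst p) (snd p)) has_derivative
     (\<lambda>v. (fst v * cos (snd p) - snd v * (fst p * sin (snd p)),
           fst v * sin (snd p) + snd v * (fst p * cos (snd p))))) (at p within S)"
proof -
  have e: "(\<lambda>p. circ X0 (fst p) (snd p)) =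
      (\<lambda>p. X0 + (fst p * cos (snd p), fst p * sin (snd p)))"
    by (auto simp: circ_def)
  show ?thesis
    unfolding e by (rule has_derivative_eq_rhs)
      (auto intro!: derivative_eq_intros has_derivative_Pair simp: fun_eq_iff algebra_simps)
qed

lemma norm_circ: "0 \<le> r \<Longrightarrow> norm (circ X0 r \<theta> - X0) = r"
  by (simp add: circ_def norm_Pair power_mult_distrib distrib_left[symmetric])

text \<open>A positive radius and a half-open range of angles make the polar map a bijection onto
  the punctured disc; what is lost is a null set.\<close>

lemma circ_polar_image:
  assumes "0 < R"
  shows "(\<lambda>p. circ X0 (fst p) (snd p)) ` ({0<..<R} \<times> {0..<2*pi}) = ball X0 R - {X0}"
proof (intro equalityI subsetI)
  fix X assume "X \<in> (\<lambda>p. circ X0 (fst p) (snd p)) ` ({0<..<R} \<times> {0..<2*pi})"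
  then obtain r t where X: "X = circ X0 r t" "0 < r" "r < R" by auto
  then have "norm (X - X0) = r" by (simp add: norm_circ)
  then show "X \<in> ball X0 R - {X0}" using X by (auto simp: dist_norm norm_minus_commute)
next
  fix X assume X: "X \<in> ball X0 R - {X0}"
  define r where "r = norm (X - X0)"
  have r: "0 < r" "r < R" using X by (auto simp: r_def dist_norm norm_minus_commute)
  obtain a b where ab: "X - X0 = (a, b)" by (cases "X - X0")
  have "a\<^sup>2 + b\<^sup>2 = r\<^sup>2" using r by (simp add: r_def ab norm_Pair)
  then have "(a / r)\<^sup>2 + (b / r)\<^sup>2 = 1"
    using r by (simp add: power_divide add_divide_distrib[symmetric])
  then obtain t where t: "0 \<le> t" "t < 2 * pi" "a / r = cos t" "b / r = sin t"
    by (rule sincos_total_2pi)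
  have "X = circ X0 r t"
    using ab r t(3,4) by (auto simp: circ_def field_simps)
  then show "X \<in> (\<lambda>p. circ X0 (fst p) (snd p)) ` ({0<..<R} \<times> {0..<2*pi})"
    using r t by (auto intro!: image_eqI[of _ _ "(r, t)"])
qed

lemma circ_polar_inj:
  "inj_on (\<lambda>p. circ X0 (fst p) (snd p)) ({0<..<R} \<times> {0..<2*pi})"
proof (rule inj_onI, clarsimp)
  fix r t s u assume *: "circ X0 r t = circ X0 s u" "0 < r" "0 < s" "0 \<le> t" "t < 2 * pi" "0 \<le> u" "u < 2 * pi"
  then have rs: "r = s" using norm_circ[of r X0 t] norm_circ[of s X0 u] by simp
  with * have "sin t = sin u \<and> cos t = cos u" by (auto simp: circ_def)
  then obtain n :: int where n: "t = u + 2 * pi * n" using sin_cos_eq_iff by blast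
  have "\<bar>2 * pi * n\<bar> < 2 * pi" using n * by linarith
  then have "n = 0" by (simp add: abs_mult)
  with n rs show "r = s \<and> t = u" by simp
qed

lemma sets_lebesgue_borel: "S \<in> sets borel \<Longrightarrow> S \<in> sets lebesgue"
  by (metis sets_completionI_sets sets_lborel)

text \<open>Change of variables on the polar rectangle followed by Fubini. The Jacobian
  \<open>r\<close> is the arc length factor inside \<open>circle_integral\<close>.\<close>

lemma polar_coordinates:
  fixes g :: "real \<times> real \<Rightarrow> real"
  assumes R: "0 < R" and g: "set_integrable lebesgue (ball X0 R) g"
  shows "AE r in lebesgue. r \<in> {0<..<R} \<longrightarrow> set_integrable lebesgue {0..2*pi} (\<lambda>\<theta>. g (circ X0 r \<theta>))"
    and "set_integrable lebesgue {0<..<R} (\<lambda>r. circle_integral X0 r g)"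
    and "(LINT X:ball X0 R|lebesgue. g X) = (LINT r:{0<..<R}|lebesgue. circle_integral X0 r g)"
proof -
  let ?S = "{0<..<R} \<times> {0..<2*pi}"
  let ?h = "\<lambda>p. fst p * g (circ X0 (fst p) (snd p))"
  have ball: "ball X0 R = insert X0 (ball X0 R - {X0})" using R by auto
  have S: "?S \<in> sets lebesgue"
    by (rule sets_lebesgue_borel) (simp add: borel_Times)
  \<comment> \<open>Written in the unreduced form that \<open>has_derivative_circ\<close> induces in
    \<open>change_of_variables_plane\<close>; the value is \<open>fst p\<close> because cos^2 +
    sin^2 = 1.\<close>
  have jac: "fst p = \<bar>fst (fst (1::real, 0::real) * cos (snd p) - snd (1, 0) * (fst p * sin (snd p)), fst (1, 0) * sin (snd p) + snd (1, 0) * (fst p * cos (snd p))) *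
      snd (fst (0, 1::real) * cos (snd p) - snd (0::real, 1) * (fst p * sin (snd p)), fst (0, 1) * sin (snd p) + snd (0, 1) * (fst p * cos (snd p))) -
      fst (fst (0, 1) * cos (snd p) - snd (0, 1) * (fst p * sin (snd p)), fst (0, 1) * sin (snd p) + snd (0, 1) * (fst p * cos (snd p))) *
      snd (fst (1, 0) * cos (snd p) - snd (1, 0) * (fst p * sin (snd p)), fst (1, 0) * sin (snd p) + snd (1, 0) * (fst p * cos (snd p)))\<bar>" if "p \<in> ?S" for p :: "real \<times> real"
  proof -
    have e: "fst p * (cos (snd p) * cos (snd p)) + fst p * (sin (snd p) * sin (snd p)) = fst p"
      using sin_cos_squared_add3[of "snd p"] by (metis distrib_left mult.right_neutral)
    show ?thesis using that e by (simp add: mem_Times_iff algebra_simps)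
  qed
  have cov: "set_integrable lebesgue ?S ?h \<longleftrightarrow> set_integrable lebesgue (ball X0 R - {X0}) g"
     "(LINT p:?S|lebesgue. ?h p) = (LINT X:ball X0 R - {X0}|lebesgue. g X)"
    unfolding circ_polar_image[OF R, symmetric]
    by (rule change_of_variables_plane[OF S has_derivative_circ circ_polar_inj jac]; assumption)+
  have gi: "set_integrable lebesgue (ball X0 R - {X0}) g"
    by (rule set_integrable_subset[OF g]) auto
  have hi: "set_integrable lebesgue ?S ?h"
    using cov(1) gi by simp
  have h_eq: "(LINT p:?S|lebesgue. ?h p) = (LINT X:ball X0 R|lebesgue. g X)"
  proof -
    have "(LINT X:ball X0 R|lebesgue. g X) = (LINT X:ball X0 R - {X0}|lebesgue. g X)"
      by (rule set_integral_discrete_difference[of "{X0}"]) (auto intro: sets_lebesgue_borel)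
    then show ?thesis using cov(2) by simp
  qed
  let ?H = "\<lambda>p. indicator ?S p *\<^sub>R ?h p"
  note F = Fubini_lebesgue[OF hi[unfolded set_integrable_def]]
  \<comment> \<open>Injectivity requires the half-open interval of angles,
    \<open>circle_integral\<close> uses the closed one; the endpoint is null.\<close>
  have pt: "set_integrable lebesgue {0..<2*pi} f \<longleftrightarrow> set_integrable lebesgue {0..2*pi} f"
      "(LINT t:{0..<2*pi}|lebesgue. f t) = (LINT t:{0..2*pi}|lebesgue. f t)" for f :: "real \<Rightarrow> real"
    by (rule set_integrable_discrete_difference[of "{2*pi}"] set_integral_discrete_difference[of "{2*pi}"];
      auto intro: sets_lebesgue_borel)+
  have H: "?H (r, t) = indicator {0<..<R} r * (indicator {0..<2*pi} t *\<^sub>R (r * g (circ X0 r t)))" for r t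
    by (simp add: indicator_times)
  show "AE r in lebesgue. r \<in> {0<..<R} \<longrightarrow> set_integrable lebesgue {0..2*pi} (\<lambda>\<theta>. g (circ X0 r \<theta>))"
    using F(1)
  proof eventually_elim
    case (elim r)
    show ?case
    proof
      assume r: "r \<in> {0<..<R}"
      then have "set_integrable lebesgue {0..<2*pi} (\<lambda>t. r * g (circ X0 r t))"
        using elim unfolding set_integrable_def H by simp
      then have "set_integrable lebesgue {0..2*pi} (\<lambda>t. r * g (circ X0 r t))" unfolding pt .
      then show "set_integrable lebesgue {0..2*pi} (\<lambda>t. g (circ X0 r t))" using r by simp
    qed
  qed
  have c: "(LINT t|lebesgue. ?H (r, t)) = indicator {0<..<R} r *\<^sub>R circle_integral X0 r g" for r
  proof -
    have "(LINT t|lebesgue. ?H (r, t)) = indicator {0<..<R} r * (LINT t:{0..<2*pi}|lebesgue. r * g (circ X0 r t))"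
      unfolding H set_lebesgue_integral_def by simp
    then show ?thesis
      unfolding pt circle_integral_def by (simp add: mult.commute)
  qed
  show "set_integrable lebesgue {0<..<R} (\<lambda>r. circle_integral X0 r g)"
    using F(2) unfolding set_integrable_def c .
  show "(LINT X:ball X0 R|lebesgue. g X) = (LINT r:{0<..<R}|lebesgue. circle_integral X0 r g)"
    using F(3) h_eq unfolding set_lebesgue_integral_def c by simp
qed


subsection \<open>Differentiation of integrals with respect to a parameter\<close>

text \<open>Dominated convergence for difference quotients. Both \<open>der\<close> and
  \<open>lip\<close> concern the base point \<open>e0\<close> only and hold almost everywhere, so a
  kink of \<open>G e x\<close> at \<open>e0\<close> is harmless as long as it occurs on a null set
  of \<open>x\<close>.\<close>

lemma has_derivative_integral_parameter:
  fixes G :: "real \<Rightarrow> 'a \<Rightarrow> real"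
  assumes d: "0 < d" and int: "\<And>e. \<bar>e - e0\<bar> < d \<Longrightarrow> integrable M (G e)"
    and H: "integrable M H" and G': "G' \<in> borel_measurable M"
    and der: "AE x in M. ((\<lambda>e. G e x) has_real_derivative G' x) (at e0)"
    and lip: "\<And>e. \<bar>e - e0\<bar> < d \<Longrightarrow> AE x in M. \<bar>G e x - G e0 x\<bar> \<le> H x * \<bar>e - e0\<bar>"
  shows "((\<lambda>e. LINT x|M. G e x) has_real_derivative (LINT x|M. G' x)) (at e0)"
  unfolding has_field_derivative_iff tendsto_at_iff_sequentially
proof (intro allI impI)
  fix X :: "nat \<Rightarrow> real" assume X: "\<forall>i. X i \<in> UNIV - {e0}" and lim: "X \<longlonglongrightarrow> e0"
  from lim d have "\<forall>\<^sub>F i in sequentially. dist (X i) e0 < d" by (rule tendstoD)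
  then obtain N where N: "\<And>i. N \<le> i \<Longrightarrow> \<bar>X i - e0\<bar> < d"
    unfolding eventually_sequentially dist_real_def by auto
  \<comment> \<open>Dropping the first \<open>N\<close> terms keeps the whole sequence in the range
    where \<open>int\<close> and \<open>lip\<close> apply.\<close>
  define Y where "Y i = X (i + N)" for i
  have Y: "\<bar>Y i - e0\<bar> < d" "Y i \<noteq> e0" for i using N[of "i+N"] X by (auto simp: Y_def)
  have Ylim: "Y \<longlonglongrightarrow> e0" unfolding Y_def using lim by (rule LIMSEQ_ignore_initial_segment)
  have e0: "integrable M (G e0)" using int[of e0] d by simp
  let ?Q = "\<lambda>i x. (G (Y i) x - G e0 x) / (Y i - e0)"
  have "(\<lambda>i. LINT x|M. ?Q i x) \<longlonglongrightarrow> (LINT x|M. G' x)"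
  proof (rule integral_dominated_convergence[OF G' _ H])
    show "?Q i \<in> borel_measurable M" for i
      using int[OF Y(1)[of i]] e0 by (intro borel_measurable_divide borel_measurable_diff) auto
    show "AE x in M. (\<lambda>i. ?Q i x) \<longlonglongrightarrow> G' x"
      using der
    proof eventually_elim
      case (elim x)
      then have "((\<lambda>e. (G e x - G e0 x) / (e - e0)) \<longlongrightarrow> G' x) (at e0)"
        by (simp add: has_field_derivative_iff)
      from this[unfolded tendsto_at_iff_sequentially, rule_format, of Y] Y Ylim
      show ?case by (auto simp: comp_def)
    qed
    show "AE x in M. norm (?Q i x) \<le> H x" for i
      using lip[OF Y(1)[of i]] by eventually_elim (use Y(2)[of i] in \<open>simp add: field_simps\<close>)
  qed
  moreover have eq: "(LINT x|M. ?Q i x) = ((LINT x|M. G (Y i) x) - (LINT x|M. G e0 x)) / (Y i - e0)" for i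
    using int[OF Y(1)[of i]] e0 by simp
  ultimately have "(\<lambda>i. ((LINT x|M. G (X (i+N)) x) - (LINT x|M. G e0 x)) / (X (i+N) - e0)) \<longlonglongrightarrow> (LINT x|M. G' x)"
    unfolding eq by (simp add: Y_def)
  from LIMSEQ_offset[OF this] 
  show "((\<lambda>y. ((LINT x|M. G y x) - (LINT x|M. G e0 x)) / (y - e0)) \<circ> X) \<longlonglongrightarrow> (LINT x|M. G' x)"
    by (simp add: comp_def)
qed

text \<open>\<open>integrable_ccontinuous_explicit\<close> differentiates from the right. Applied to
  the reflected function \<open>h (- x)\<close> it gives the derivative from the left, and its
  exceptional set is reflected back.\<close>

lemma lebesgue_differentiation_real:
  fixes h :: "real \<Rightarrow> real"
  assumes h: "integrable lebesgue h"
  shows "AE r in lebesgue. a < r \<longrightarrow>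
    ((\<lambda>r. LINT x:{a<..<r}|lebesgue. h x) has_real_derivative h r) (at r)"
proof -
  have hi: "h absolutely_integrable_on S" if "S \<in> sets lebesgue" for S
    using set_integrable_subset[of lebesgue UNIV h S] h that by (simp add: set_integrable_def)
  have hcb: "h integrable_on {u..v}" for u v
    using hi[of "{u..v}"] by (auto intro: set_lebesgue_integral_eq_integral(1))
  have hcb': "(\<lambda>x. h (- x)) integrable_on {u..v}" for u v
    using hcb[of "-v" "-u"] Henstock_Kurzweil_Integration.integrable_reflect_real[of h "-u" "-v"] by simp
  from integrable_ccontinuous_explicit[of h] hcb obtain N1 where N1: "negligible N1"
    "\<And>x e. \<lbrakk>x \<notin> N1; 0 < e\<rbrakk> \<Longrightarrow> \<exists>d>0. \<forall>k. 0 < k \<and> k < d \<longrightarrow>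
        norm(integral {x..x + k} h /\<^sub>R k - h x) < e" by auto
  from integrable_ccontinuous_explicit[of "\<lambda>x. h (- x)"] hcb' obtain N2 where N2: "negligible N2"
    "\<And>x e. \<lbrakk>x \<notin> N2; 0 < e\<rbrakk> \<Longrightarrow> \<exists>d>0. \<forall>k. 0 < k \<and> k < d \<longrightarrow>
        norm(integral {x..x + k} (\<lambda>x. h (-x)) /\<^sub>R k - h (-x)) < e" by auto
  have "negligible (uminus ` N2)"
    using N2(1) by (intro negligible_differentiable_image_negligible) (auto intro!: derivative_intros)
  then have "N1 \<union> uminus ` N2 \<in> null_sets lebesgue"
    using N1(1) by (simp add: negligible_iff_null_sets[symmetric])
  then have "AE r in lebesgue. r \<notin> N1 \<union> uminus ` N2" by (rule AE_not_in)
  then show ?thesis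
  proof eventually_elim
    case (elim r)
    then have r: "r \<notin> N1" "- r \<notin> N2" by (auto simp: image_iff)
    show ?case
    proof
      assume ar: "a < r"
      have F: "(LINT x:{a<..<s}|lebesgue. h x) = integral {a..s} h" for s
        using set_lebesgue_integral_eq_integral(2)[OF hi[of "{a<..<s}"]]
        by (simp add: integral_open_interval_real)
      have ev: "((\<lambda>y. ((LINT x:{a<..<y}|lebesgue. h x) - (LINT x:{a<..<r}|lebesgue. h x)) / (y - r)) \<longlongrightarrow> h r) (at r)"
        unfolding LIM_def
      proof (intro allI impI)
        fix e :: real assume e: "0 < e"
        obtain d1 where d1: "d1 > 0" "\<And>k. 0 < k \<Longrightarrow> k < d1 \<Longrightarrow> norm(integral {r..r + k} h /\<^sub>R k - h r) < e"
          using N1(2)[OF r(1) e] by blast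
        obtain d2 where d2: "d2 > 0" "\<And>k. 0 < k \<Longrightarrow> k < d2 \<Longrightarrow> norm(integral {-r..-r + k} (\<lambda>x. h (-x)) /\<^sub>R k - h (- (-r))) < e"
          using N2(2)[OF r(2) e] by blast
        show "\<exists>s>0. \<forall>y. y \<noteq> r \<and> dist y r < s \<longrightarrow>
          dist (((LINT x:{a<..<y}|lebesgue. h x) - (LINT x:{a<..<r}|lebesgue. h x)) / (y - r)) (h r) < e"
        proof (intro exI[of _ "min (min d1 d2) (r - a)"] conjI allI impI)
          show "0 < min (min d1 d2) (r - a)" using d1 d2 ar by simp
          fix y assume y: "y \<noteq> r \<and> dist y r < min (min d1 d2) (r - a)"
          show "dist (((LINT x:{a<..<y}|lebesgue. h x) - (LINT x:{a<..<r}|lebesgue. h x)) / (y - r)) (h r) < e"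
          proof (cases "r < y")
            case True
            then have "integral {a..r} h + integral {r..y} h = integral {a..y} h"
              using ar hcb by (intro Henstock_Kurzweil_Integration.integral_combine) auto
            then show ?thesis unfolding F using d1(2)[of "y - r"] True y
              by (simp add: dist_real_def field_simps)
          next
            case False
            with y have yr: "y < r" by auto
            have ay: "a < y" using y yr by (simp add: dist_real_def)
            have "integral {a..y} h + integral {y..r} h = integral {a..r} h"
              using ay yr hcb by (intro Henstock_Kurzweil_Integration.integral_combine) auto
            moreover have "integral {-r..-y} (\<lambda>x. h (-x)) = integral {y..r} h"
              by simp
            ultimately show ?thesis unfolding F using d2(2)[of "r - y"] yr y
              by (simp add: dist_real_def field_simps)
          qed
        qed
      qed
      then show "((\<lambda>r. LINT x:{a<..<r}|lebesgue. h x) has_real_derivative h r) (at r)"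
        by (simp add: has_field_derivative_iff)
    qed
  qed
qed

section \<open>Measurable and integrable products on a set\<close>

lemma set_borel_measurable_continuous_on:
  fixes q :: "'a::euclidean_space \<Rightarrow> 'b::euclidean_space"
  assumes "continuous_on S q" "S \<in> sets lebesgue"
  shows "set_borel_measurable lebesgue S q"
  using continuous_imp_measurable_on_sets_lebesgue[OF assms] assms(2)
  by (simp add: set_borel_measurable_def borel_measurable_restrict_space_iff)

lemma set_borel_measurable_scaleR:
  fixes w :: "'a \<Rightarrow> 'b::{second_countable_topology, real_normed_vector}"
  assumes "set_borel_measurable M S q" "set_borel_measurable M S w"
  shows "set_borel_measurable M S (\<lambda>x. q x *\<^sub>R w x)"
proof -
  have e: "(\<lambda>x. indicator S x *\<^sub>R q x *\<^sub>R w x) = (\<lambda>x. (indicator S x *\<^sub>R q x) *\<^sub>R (indicator S x *\<^sub>R w x))"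
    by (auto simp: indicator_def)
  show ?thesis
    using assms unfolding set_borel_measurable_def e by (rule borel_measurable_scaleR)
qed

lemma set_borel_measurable_mult:
  fixes w q :: "'a \<Rightarrow> real"
  assumes "set_borel_measurable M S q" "set_borel_measurable M S w"
  shows "set_borel_measurable M S (\<lambda>x. q x * w x)"
  using set_borel_measurable_scaleR[OF assms] by simp

lemma set_integrable_imp_measurable: "set_integrable M S w \<Longrightarrow> set_borel_measurable M S w"
  unfolding set_integrable_def set_borel_measurable_def by auto

lemma set_integrable_bounded_scaleR:
  fixes w :: "'a \<Rightarrow> 'b::{banach, second_countable_topology}"
  assumes q: "set_borel_measurable M S q" and b: "\<And>x. x \<in> S \<Longrightarrow> \<bar>q x\<bar> \<le> B"
    and w: "set_integrable M S w"
  shows "set_integrable M S (\<lambda>x. q x *\<^sub>R w x)"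
proof (rule set_integrable_bound)
  show "set_integrable M S (\<lambda>x. B *\<^sub>R w x)"
    using w by (rule set_integrable_scaleR_right)
  show "set_borel_measurable M S (\<lambda>x. q x *\<^sub>R w x)"
    by (intro set_borel_measurable_scaleR q set_integrable_imp_measurable w)
  show "AE x in M. x \<in> S \<longrightarrow> norm (q x *\<^sub>R w x) \<le> norm (B *\<^sub>R w x)"
  proof (intro AE_I2 impI)
    fix x assume "x \<in> S"
    then have "\<bar>q x\<bar> \<le> \<bar>B\<bar>" using b[of x] by linarith
    then show "norm (q x *\<^sub>R w x) \<le> norm (B *\<^sub>R w x)"
      by (simp add: mult_right_mono)
  qed
qed

lemma set_integrable_bounded_mult:
  fixes w :: "'a \<Rightarrow> real"
  assumes "set_borel_measurable M S q" "\<And>x. x \<in> S \<Longrightarrow> \<bar>q x\<bar> \<le> B" "set_integrable M S w"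
  shows "set_integrable M S (\<lambda>x. q x * w x)"
  using set_integrable_bounded_scaleR[OF assms] by simp

lemma has_derivative_set_integral_parameter:
  fixes G :: "real \<Rightarrow> 'a \<Rightarrow> real"
  assumes d: "0 < d" and int: "\<And>e. \<bar>e - e0\<bar> < d \<Longrightarrow> set_integrable M S (G e)"
    and H: "set_integrable M S H" and G': "set_borel_measurable M S G'"
    and der: "AE x in M. x \<in> S \<longrightarrow> ((\<lambda>e. G e x) has_real_derivative G' x) (at e0)"
    and lip: "\<And>e x. \<bar>e - e0\<bar> < d \<Longrightarrow> x \<in> S \<Longrightarrow> \<bar>G e x - G e0 x\<bar> \<le> H x * \<bar>e - e0\<bar>"
  shows "((\<lambda>e. LINT x:S|M. G e x) has_real_derivative (LINT x:S|M. G' x)) (at e0)"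
  unfolding set_lebesgue_integral_def
proof (rule has_derivative_integral_parameter[OF d])
  show "integrable M (\<lambda>x. indicat_real S x *\<^sub>R G e x)" if "\<bar>e - e0\<bar> < d" for e
    using int[OF that] unfolding set_integrable_def .
  show "integrable M (\<lambda>x. indicat_real S x *\<^sub>R H x)"
    using H unfolding set_integrable_def .
  show "(\<lambda>x. indicat_real S x *\<^sub>R G' x) \<in> borel_measurable M"
    using G' unfolding set_borel_measurable_def .
  show "AE x in M. ((\<lambda>e. indicat_real S x *\<^sub>R G e x) has_real_derivative indicat_real S x *\<^sub>R G' x) (at e0)"
    using der
  proof eventually_elim
    case (elim x)
    then show ?case by (cases "x \<in> S") auto
  qed
  show "AE x in M. \<bar>indicat_real S x *\<^sub>R G e x - indicat_real S x *\<^sub>R G e0 x\<bar> \<le> indicat_real S x *\<^sub>R H x * \<bar>e - e0\<bar>"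
    if "\<bar>e - e0\<bar> < d" for e
    by (intro AE_I2) (use lip[OF that] in \<open>auto simp: indicator_def\<close>)
qed

text \<open>With an exponent of at least two the difference quotient at the kink tends to
  zero.\<close>

lemma has_derivative_pos_power:
  fixes x :: real
  shows "((\<lambda>x. max 0 x ^ Suc (Suc n)) has_real_derivative real (Suc (Suc n)) * max 0 x ^ Suc n) (at x)"
proof (rule linorder_cases[of x 0])
  assume less: "x < 0"
  have "((\<lambda>x::real. 0) has_real_derivative 0) (at x)" by simp
  moreover have "\<forall>\<^sub>F y in nhds x. max 0 y ^ Suc (Suc n) = 0"
    using eventually_nhds_in_open[of "{..<0}" x] less by (auto elim!: eventually_mono)
  ultimately show ?thesis using less
    by (subst DERIV_cong_ev[OF refl _ refl, where g = "\<lambda>x. 0"]) auto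
next
  assume greater: "0 < x"
  have "((\<lambda>x::real. x ^ Suc (Suc n)) has_real_derivative (Suc (Suc n)) * x ^ Suc n) (at x)"
    by (rule derivative_eq_intros refl | simp)+
  moreover have "\<forall>\<^sub>F y in nhds x. max 0 y ^ Suc (Suc n) = y ^ Suc (Suc n)"
    using eventually_nhds_in_open[of "{0<..}" x] greater by (auto elim!: eventually_mono)
  ultimately show ?thesis using greater
    by (subst DERIV_cong_ev[OF refl _ refl, where g = "\<lambda>x. x ^ Suc (Suc n)"]) auto
next
  assume equal: "x = 0"
  have "((\<lambda>h::real. max 0 h ^ Suc n) \<longlongrightarrow> max 0 0 ^ Suc n) (at 0)"
    by (intro tendsto_intros)
  then have 1: "((\<lambda>h::real. max 0 h ^ Suc n) \<longlongrightarrow> 0) (at 0)" by simp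
  have "((\<lambda>h::real. max 0 h ^ Suc (Suc n) / h) \<longlongrightarrow> 0) (at 0)"
    by (rule Lim_transform_eventually[OF 1]) (auto simp: eventually_at_filter max_def intro!: always_eventually)
  then show ?thesis using equal by (simp add: has_field_derivative_iff)
qed

text \<open>Differences of powers are factored. The difference of the arguments is a separate
  variable \<open>d\<close>, so that the common term |Z|^2 drops out of the bound when
  \<open>a\<close> and \<open>b\<close> are \<open>e - |Z|^2\<close> and
  \<open>\<alpha> - |Z|^2\<close>.\<close>

lemma pos_power_lipschitz:
  fixes a b d K :: real
  assumes "a \<le> K" "b \<le> K" "0 \<le> K" and d: "a - b = d"
  shows "\<bar>max 0 a - max 0 b\<bar> \<le> \<bar>d\<bar>"
    and "\<bar>max 0 a ^ 2 - max 0 b ^ 2\<bar> \<le> 2 * K * \<bar>d\<bar>"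
    and "\<bar>max 0 a ^ 3 - max 0 b ^ 3\<bar> \<le> 3 * K^2 * \<bar>d\<bar>"
proof -
  define p q where "p = max 0 a" and "q = max 0 b"
  have pq: "0 \<le> p" "p \<le> K" "0 \<le> q" "q \<le> K" using assms by (auto simp: p_def q_def)
  have 1: "\<bar>p - q\<bar> \<le> \<bar>d\<bar>" unfolding d[symmetric] by (auto simp: p_def q_def)
  have "\<bar>p^2 - q^2\<bar> = \<bar>p + q\<bar> * \<bar>p - q\<bar>"
    by (simp add: abs_mult[symmetric] power2_eq_square algebra_simps)
  also have "\<dots> \<le> (2 * K) * \<bar>d\<bar>" by (intro mult_mono 1) (use pq in auto)
  finally have 2: "\<bar>p^2 - q^2\<bar> \<le> 2 * K * \<bar>d\<bar>" .
  have "p^2 \<le> K^2" "p * q \<le> K * K" "q^2 \<le> K^2" using pq by (auto intro: mult_mono power_mono)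
  then have "\<bar>p^2 + p * q + q^2\<bar> \<le> 3 * K^2" using pq by (simp add: power2_eq_square)
  moreover have "\<bar>p^3 - q^3\<bar> = \<bar>p^2 + p * q + q^2\<bar> * \<bar>p - q\<bar>"
    by (simp add: abs_mult[symmetric] power2_eq_square power3_eq_cube algebra_simps)
  ultimately have 3: "\<bar>p^3 - q^3\<bar> \<le> (3 * K^2) * \<bar>d\<bar>"
    by (simp only:) (intro mult_mono 1; simp)
  show "\<bar>max 0 a - max 0 b\<bar> \<le> \<bar>d\<bar>"
    "\<bar>max 0 a ^ 2 - max 0 b ^ 2\<bar> \<le> 2 * K * \<bar>d\<bar>"
    "\<bar>max 0 a ^ 3 - max 0 b ^ 3\<bar> \<le> 3 * K^2 * \<bar>d\<bar>"
    using 1 2 3 unfolding p_def q_def .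
qed

text \<open>In polar coordinates the disc integral is an indefinite integral in the radius, to which
  the one-dimensional differentiation theorem applies.\<close>

lemma AE_has_derivative_ball_integral:
  fixes g :: "real \<times> real \<Rightarrow> real"
  assumes R: "0 < R" and g: "set_integrable lebesgue (ball X0 R) g"
  shows "AE r in lebesgue. 0 < r \<and> r < R \<longrightarrow>
    ((\<lambda>r. LINT X:ball X0 r|lebesgue. g X) has_real_derivative circle_integral X0 r g) (at r)"
proof -
  \<comment> \<open>Cutting off outside of the admissible radii makes the integrand integrable on
    the whole line.\<close>
  let ?h = "\<lambda>r. indicator {0<..<R} r *\<^sub>R circle_integral X0 r g"
  have "integrable lebesgue ?h"
    using polar_coordinates(2)[OF R g] unfolding set_integrable_def .
  from lebesgue_differentiation_real[OF this, of 0] show ?thesis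
  proof eventually_elim
    case (elim r)
    show ?case
    proof
      assume r: "0 < r \<and> r < R"
      with elim have d: "((\<lambda>r. LINT x:{0<..<r}|lebesgue. ?h x) has_real_derivative ?h r) (at r)"
        by simp
      have eq: "(LINT x:{0<..<s}|lebesgue. ?h x) = (LINT X:ball X0 s|lebesgue. g X)"
        if s: "s \<in> {0<..<R}" for s
      proof -
        have "set_integrable lebesgue (ball X0 s) g"
          by (rule set_integrable_subset[OF g]) (use s in auto)
        with s have "(LINT X:ball X0 s|lebesgue. g X) = (LINT r:{0<..<s}|lebesgue. circle_integral X0 r g)"
          by (intro polar_coordinates(3)) auto
        also have "\<dots> = (LINT x:{0<..<s}|lebesgue. ?h x)"
          by (rule set_lebesgue_integral_cong) (use s in auto)
        finally show ?thesis ..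
      qed
      have "\<forall>\<^sub>F s in nhds r. s \<in> {0<..<R}"
        using r by (intro eventually_nhds_in_open) auto
      then have "\<forall>\<^sub>F s in nhds r. (LINT x:{0<..<s}|lebesgue. ?h x) = (LINT X:ball X0 s|lebesgue. g X)"
        by eventually_elim (rule eq)
      from d[unfolded DERIV_cong_ev[OF refl this refl]]
      show "((\<lambda>r. LINT X:ball X0 r|lebesgue. g X) has_real_derivative circle_integral X0 r g) (at r)"
        using r by simp
    qed
  qed
qed

lemma circle_integral_radial_mult:
  assumes "0 \<le> r"
  shows "circle_integral X0 r (\<lambda>X. q (norm (X - X0)) * g X) = q r * circle_integral X0 r g"
  unfolding circle_integral_def
  by (simp add: norm_circ[OF assms] mult.assoc)

text \<open>The assumption is differentiated three times in \<open>\<alpha>\<close>: twice under the integral, then almost everywhere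
  in the radius \<open>r = sqrt \<alpha>\<close>.\<close>

lemma radial_variation_identity:
  fixes c g :: "real \<times> real \<Rightarrow> real"
  assumes R: "0 < R" and c: "set_integrable lebesgue (ball X0 R) c"
    and g: "set_integrable lebesgue (ball X0 R) g"
    and var: "\<And>\<alpha>. 0 < \<alpha> \<Longrightarrow> \<alpha> < R\<^sup>2 \<Longrightarrow>
      (LINT X:ball X0 R|lebesgue. max 0 (\<alpha> - (norm (X - X0))\<^sup>2) ^ 3 * c X
          - 6 * max 0 (\<alpha> - (norm (X - X0))\<^sup>2) ^ 2 * g X) = 0"
  shows "AE r in lebesgue. 0 < r \<and> r < R \<longrightarrow>
    circle_integral X0 r g = r * (LINT X:ball X0 r|lebesgue. c X)"
proof -
  let ?B = "ball X0 R"
  let ?t = "\<lambda>X. (norm (X - X0))\<^sup>2"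
  let ?p = "\<lambda>\<alpha> X. max 0 (\<alpha> - ?t X)"
  have pm: "set_borel_measurable lebesgue ?B (\<lambda>X. ?p \<alpha> X ^ n)" for \<alpha> n
    by (intro set_borel_measurable_continuous_on continuous_intros) auto
  have pb: "?p \<alpha> X \<le> max 0 \<alpha>" for \<alpha> X
    by (auto simp: max_def) (use zero_le_power2[of "norm (X - X0)"] in linarith)+
  have pint: "set_integrable lebesgue ?B (\<lambda>X. ?p \<alpha> X ^ n * w X)" if "set_integrable lebesgue ?B w" for \<alpha> n w
    by (rule set_integrable_bounded_mult[OF pm _ that, where B = "max 0 \<alpha> ^ n"])
      (simp add: power_abs power_mono[OF pb])
  have pint1: "set_integrable lebesgue ?B (\<lambda>X. ?p \<alpha> X * w X)" if "set_integrable lebesgue ?B w" for \<alpha> w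
    using pint[OF that, of \<alpha> 1] by simp
  have ca: "set_integrable lebesgue ?B (\<lambda>X. \<bar>c X\<bar>)" and ga: "set_integrable lebesgue ?B (\<lambda>X. \<bar>g X\<bar>)"
    using c g by (auto intro: set_integrable_abs)
  have nbd: "\<exists>d>0. \<forall>e. \<bar>e - \<alpha>\<bar> < d \<longrightarrow> 0 < e \<and> e < R\<^sup>2" if "0 < \<alpha>" "\<alpha> < R\<^sup>2" for \<alpha>
    using that by (intro exI[of _ "min \<alpha> (R\<^sup>2 - \<alpha>)"]) auto
  \<comment> \<open>A function that vanishes on a neighbourhood of \<open>\<alpha>\<close> has
    derivative zero there; each differentiation of the identity ends with this.\<close>
  have zero: "(LINT X:?B|lebesgue. G' X) = 0"
    if "((\<lambda>e. LINT X:?B|lebesgue. G e X) has_real_derivative (LINT X:?B|lebesgue. G' X)) (at \<alpha>)"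
      "\<And>e. 0 < e \<Longrightarrow> e < R\<^sup>2 \<Longrightarrow> (LINT X:?B|lebesgue. G e X) = 0" "0 < \<alpha>" "\<alpha> < R\<^sup>2" for G G' \<alpha>
  proof -
    have "\<forall>\<^sub>F e in nhds \<alpha>. e \<in> {0<..<R\<^sup>2}"
      using that by (intro eventually_nhds_in_open) auto
    then have "\<forall>\<^sub>F e in nhds \<alpha>. (LINT X:?B|lebesgue. G e X) = 0"
      by eventually_elim (use that in auto)
    from that(1)[unfolded DERIV_cong_ev[OF refl this refl]] show ?thesis
      by (metis DERIV_const DERIV_unique)
  qed
  have step1: "(LINT X:?B|lebesgue. 3 * (?p \<alpha> X ^ 2 * c X) - 12 * (?p \<alpha> X * g X)) = 0"
    if \<alpha>: "0 < \<alpha>" "\<alpha> < R\<^sup>2" for \<alpha>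
  proof (rule zero[OF _ var \<alpha>])
    obtain d where d: "d > 0" "\<And>e. \<bar>e - \<alpha>\<bar> < d \<Longrightarrow> 0 < e \<and> e < R\<^sup>2" using nbd[OF \<alpha>] by blast
    let ?H = "\<lambda>X. (3 * (R\<^sup>2)\<^sup>2) * \<bar>c X\<bar> + (12 * R\<^sup>2) * \<bar>g X\<bar>"
    show "((\<lambda>e. LINT X:?B|lebesgue. ?p e X ^ 3 * c X - 6 * ?p e X ^ 2 * g X) has_real_derivative
      (LINT X:?B|lebesgue. 3 * (?p \<alpha> X ^ 2 * c X) - 12 * (?p \<alpha> X * g X))) (at \<alpha>)"
    proof (rule has_derivative_set_integral_parameter[OF d(1), where H = ?H])
      show "set_integrable lebesgue ?B (\<lambda>X. ?p e X ^ 3 * c X - 6 * ?p e X ^ 2 * g X)" for e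
        using pint[OF c, of e 3] pint[OF g, of e 2] by (auto simp: mult.assoc)
      show "set_integrable lebesgue ?B ?H"
        using ca ga by auto
      show "set_borel_measurable lebesgue ?B (\<lambda>X. 3 * (?p \<alpha> X ^ 2 * c X) - 12 * (?p \<alpha> X * g X))"
        by (intro set_integrable_imp_measurable set_integral_diff(1) set_integrable_mult_right pint pint1 c g)
      show "AE X in lebesgue. X \<in> ?B \<longrightarrow>
        ((\<lambda>e. ?p e X ^ 3 * c X - 6 * ?p e X ^ 2 * g X) has_real_derivative
           3 * (?p \<alpha> X ^ 2 * c X) - 12 * (?p \<alpha> X * g X)) (at \<alpha>)"
      proof (intro AE_I2 impI)
        fix X
        have 1: "((\<lambda>e. e - ?t X) has_real_derivative 1) (at \<alpha>)" by (auto intro!: derivative_eq_intros)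
        have 3: "((\<lambda>e. ?p e X ^ 3) has_real_derivative 3 * ?p \<alpha> X ^ 2) (at \<alpha>)"
          using DERIV_chain2[OF has_derivative_pos_power[of 1] 1] by (simp add: eval_nat_numeral)
        have 2: "((\<lambda>e. ?p e X ^ 2) has_real_derivative 2 * ?p \<alpha> X) (at \<alpha>)"
          using DERIV_chain2[OF has_derivative_pos_power[of 0] 1] by (simp add: eval_nat_numeral)
        show "((\<lambda>e. ?p e X ^ 3 * c X - 6 * ?p e X ^ 2 * g X) has_real_derivative
           3 * (?p \<alpha> X ^ 2 * c X) - 12 * (?p \<alpha> X * g X)) (at \<alpha>)"
          by (rule derivative_eq_intros 2 3 refl | simp)+
      qed
      fix e X assume e: "\<bar>e - \<alpha>\<bar> < d" 
      have e2: "e < R\<^sup>2" using d(2)[OF e] by simp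
      have l: "e - ?t X \<le> R\<^sup>2" "\<alpha> - ?t X \<le> R\<^sup>2" "0 \<le> R\<^sup>2"
        "e - ?t X - (\<alpha> - ?t X) = e - \<alpha>" using e2 \<alpha>(2)
        zero_le_power2[of "norm (X - X0)"] by (linarith | simp)+
      have pl: "\<bar>?p e X - ?p \<alpha> X\<bar> \<le> \<bar>e - \<alpha>\<bar>" "\<bar>?p e X ^ 2 - ?p \<alpha> X ^ 2\<bar> \<le> 2 * R\<^sup>2 * \<bar>e - \<alpha>\<bar>"
        "\<bar>?p e X ^ 3 - ?p \<alpha> X ^ 3\<bar> \<le> 3 * (R\<^sup>2)\<^sup>2 * \<bar>e - \<alpha>\<bar>"
        by (rule pos_power_lipschitz[OF l])+
      have "\<bar>(?p e X ^ 3 * c X - 6 * ?p e X ^ 2 * g X) - (?p \<alpha> X ^ 3 * c X - 6 * ?p \<alpha> X ^ 2 * g X)\<bar>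
        = \<bar>(?p e X ^ 3 - ?p \<alpha> X ^ 3) * c X - 6 * ((?p e X ^ 2 - ?p \<alpha> X ^ 2) * g X)\<bar>"
        by (simp add: algebra_simps)
      also have "\<dots> \<le> \<bar>?p e X ^ 3 - ?p \<alpha> X ^ 3\<bar> * \<bar>c X\<bar> + 6 * (\<bar>?p e X ^ 2 - ?p \<alpha> X ^ 2\<bar> * \<bar>g X\<bar>)"
        by (rule order_trans[OF abs_triangle_ineq4]) (simp add: abs_mult)
      also have "\<dots> \<le> (3 * (R\<^sup>2)\<^sup>2 * \<bar>e - \<alpha>\<bar>) * \<bar>c X\<bar> + 6 * ((2 * R\<^sup>2 * \<bar>e - \<alpha>\<bar>) * \<bar>g X\<bar>)"
        by (intro add_mono mult_left_mono mult_right_mono pl) simp_all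
      also have "\<dots> = ?H X * \<bar>e - \<alpha>\<bar>" by (simp add: algebra_simps)
      finally show "\<bar>(?p e X ^ 3 * c X - 6 * ?p e X ^ 2 * g X) - (?p \<alpha> X ^ 3 * c X - 6 * ?p \<alpha> X ^ 2 * g X)\<bar> \<le> ?H X * \<bar>e - \<alpha>\<bar>" .
    qed
  qed
  have step2: "(LINT X:?B|lebesgue. 6 * (?p \<alpha> X * c X) - 12 * (indicator (ball X0 (sqrt \<alpha>)) X * g X)) = 0"
    if \<alpha>: "0 < \<alpha>" "\<alpha> < R\<^sup>2" for \<alpha>
  proof (rule zero[OF _ step1 \<alpha>])
    obtain d where d: "d > 0" "\<And>e. \<bar>e - \<alpha>\<bar> < d \<Longrightarrow> 0 < e \<and> e < R\<^sup>2" using nbd[OF \<alpha>] by blast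
    let ?H = "\<lambda>X. (6 * R\<^sup>2) * \<bar>c X\<bar> + 12 * \<bar>g X\<bar>"
    let ?I = "\<lambda>X. indicat_real (ball X0 (sqrt \<alpha>)) X"
    show "((\<lambda>e. LINT X:?B|lebesgue. 3 * (?p e X ^ 2 * c X) - 12 * (?p e X * g X)) has_real_derivative
      (LINT X:?B|lebesgue. 6 * (?p \<alpha> X * c X) - 12 * (?I X * g X))) (at \<alpha>)"
    proof (rule has_derivative_set_integral_parameter[OF d(1), where H = ?H])
      show "set_integrable lebesgue ?B (\<lambda>X. 3 * (?p e X ^ 2 * c X) - 12 * (?p e X * g X))" for e
        by (intro set_integral_diff(1) set_integrable_mult_right pint pint1 c g)
      show "set_integrable lebesgue ?B ?H"
        using ca ga by auto
      have "(\<lambda>X. indicat_real ?B X *\<^sub>R ?I X) \<in> borel_measurable lebesgue"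
        by (intro borel_measurable_scaleR borel_measurable_indicator) auto
      then have "set_borel_measurable lebesgue ?B ?I"
        by (simp add: set_borel_measurable_def)
      then have "set_integrable lebesgue ?B (\<lambda>X. ?I X * g X)"
        by (rule set_integrable_bounded_mult[OF _ _ g, where B = 1]) (auto simp: indicator_def)
      then show "set_borel_measurable lebesgue ?B (\<lambda>X. 6 * (?p \<alpha> X * c X) - 12 * (?I X * g X))"
        by (intro set_integrable_imp_measurable set_integral_diff(1) set_integrable_mult_right pint pint1 c)
      \<comment> \<open>The positive part has its kink in \<open>e\<close> at
        \<open>e = |Z|^2\<close>. For \<open>e = \<alpha>\<close> this happens only on a circle,
        which is null.\<close>
      have "sphere X0 (sqrt \<alpha>) \<in> null_sets lebesgue"
        by (simp add: negligible_iff_null_sets[symmetric] negligible_sphere)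
      then have "AE X in lebesgue. X \<notin> sphere X0 (sqrt \<alpha>)" by (rule AE_not_in)
      then show "AE X in lebesgue. X \<in> ?B \<longrightarrow>
        ((\<lambda>e. 3 * (?p e X ^ 2 * c X) - 12 * (?p e X * g X)) has_real_derivative
           6 * (?p \<alpha> X * c X) - 12 * (?I X * g X)) (at \<alpha>)"
      proof (eventually_elim, intro impI)
        fix X assume "X \<notin> sphere X0 (sqrt \<alpha>)"
        then have ne: "norm (X - X0) \<noteq> sqrt \<alpha>" by (simp add: dist_norm norm_minus_commute)
        have 1: "((\<lambda>e. e - ?t X) has_real_derivative 1) (at \<alpha>)" by (auto intro!: derivative_eq_intros)
        have 2: "((\<lambda>e. ?p e X ^ 2) has_real_derivative 2 * ?p \<alpha> X) (at \<alpha>)"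
          using DERIV_chain2[OF has_derivative_pos_power[of 0] 1] by (simp add: eval_nat_numeral)
        have 3: "((\<lambda>e. ?p e X) has_real_derivative ?I X) (at \<alpha>)"
        proof (cases "norm (X - X0) < sqrt \<alpha>")
          case True
          then have t: "?t X < \<alpha>" using power_strict_mono[of "norm (X - X0)" "sqrt \<alpha>" 2] \<alpha>(1) by simp
          have "\<forall>\<^sub>F e in nhds \<alpha>. ?p e X = e - ?t X"
            using eventually_nhds_in_open[of "{?t X<..}" \<alpha>] t by (auto elim!: eventually_mono)
          from 1[folded DERIV_cong_ev[OF refl this refl]] show ?thesis
            using True by (simp add: dist_norm norm_minus_commute)
        next
          case False
          with ne have "sqrt \<alpha> < norm (X - X0)" by simp
          then have t: "\<alpha> < ?t X" using power_strict_mono[of "sqrt \<alpha>" "norm (X - X0)" 2] \<alpha>(1) by simp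
          have ev: "\<forall>\<^sub>F e in nhds \<alpha>. ?p e X = 0"
            using eventually_nhds_in_open[of "{..<?t X}" \<alpha>] t by (auto elim!: eventually_mono)
          have "((\<lambda>e. 0) has_real_derivative 0) (at \<alpha>)" by simp
          from this[folded DERIV_cong_ev[OF refl ev refl]] show ?thesis
            using False by (simp add: dist_norm norm_minus_commute)
        qed
        show "((\<lambda>e. 3 * (?p e X ^ 2 * c X) - 12 * (?p e X * g X)) has_real_derivative
           6 * (?p \<alpha> X * c X) - 12 * (?I X * g X)) (at \<alpha>)"
          by (rule derivative_eq_intros 2 3 refl | simp)+
      qed
      fix e X assume e: "\<bar>e - \<alpha>\<bar> < d" 
      have e2: "e < R\<^sup>2" using d(2)[OF e] by simp
      have l: "e - ?t X \<le> R\<^sup>2" "\<alpha> - ?t X \<le> R\<^sup>2" "0 \<le> R\<^sup>2"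
        "e - ?t X - (\<alpha> - ?t X) = e - \<alpha>" using e2 \<alpha>(2)
        zero_le_power2[of "norm (X - X0)"] by (linarith | simp)+
      have pl: "\<bar>?p e X - ?p \<alpha> X\<bar> \<le> \<bar>e - \<alpha>\<bar>" "\<bar>?p e X ^ 2 - ?p \<alpha> X ^ 2\<bar> \<le> 2 * R\<^sup>2 * \<bar>e - \<alpha>\<bar>"
        "\<bar>?p e X ^ 3 - ?p \<alpha> X ^ 3\<bar> \<le> 3 * (R\<^sup>2)\<^sup>2 * \<bar>e - \<alpha>\<bar>"
        by (rule pos_power_lipschitz[OF l])+
      have "\<bar>(3 * (?p e X ^ 2 * c X) - 12 * (?p e X * g X)) - (3 * (?p \<alpha> X ^ 2 * c X) - 12 * (?p \<alpha> X * g X))\<bar>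
        = \<bar>3 * ((?p e X ^ 2 - ?p \<alpha> X ^ 2) * c X) - 12 * ((?p e X - ?p \<alpha> X) * g X)\<bar>"
        by (simp add: algebra_simps)
      also have "\<dots> \<le> 3 * (\<bar>?p e X ^ 2 - ?p \<alpha> X ^ 2\<bar> * \<bar>c X\<bar>) + 12 * (\<bar>?p e X - ?p \<alpha> X\<bar> * \<bar>g X\<bar>)"
        by (rule order_trans[OF abs_triangle_ineq4]) (simp add: abs_mult)
      also have "\<dots> \<le> 3 * ((2 * R\<^sup>2 * \<bar>e - \<alpha>\<bar>) * \<bar>c X\<bar>) + 12 * (\<bar>e - \<alpha>\<bar> * \<bar>g X\<bar>)"
        by (intro add_mono mult_left_mono mult_right_mono pl) simp_all
      also have "\<dots> = ?H X * \<bar>e - \<alpha>\<bar>" by (simp add: algebra_simps)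
      finally show "\<bar>(3 * (?p e X ^ 2 * c X) - 12 * (?p e X * g X)) - (3 * (?p \<alpha> X ^ 2 * c X) - 12 * (?p \<alpha> X * g X))\<bar> \<le> ?H X * \<bar>e - \<alpha>\<bar>" .
    qed
  qed
  have tc: "set_integrable lebesgue ?B (\<lambda>X. ?t X * c X)"
  proof (rule set_integrable_bounded_mult[OF _ _ c, where B = "R\<^sup>2"])
    show "set_borel_measurable lebesgue ?B ?t"
      by (intro set_borel_measurable_continuous_on continuous_intros) auto
  qed (auto simp: dist_norm norm_minus_commute intro!: power_mono)
  let ?C = "\<lambda>r. LINT X:ball X0 r|lebesgue. c X"
  let ?T = "\<lambda>r. LINT X:ball X0 r|lebesgue. ?t X * c X"
  let ?G = "\<lambda>r. LINT X:ball X0 r|lebesgue. g X"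
  \<comment> \<open>For \<open>\<alpha> = r^2\<close> the positive part lives on the disc of radius
    \<open>r\<close>, where it equals r^2 - |Z|^2; a common factor 6 is divided out.\<close>
  have step3: "r\<^sup>2 * ?C r - ?T r - 2 * ?G r = 0" if r: "0 < r" "r < R" for r
  proof -
    have sub: "set_integrable lebesgue (ball X0 r) w" if "set_integrable lebesgue ?B w" for w :: "real \<times> real \<Rightarrow> real"
      by (rule set_integrable_subset[OF that]) (use r in auto)
    have eq: "indicator ?B X *\<^sub>R (6 * (?p (r\<^sup>2) X * c X) - 12 * (indicator (ball X0 (sqrt (r\<^sup>2))) X * g X)) =
        indicator (ball X0 r) X *\<^sub>R (6 * (r\<^sup>2 * c X - ?t X * c X - 2 * g X))" for X
    proof (cases "X \<in> ball X0 r")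
      case True
      then have n: "norm (X - X0) < r" by (simp add: dist_norm norm_minus_commute)
      then have "?t X \<le> r\<^sup>2" using r by (intro power_mono) auto
      with True n r show ?thesis by (simp add: dist_norm norm_minus_commute algebra_simps)
    next
      case False
      then have n: "r \<le> norm (X - X0)" by (simp add: dist_norm norm_minus_commute)
      then have "r\<^sup>2 \<le> ?t X" using r by (intro power_mono) auto
      with False r show ?thesis by simp
    qed
    have "0 = (LINT X:ball X0 r|lebesgue. 6 * (r\<^sup>2 * c X - ?t X * c X - 2 * g X))"
      using step2[of "r\<^sup>2"] r unfolding set_lebesgue_integral_def eq by (simp add: power_strict_mono)
    also have "\<dots> = 6 * (r\<^sup>2 * ?C r - ?T r - 2 * ?G r)"
      using sub[OF c] sub[OF tc] sub[OF g] by simp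
    finally show ?thesis by simp
  qed
  show ?thesis
    using AE_has_derivative_ball_integral[OF R c] AE_has_derivative_ball_integral[OF R tc]
      AE_has_derivative_ball_integral[OF R g]
  proof eventually_elim
    case (elim r)
    show ?case
    proof
      assume r: "0 < r \<and> r < R"
      note d = elim[rule_format, OF r]
      have d1: "((\<lambda>r. r\<^sup>2 * ?C r - ?T r - 2 * ?G r) has_real_derivative
         2 * r * ?C r + r\<^sup>2 * circle_integral X0 r c - circle_integral X0 r (\<lambda>X. ?t X * c X) - 2 * circle_integral X0 r g) (at r)"
        by (rule derivative_eq_intros d refl | simp)+
      have ev: "\<forall>\<^sub>F s in nhds r. s\<^sup>2 * ?C s - ?T s - 2 * ?G s = 0"
        using eventually_nhds_in_open[of "{0<..<R}" r] r step3 by (auto elim!: eventually_mono)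
      have "2 * r * ?C r + r\<^sup>2 * circle_integral X0 r c - circle_integral X0 r (\<lambda>X. ?t X * c X) - 2 * circle_integral X0 r g = 0"
        by (rule DERIV_unique[OF d1[unfolded DERIV_cong_ev[OF refl ev refl]] DERIV_const])
      \<comment> \<open>On the circle |Z|^2 is r^2, so the two circle integrals of \<open>c\<close>
        cancel.\<close>
      moreover have "circle_integral X0 r (\<lambda>X. ?t X * c X) = r\<^sup>2 * circle_integral X0 r c"
        using circle_integral_radial_mult[of r X0 "\<lambda>s. s\<^sup>2" c] r by simp
      ultimately show "circle_integral X0 r g = r * (LINT X:ball X0 r|lebesgue. c X)" by simp
    qed
  qed
qed


subsection \<open>Weak gradients and test functions\<close>

text \<open>The smoothness part of \<open>test_fun\<close> without the support condition: such
  factors may multiply a test function.\<close>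

definition C1_gradient :: "(real \<times> real \<Rightarrow> real) \<Rightarrow> (real \<times> real \<Rightarrow> real \<times> real) \<Rightarrow> bool" where
  "C1_gradient q Dq \<longleftrightarrow> (\<forall>X. (q has_derivative (\<lambda>v. Dq X \<bullet> v)) (at X)) \<and> continuous_on UNIV Dq"

lemma C1_gradientD:
  assumes "C1_gradient q Dq"
  shows "(q has_derivative (\<lambda>v. Dq X \<bullet> v)) (at X within S)" "continuous_on S Dq" "continuous_on S q"
proof -
  have d: "(q has_derivative (\<lambda>v. Dq X \<bullet> v)) (at X within S)" for X S
    using assms unfolding C1_gradient_def by (blast intro: has_derivative_at_withinI)
  then show "(q has_derivative (\<lambda>v. Dq X \<bullet> v)) (at X within S)" .
  show "continuous_on S Dq" using assms unfolding C1_gradient_def by (blast intro: continuous_on_subset)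
  show "continuous_on S q" by (rule has_derivative_continuous_on[OF d])
qed

lemma C1_gradient_const: "C1_gradient (\<lambda>X. c) (\<lambda>X. 0)"
  by (simp add: C1_gradient_def)

lemma C1_gradientI:
  assumes "\<And>X. (q has_derivative (\<lambda>v. Dq X \<bullet> v)) (at X)" "continuous_on UNIV Dq"
  shows "C1_gradient q Dq"
  using assms unfolding C1_gradient_def by blast

lemma C1_gradient_add:
  assumes q: "C1_gradient q Dq" and p: "C1_gradient p Dp"
  shows "C1_gradient (\<lambda>X. q X + p X) (\<lambda>X. Dq X + Dp X)"
proof (rule C1_gradientI)
  show "((\<lambda>X. q X + p X) has_derivative (\<lambda>v. (Dq X + Dp X) \<bullet> v)) (at X)" for X
    unfolding inner_add_left by (rule has_derivative_add[OF C1_gradientD(1)[OF q] C1_gradientD(1)[OF p]])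
  show "continuous_on UNIV (\<lambda>X. Dq X + Dp X)"
    by (rule continuous_on_add[OF C1_gradientD(2)[OF q] C1_gradientD(2)[OF p]])
qed

lemma C1_gradient_mult:
  assumes q: "C1_gradient q Dq" and p: "C1_gradient p Dp"
  shows "C1_gradient (\<lambda>X. q X * p X) (\<lambda>X. q X *\<^sub>R Dp X + p X *\<^sub>R Dq X)"
proof (rule C1_gradientI)
  show "((\<lambda>X. q X * p X) has_derivative (\<lambda>v. (q X *\<^sub>R Dp X + p X *\<^sub>R Dq X) \<bullet> v)) (at X)" for X
    by (rule has_derivative_eq_rhs[OF has_derivative_mult[OF C1_gradientD(1)[OF q] C1_gradientD(1)[OF p]]])
      (simp add: fun_eq_iff inner_add_left mult.commute)
  show "continuous_on UNIV (\<lambda>X. q X *\<^sub>R Dp X + p X *\<^sub>R Dq X)"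
    by (intro continuous_on_add continuous_on_scaleR C1_gradientD[OF q] C1_gradientD[OF p])
qed

lemma C1_gradient_cmult:
  assumes "C1_gradient q Dq"
  shows "C1_gradient (\<lambda>X. c * q X) (\<lambda>X. c *\<^sub>R Dq X)"
  using C1_gradient_mult[OF C1_gradient_const[of c] assms] by simp

lemma C1_gradient_fst: "C1_gradient (\<lambda>X. fst X - c) (\<lambda>X. (1, 0))"
proof (rule C1_gradientI)
  show "((\<lambda>X. fst X - c) has_derivative (\<lambda>v. (1, 0) \<bullet> v)) (at X)" for X :: "real \<times> real"
    by (rule has_derivative_eq_rhs[OF has_derivative_diff[OF has_derivative_fst[OF has_derivative_ident] has_derivative_const]])
      (simp add: fun_eq_iff inner_prod_def)
qed simp

lemma C1_gradient_snd: "C1_gradient (\<lambda>X. snd X - c) (\<lambda>X. (0, 1))"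
proof (rule C1_gradientI)
  show "((\<lambda>X. snd X - c) has_derivative (\<lambda>v. (0, 1) \<bullet> v)) (at X)" for X :: "real \<times> real"
    by (rule has_derivative_eq_rhs[OF has_derivative_diff[OF has_derivative_snd[OF has_derivative_ident] has_derivative_const]])
      (simp add: fun_eq_iff inner_prod_def)
qed simp

lemma C1_gradient_compose:
  assumes "C1_gradient q Dq" "\<And>t. (h has_real_derivative h' t) (at t)" "continuous_on UNIV h'"
  shows "C1_gradient (\<lambda>X. h (q X)) (\<lambda>X. h' (q X) *\<^sub>R Dq X)"
  unfolding C1_gradient_def
proof (intro conjI allI)
  fix X
  have "(h has_derivative (*) (h' (q X))) (at (q X))"
    using assms(2) by (simp add: has_field_derivative_def)
  from has_derivative_compose[OF C1_gradientD(1)[OF assms(1), where S = UNIV] this]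
  show "((\<lambda>X. h (q X)) has_derivative (\<bullet>) (h' (q X) *\<^sub>R Dq X)) (at X)"
    by (rule has_derivative_eq_rhs) auto
  show "continuous_on UNIV (\<lambda>X. h' (q X) *\<^sub>R Dq X)"
    by (intro continuous_intros continuous_on_compose2[OF assms(3)] C1_gradientD[OF assms(1)]) auto
qed

lemma C1_gradient_sqnorm: "C1_gradient (\<lambda>X. (norm (X - X0))\<^sup>2) (\<lambda>X. 2 *\<^sub>R (X - X0))"
proof (rule C1_gradientI)
  fix X
  have e: "(norm (X - X0))\<^sup>2 = (X - X0) \<bullet> (X - X0)" for X
    by (simp add: power2_norm_eq_inner)
  have "((\<lambda>X. X - X0) has_derivative (\<lambda>v. v)) (at X)"
    by (rule has_derivative_eq_rhs[OF has_derivative_diff[OF has_derivative_ident has_derivative_const]]) simp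
  from has_derivative_inner[OF this this]
  show "((\<lambda>X. (norm (X - X0))\<^sup>2) has_derivative (\<bullet>) (2 *\<^sub>R (X - X0))) (at X)"
    unfolding e by (rule has_derivative_eq_rhs) (simp add: fun_eq_iff inner_commute)
qed (intro continuous_intros)

lemma test_fun_mult:
  assumes "test_fun S \<eta> D\<eta>" "C1_gradient q Dq"
  shows "test_fun S (\<lambda>X. \<eta> X * q X) (\<lambda>X. \<eta> X *\<^sub>R Dq X + q X *\<^sub>R D\<eta> X)"
proof -
  have "C1_gradient \<eta> D\<eta>" using assms(1) unfolding test_fun_def C1_gradient_def by blast
  note m = C1_gradient_mult[OF this assms(2)]
  obtain K where "compact K" "K \<subseteq> S" "\<forall>X. X \<notin> K \<longrightarrow> \<eta> X = 0"
    using assms(1) unfolding test_fun_def by blast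
  then have "\<exists>K. compact K \<and> K \<subseteq> S \<and> (\<forall>X. X \<notin> K \<longrightarrow> \<eta> X * q X = 0)" by auto
  with m show ?thesis unfolding test_fun_def C1_gradient_def by blast
qed

lemma test_fun_radial:
  assumes R: "0 < R" and t1: "t1 < R\<^sup>2" "\<And>t. t1 \<le> t \<Longrightarrow> \<kappa> t = 0"
    and \<kappa>: "\<And>t. (\<kappa> has_real_derivative \<kappa>' t) (at t)" "continuous_on UNIV \<kappa>'"
  shows "test_fun (ball X0 R) (\<lambda>X. \<kappa> ((norm (X - X0))\<^sup>2)) (\<lambda>X. (2 * \<kappa>' ((norm (X - X0))\<^sup>2)) *\<^sub>R (X - X0))"
proof -
  have K: "compact (cball X0 (sqrt (max 0 t1)))" "cball X0 (sqrt (max 0 t1)) \<subseteq> ball X0 R"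
  proof -
    have "sqrt (max 0 t1) < R" using R t1(1) by (auto simp: max_def real_less_lsqrt)
    then show "cball X0 (sqrt (max 0 t1)) \<subseteq> ball X0 R" by auto
  qed auto
  have "\<kappa> ((norm (X - X0))\<^sup>2) = 0" if "X \<notin> cball X0 (sqrt (max 0 t1))" for X
  proof (rule t1(2))
    have "sqrt (max 0 t1) < norm (X - X0)" using that by (simp add: dist_norm norm_minus_commute)
    then have "(sqrt (max 0 t1))\<^sup>2 < (norm (X - X0))\<^sup>2" by (intro power_strict_mono) auto
    then show "t1 \<le> (norm (X - X0))\<^sup>2" by simp
  qed
  then have "\<exists>K. compact K \<and> K \<subseteq> ball X0 R \<and> (\<forall>X. X \<notin> K \<longrightarrow> \<kappa> ((norm (X - X0))\<^sup>2) = 0)"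
    using K by (intro exI[of _ "cball X0 (sqrt (max 0 t1))"]) simp
  moreover have "C1_gradient (\<lambda>X. \<kappa> ((norm (X - X0))\<^sup>2)) (\<lambda>X. (2 * \<kappa>' ((norm (X - X0))\<^sup>2)) *\<^sub>R (X - X0))"
    using C1_gradient_compose[OF C1_gradient_sqnorm[of X0] \<kappa>] by (simp add: mult.commute)
  ultimately show ?thesis
    unfolding test_fun_def C1_gradient_def by simp
qed

text \<open>The complement of \<open>K\<close> is open, so vanishing of the function there passes to
  the gradient.\<close>

lemma test_fun_support:
  assumes "test_fun S \<eta> D\<eta>"
  shows "\<exists>K. compact K \<and> K \<subseteq> S \<and> (\<forall>X. X \<notin> K \<longrightarrow> \<eta> X = 0 \<and> D\<eta> X = 0)"
proof -
  obtain K where K: "compact K" "K \<subseteq> S" "\<And>X. X \<notin> K \<Longrightarrow> \<eta> X = 0"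
    using assms unfolding test_fun_def by blast
  have "D\<eta> X = 0" if X: "X \<notin> K" for X
  proof -
    have 1: "(\<eta> has_derivative (\<lambda>v. D\<eta> X \<bullet> v)) (at X)" using assms unfolding test_fun_def by blast
    have "open (- K)" using K(1) by (simp add: compact_imp_closed open_Compl)
    then have "(\<eta> has_derivative (\<lambda>v. 0)) (at X)"
      by (rule has_derivative_transform_within_open[OF has_derivative_const]) (simp_all add: X K(3))
    from fun_cong[OF has_derivative_unique[OF 1 this], of "D\<eta> X"] have "D\<eta> X \<bullet> D\<eta> X = 0" .
    then show ?thesis by simp
  qed
  with K show ?thesis by blast
qed

section \<open>Integration by parts with a weak gradient\<close>

lemma set_integrable_compact_support:
  fixes w :: "real \<times> real \<Rightarrow> 'b::{banach, second_countable_topology}"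
  assumes K: "compact K" "K \<subseteq> S" and w: "set_integrable lebesgue K w"
    and q: "continuous_on UNIV q" "\<And>X. X \<notin> K \<Longrightarrow> q X = 0"
  shows "set_integrable lebesgue S (\<lambda>X. q X *\<^sub>R w X)"
proof -
  have Ks: "K \<in> sets lebesgue" using K(1) by (simp add: borel_compact sets_lebesgue_borel)
  have qK: "continuous_on K q" using q(1) continuous_on_subset by blast
  obtain B where "\<forall>x \<in> q ` K. norm x \<le> B"
    using compact_imp_bounded[OF compact_continuous_image[OF qK K(1)]] unfolding bounded_iff by blast
  then have B: "\<And>X. X \<in> K \<Longrightarrow> \<bar>q X\<bar> \<le> B" by simp
  have "set_integrable lebesgue K (\<lambda>X. q X *\<^sub>R w X)"
    by (rule set_integrable_bounded_scaleR[OF set_borel_measurable_continuous_on[OF qK Ks] B w])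
  moreover have "(\<lambda>X. indicat_real S X *\<^sub>R q X *\<^sub>R w X) = (\<lambda>X. indicat_real K X *\<^sub>R q X *\<^sub>R w X)"
  proof (rule ext)
    show "indicat_real S X *\<^sub>R q X *\<^sub>R w X = indicat_real K X *\<^sub>R q X *\<^sub>R w X" for X
      using K(2) q(2)[of X] by (cases "X \<in> K") auto
  qed
  ultimately show ?thesis unfolding set_integrable_def by simp
qed

lemma set_integrable_fst_snd:
  fixes w :: "'a \<Rightarrow> real \<times> real"
  assumes "set_integrable M S w"
  shows "set_integrable M S (\<lambda>x. fst (w x))" "set_integrable M S (\<lambda>x. snd (w x))"
    "fst (LINT x:S|M. w x) = (LINT x:S|M. fst (w x))"
    "snd (LINT x:S|M. w x) = (LINT x:S|M. snd (w x))"
proof -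
  have i: "integrable M (\<lambda>x. indicator S x *\<^sub>R w x)" using assms unfolding set_integrable_def .
  show "set_integrable M S (\<lambda>x. fst (w x))" "set_integrable M S (\<lambda>x. snd (w x))"
    using integrable_bounded_linear[OF bounded_linear_fst i] integrable_bounded_linear[OF bounded_linear_snd i]
    by (simp_all only: set_integrable_def fst_scaleR snd_scaleR)
  show "fst (LINT x:S|M. w x) = (LINT x:S|M. fst (w x))" "snd (LINT x:S|M. w x) = (LINT x:S|M. snd (w x))"
    using integral_bounded_linear[OF bounded_linear_fst i] integral_bounded_linear[OF bounded_linear_snd i]
    by (simp_all only: set_lebesgue_integral_def fst_scaleR snd_scaleR)
qed

lemma weak_gradient_test_integrable:
  assumes wg: "weak_gradient S g Dg" and t: "test_fun S \<eta> D\<eta>"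
  shows "set_integrable lebesgue S (\<lambda>X. g X *\<^sub>R D\<eta> X)" "set_integrable lebesgue S (\<lambda>X. \<eta> X *\<^sub>R Dg X)"
    and "(LINT X:S|lebesgue. g X *\<^sub>R D\<eta> X) = - (LINT X:S|lebesgue. \<eta> X *\<^sub>R Dg X)"
proof -
  obtain K where K: "compact K" "K \<subseteq> S" "\<And>X. X \<notin> K \<Longrightarrow> \<eta> X = 0" "\<And>X. X \<notin> K \<Longrightarrow> D\<eta> X = 0"
    using test_fun_support[OF t] by blast
  have C: "C1_gradient \<eta> D\<eta>" using t unfolding test_fun_def C1_gradient_def by blast
  have gK: "set_integrable lebesgue K g" "set_integrable lebesgue K Dg"
    using wg[unfolded weak_gradient_def, THEN conjunct1] K(1,2) by blast+
  have 1: "set_integrable lebesgue S (\<lambda>X. fst (D\<eta> X) *\<^sub>R g X)" "set_integrable lebesgue S (\<lambda>X. snd (D\<eta> X) *\<^sub>R g X)"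
    by (rule set_integrable_compact_support[OF K(1,2) gK(1)]; simp add: K(4) continuous_on_fst continuous_on_snd C1_gradientD(2)[OF C])+
  have "set_integrable lebesgue S (\<lambda>X. (fst (D\<eta> X) * g X) *\<^sub>R (1::real,0::real) + (snd (D\<eta> X) * g X) *\<^sub>R (0,1))"
    using 1 by (intro set_integral_add(1) set_integrable_scaleR_left) simp_all
  moreover have "(fst (D\<eta> X) * g X) *\<^sub>R (1::real,0::real) + (snd (D\<eta> X) * g X) *\<^sub>R (0,1) = g X *\<^sub>R D\<eta> X" for X
    by (simp add: prod_eq_iff)
  ultimately have 2: "set_integrable lebesgue S (\<lambda>X. g X *\<^sub>R D\<eta> X)" by simp
  have 3: "set_integrable lebesgue S (\<lambda>X. \<eta> X *\<^sub>R Dg X)"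
    by (rule set_integrable_compact_support[OF K(1,2) gK(2)]) (simp_all add: K(3) C1_gradientD(3)[OF C])
  show "set_integrable lebesgue S (\<lambda>X. g X *\<^sub>R D\<eta> X)" "set_integrable lebesgue S (\<lambda>X. \<eta> X *\<^sub>R Dg X)"
    by (fact 2 3)+
  show "(LINT X:S|lebesgue. g X *\<^sub>R D\<eta> X) = - (LINT X:S|lebesgue. \<eta> X *\<^sub>R Dg X)"
    by (rule wg[unfolded weak_gradient_def, THEN conjunct2, rule_format, OF t])
qed

text \<open>The form for a test vector field with components \<open>\<eta>1\<close> and
  \<open>\<eta>2\<close>: the first component of the identity for \<open>\<eta>1\<close> is added to
  the second component of the identity for \<open>\<eta>2\<close>.\<close>

lemma weak_gradient_divergence:
  assumes wg: "weak_gradient S g Dg"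
    and \<eta>: "test_fun S \<eta>1 D\<eta>1" "test_fun S \<eta>2 D\<eta>2"
  shows "set_integrable lebesgue S (\<lambda>X. g X * (fst (D\<eta>1 X) + snd (D\<eta>2 X)))"
    and "set_integrable lebesgue S (\<lambda>X. \<eta>1 X * fst (Dg X) + \<eta>2 X * snd (Dg X))"
    and "(LINT X:S|lebesgue. g X * (fst (D\<eta>1 X) + snd (D\<eta>2 X))) =
       - (LINT X:S|lebesgue. \<eta>1 X * fst (Dg X) + \<eta>2 X * snd (Dg X))"
proof -
  note 1 = weak_gradient_test_integrable[OF wg \<eta>(1)] and 2 = weak_gradient_test_integrable[OF wg \<eta>(2)]
  note a = set_integrable_fst_snd[OF 1(1)] set_integrable_fst_snd[OF 1(2)]
    set_integrable_fst_snd[OF 2(1)] set_integrable_fst_snd[OF 2(2)]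
  have e1: "(\<lambda>X. g X * (fst (D\<eta>1 X) + snd (D\<eta>2 X))) = (\<lambda>X. fst (g X *\<^sub>R D\<eta>1 X) + snd (g X *\<^sub>R D\<eta>2 X))"
    by (simp add: distrib_left)
  have e2: "(\<lambda>X. \<eta>1 X * fst (Dg X) + \<eta>2 X * snd (Dg X)) = (\<lambda>X. fst (\<eta>1 X *\<^sub>R Dg X) + snd (\<eta>2 X *\<^sub>R Dg X))"
    by simp
  show "set_integrable lebesgue S (\<lambda>X. g X * (fst (D\<eta>1 X) + snd (D\<eta>2 X)))"
    unfolding e1 by (rule set_integral_add(1)[OF a(1) a(10)])
  show "set_integrable lebesgue S (\<lambda>X. \<eta>1 X * fst (Dg X) + \<eta>2 X * snd (Dg X))"
    unfolding e2 by (rule set_integral_add(1)[OF a(5) a(14)])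
  show "(LINT X:S|lebesgue. g X * (fst (D\<eta>1 X) + snd (D\<eta>2 X))) =
       - (LINT X:S|lebesgue. \<eta>1 X * fst (Dg X) + \<eta>2 X * snd (Dg X))"
    unfolding e1 e2 set_integral_add(2)[OF a(1) a(10)] set_integral_add(2)[OF a(5) a(14)]
      a(3,7,12,16)[symmetric]
    by (simp only: 1(3) 2(3) fst_uminus snd_uminus minus_add_distrib)
qed

text \<open>Makes the approximants of the Stone-Weierstrass theorem admissible as smooth
  weights.\<close>

lemma C1_gradient_real_polynomial:
  assumes "real_polynomial_function (P :: real \<times> real \<Rightarrow> real)"
  shows "\<exists>DP. C1_gradient P DP"
  using assms
proof induction
  case (linear f)
  have "f v = (f (1,0), f (0,1)) \<bullet> v" for v
  proof -
    interpret bounded_linear f by fact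
    have "f v = f (fst v *\<^sub>R (1,0) + snd v *\<^sub>R (0,1))" by simp
    also have "\<dots> = fst v * f (1,0) + snd v * f (0,1)" unfolding add scaleR by simp
    finally show ?thesis by (simp add: inner_prod_def)
  qed
  then have e: "f = (\<bullet>) (f (1,0), f (0,1))" by (rule ext)
  have "C1_gradient f (\<lambda>X. (f (1,0), f (0,1)))"
  proof (rule C1_gradientI)
    show "(f has_derivative (\<bullet>) (f (1, 0), f (0, 1))) (at X)" for X
      using bounded_linear_imp_has_derivative[OF linear] by (rule has_derivative_eq_rhs) (rule e)
  qed simp
  then show ?case by blast
next
  case (const c)
  show ?case by (rule exI[of _ "\<lambda>X. 0"], rule C1_gradient_const)
next
  case (add f g)
  then obtain Df Dg where "C1_gradient f Df" "C1_gradient g Dg" by blast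
  then show ?case by (intro exI) (rule C1_gradient_add)
next
  case (mult f g)
  then obtain Df Dg where "C1_gradient f Df" "C1_gradient g Dg" by blast
  then show ?case by (intro exI) (rule C1_gradient_mult)
qed

section \<open>Flux through almost every circle\<close>

lemma bounded_on_ball_continuous:
  fixes q :: "real \<times> real \<Rightarrow> real"
  assumes "continuous_on (cball X0 R) q"
  shows "\<exists>B\<ge>0. \<forall>X\<in>cball X0 R. \<bar>q X\<bar> \<le> B"
proof -
  obtain B where "\<forall>x \<in> q ` cball X0 R. norm x \<le> B"
    using compact_imp_bounded[OF compact_continuous_image[OF assms compact_cball]] unfolding bounded_iff by blast
  then show ?thesis by (intro exI[of _ "max 0 B"]) auto
qed

lemma set_integrable_continuous_mult:
  fixes q w :: "real \<times> real \<Rightarrow> real"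
  assumes q: "continuous_on (cball X0 R) q" and w: "set_integrable lebesgue (ball X0 R) w"
  shows "set_integrable lebesgue (ball X0 R) (\<lambda>X. q X * w X)"
proof -
  obtain B where B: "\<forall>X\<in>cball X0 R. \<bar>q X\<bar> \<le> B" using bounded_on_ball_continuous[OF q] by blast
  show ?thesis
  proof (rule set_integrable_bounded_mult[OF _ _ w])
    show "set_borel_measurable lebesgue (ball X0 R) q"
      by (intro set_borel_measurable_continuous_on continuous_on_subset[OF q]) auto
    show "\<bar>q X\<bar> \<le> B" if "X \<in> ball X0 R" for X using B that by auto
  qed
qed

lemma set_integrable_inner_continuous:
  fixes q Dg :: "real \<times> real \<Rightarrow> real \<times> real"
  assumes q: "continuous_on (cball X0 R) q" and w: "set_integrable lebesgue (ball X0 R) Dg"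
  shows "set_integrable lebesgue (ball X0 R) (\<lambda>X. q X \<bullet> Dg X)"
proof -
  have "set_integrable lebesgue (ball X0 R) (\<lambda>X. fst (q X) * fst (Dg X) + snd (q X) * snd (Dg X))"
    by (intro set_integral_add(1) set_integrable_continuous_mult continuous_on_fst continuous_on_snd q set_integrable_fst_snd w)
  then show ?thesis by (simp add: inner_prod_def)
qed

text \<open>The product of the exponent 3 and the 2 from the gradient of |Z|^2 is the coefficient 6
  in \<open>radial_variation_identity\<close>.\<close>

lemma test_fun_truncated_cubic:
  assumes R: "0 < R" and \<alpha>: "\<alpha> < R\<^sup>2"
  shows "test_fun (ball X0 R) (\<lambda>X. max 0 (\<alpha> - (norm (X - X0))\<^sup>2) ^ 3)
    (\<lambda>X. (2 * (- 3 * max 0 (\<alpha> - (norm (X - X0))\<^sup>2) ^ 2)) *\<^sub>R (X - X0))"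
proof (rule test_fun_radial[OF R \<alpha>])
  show "max 0 (\<alpha> - t) ^ 3 = 0" if "\<alpha> \<le> t" for t using that by simp
  show "((\<lambda>t. max 0 (\<alpha> - t) ^ 3) has_real_derivative - 3 * max 0 (\<alpha> - t) ^ 2) (at t)" for t
  proof -
    have "((\<lambda>t. \<alpha> - t) has_real_derivative -1) (at t)" by (auto intro!: derivative_eq_intros)
    from DERIV_chain2[OF has_derivative_pos_power[of 1] this] show ?thesis
      by (simp add: eval_nat_numeral)
  qed
  show "continuous_on UNIV (\<lambda>t. - 3 * max 0 (\<alpha> - t) ^ 2)" by (intro continuous_intros)
qed

text \<open>Gauss's theorem for the field \<open>g Q Z\<close> on almost every disc, multiplied by
  \<open>r\<close>. The test field is the truncated cubic times \<open>Q Z\<close>; expanding its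
  divergence gives the hypothesis of \<open>radial_variation_identity\<close>.\<close>

lemma weak_gradient_radial_flux:
  assumes R: "0 < R" and wg: "weak_gradient (ball X0 R) g Dg"
    and gi: "set_integrable lebesgue (ball X0 R) g" and Dgi: "set_integrable lebesgue (ball X0 R) Dg"
    and Q: "C1_gradient Q DQ"
  shows "AE r in lebesgue. 0 < r \<and> r < R \<longrightarrow>
    circle_integral X0 r (\<lambda>X. (norm (X - X0))\<^sup>2 * Q X * g X) =
    r * (LINT X:ball X0 r|lebesgue. (2 * Q X + DQ X \<bullet> (X - X0)) * g X + Q X * ((X - X0) \<bullet> Dg X))"
proof (rule radial_variation_identity[OF R])
  let ?t = "\<lambda>X. (norm (X - X0))\<^sup>2"
  have c1: "set_integrable lebesgue (ball X0 R) (\<lambda>X. (2 * Q X + DQ X \<bullet> (X - X0)) * g X)"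
    by (intro set_integrable_continuous_mult gi continuous_intros C1_gradientD(2,3)[OF Q])
  have c2: "set_integrable lebesgue (ball X0 R) (\<lambda>X. Q X * ((X - X0) \<bullet> Dg X))"
    by (intro set_integrable_continuous_mult set_integrable_inner_continuous Dgi continuous_intros C1_gradientD(2,3)[OF Q])
  show "set_integrable lebesgue (ball X0 R) (\<lambda>X. (2 * Q X + DQ X \<bullet> (X - X0)) * g X + Q X * ((X - X0) \<bullet> Dg X))"
    by (rule set_integral_add(1)[OF c1 c2])
  show "set_integrable lebesgue (ball X0 R) (\<lambda>X. ?t X * Q X * g X)"
    by (intro set_integrable_continuous_mult gi continuous_intros C1_gradientD(2,3)[OF Q])
  fix \<alpha> :: real assume \<alpha>: "0 < \<alpha>" "\<alpha> < R\<^sup>2"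
  let ?p = "\<lambda>X. max 0 (\<alpha> - ?t X)"
  let ?\<kappa> = "\<lambda>t. max 0 (\<alpha> - t) ^ 3" and ?\<kappa>' = "\<lambda>t. - 3 * max 0 (\<alpha> - t) ^ 2"
  note tf = test_fun_truncated_cubic[OF R \<alpha>(2), of X0]
  have t1: "test_fun (ball X0 R) (\<lambda>X. ?\<kappa> (?t X) * (Q X * (fst X - fst X0)))
      (\<lambda>X. ?\<kappa> (?t X) *\<^sub>R (Q X *\<^sub>R (1, 0) + (fst X - fst X0) *\<^sub>R DQ X) + (Q X * (fst X - fst X0)) *\<^sub>R ((2 * ?\<kappa>' (?t X)) *\<^sub>R (X - X0)))"
    by (rule test_fun_mult[OF tf C1_gradient_mult[OF Q C1_gradient_fst]])
  have t2: "test_fun (ball X0 R) (\<lambda>X. ?\<kappa> (?t X) * (Q X * (snd X - snd X0)))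
      (\<lambda>X. ?\<kappa> (?t X) *\<^sub>R (Q X *\<^sub>R (0, 1) + (snd X - snd X0) *\<^sub>R DQ X) + (Q X * (snd X - snd X0)) *\<^sub>R ((2 * ?\<kappa>' (?t X)) *\<^sub>R (X - X0)))"
    by (rule test_fun_mult[OF tf C1_gradient_mult[OF Q C1_gradient_snd]])
  note dv = weak_gradient_divergence[OF wg t1 t2]
  have n2: "?t X = (fst X - fst X0)\<^sup>2 + (snd X - snd X0)\<^sup>2" for X
    by (simp add: norm_prod_def)
  then have n2': "norm (X - X0) * norm (X - X0) = (fst X - fst X0) * (fst X - fst X0) + (snd X - snd X0) * (snd X - snd X0)" for X
    by (simp only: power2_eq_square)
  let ?\<eta> = "\<lambda>X. ?\<kappa> (?t X) * (Q X * (fst X - fst X0)) * fst (Dg X) + ?\<kappa> (?t X) * (Q X * (snd X - snd X0)) * snd (Dg X)"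
  let ?d = "\<lambda>X. g X * (fst (?\<kappa> (?t X) *\<^sub>R (Q X *\<^sub>R (1, 0) + (fst X - fst X0) *\<^sub>R DQ X) + (Q X * (fst X - fst X0)) *\<^sub>R ((2 * ?\<kappa>' (?t X)) *\<^sub>R (X - X0)))
     + snd (?\<kappa> (?t X) *\<^sub>R (Q X *\<^sub>R (0, 1) + (snd X - snd X0) *\<^sub>R DQ X) + (Q X * (snd X - snd X0)) *\<^sub>R ((2 * ?\<kappa>' (?t X)) *\<^sub>R (X - X0))))"
  have "?p X ^ 3 * ((2 * Q X + DQ X \<bullet> (X - X0)) * g X + Q X * ((X - X0) \<bullet> Dg X))
          - 6 * ?p X ^ 2 * (?t X * Q X * g X) = ?d X + ?\<eta> X" for X
  proof -
    define p where "p = ?p X"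
    show ?thesis unfolding p_def[symmetric]
      by (simp add: inner_prod_def n2'[of X] algebra_simps power2_eq_square)
  qed
  then have "(LINT X:ball X0 R|lebesgue. ?p X ^ 3 * ((2 * Q X + DQ X \<bullet> (X - X0)) * g X + Q X * ((X - X0) \<bullet> Dg X))
          - 6 * ?p X ^ 2 * (?t X * Q X * g X)) = (LINT X:ball X0 R|lebesgue. ?d X + ?\<eta> X)"
    by presburger
  also have "\<dots> = 0"
    unfolding set_integral_add(2)[OF dv(1,2)] dv(3) by simp
  finally show "(LINT X:ball X0 R|lebesgue. ?p X ^ 3 * ((2 * Q X + DQ X \<bullet> (X - X0)) * g X + Q X * ((X - X0) \<bullet> Dg X))
          - 6 * ?p X ^ 2 * (?t X * Q X * g X)) = 0" .
qed


subsection \<open>Circle integrals of Sobolev functions\<close>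

text \<open>Two nested squares of positive parts: the inner one starts smoothly at
  \<open>\<tau>\<close>, the outer one saturates smoothly at \<open>2 * \<tau>\<close> at the
  latest.\<close>

lemma smooth_step:
  assumes \<tau>: "0 < (\<tau>::real)"
  shows "\<exists>l l'. (\<forall>t. (l has_real_derivative l' t) (at t)) \<and> continuous_on UNIV l' \<and>
    (\<forall>t\<le>\<tau>. l t = 0 \<and> l' t = 0) \<and> (\<forall>t\<ge>2*\<tau>. l t = 1 \<and> l' t = (0::real))"
proof (intro exI conjI allI impI)
  let ?v = "\<lambda>t. 1 - (max 0 (t - \<tau>))\<^sup>2 / \<tau>\<^sup>2"
  let ?l = "\<lambda>t. 1 - (max 0 (?v t))\<^sup>2" and ?l' = "\<lambda>t. 2 * max 0 (?v t) * (2 * max 0 (t - \<tau>) / \<tau>\<^sup>2)"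
  have sq: "((\<lambda>x. (max 0 x)\<^sup>2) has_real_derivative 2 * max 0 x) (at x)" for x :: real
    using has_derivative_pos_power[of 0 x] by (simp add: eval_nat_numeral)
  show "(?l has_real_derivative ?l' t) (at t)" for t
  proof -
    have 1: "((\<lambda>t. (max 0 (t - \<tau>))\<^sup>2) has_real_derivative 2 * max 0 (t - \<tau>)) (at t)"
      using DERIV_chain2[OF sq DERIV_diff[OF DERIV_ident DERIV_const[of \<tau>]]] by simp
    have 2: "(?v has_real_derivative - (2 * max 0 (t - \<tau>) / \<tau>\<^sup>2)) (at t)"
      using DERIV_diff[OF DERIV_const[of 1] DERIV_cdivide[OF 1, of "\<tau>\<^sup>2"]] by simp
    show ?thesis
      using DERIV_diff[OF DERIV_const[of 1] DERIV_chain2[OF sq 2]] by simp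
  qed
  show "continuous_on UNIV ?l'" using \<tau> by (intro continuous_intros) auto
  show "?l t = 0" "?l' t = 0" if "t \<le> \<tau>" for t using that by simp_all
  show "?l t = 1" "?l' t = 0" if "2 * \<tau> \<le> t" for t
  proof -
    have "\<tau>\<^sup>2 \<le> (max 0 (t - \<tau>))\<^sup>2" using that \<tau> by (intro power_mono) auto
    then have "?v t \<le> 0" using \<tau> by simp
    then show "?l t = 1" "?l' t = 0" by simp_all
  qed
qed

lemma has_derivative_norm_shift:
  fixes X X0 :: "real \<times> real"
  assumes "X \<noteq> X0"
  shows "((\<lambda>X. inverse (norm (X - X0))) has_derivative
    (\<lambda>v. - ((X - X0) \<bullet> v) / (norm (X - X0)) ^ 3)) (at X)"
proof -
  let ?n = "norm (X - X0)"
  have n: "0 < ?n" using assms by simp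
  have "((\<lambda>X. (norm (X - X0))\<^sup>2) has_derivative (\<lambda>v. (2 *\<^sub>R (X - X0)) \<bullet> v)) (at X)"
    by (rule C1_gradientD(1)[OF C1_gradient_sqnorm])
  moreover have "((\<lambda>t. inverse (sqrt t)) has_derivative (*) (- (inverse ?n)\<^sup>2 * (inverse ?n / 2))) (at (?n\<^sup>2))"
    unfolding has_field_derivative_def[symmetric]
    by (rule derivative_eq_intros refl | use n in \<open>simp add: power2_eq_square\<close>)+
  ultimately have "((\<lambda>X. inverse (sqrt ((norm (X - X0))\<^sup>2))) has_derivative
      (\<lambda>v. (- (inverse ?n)\<^sup>2 * (inverse ?n / 2)) * ((2 *\<^sub>R (X - X0)) \<bullet> v))) (at X)"
    by (rule has_derivative_compose)
  then have d: "((\<lambda>X. inverse (norm (X - X0))) has_derivative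
      (\<lambda>v. (- (inverse ?n)\<^sup>2 * (inverse ?n / 2)) * ((2 *\<^sub>R (X - X0)) \<bullet> v))) (at X)"
    by (simp only: real_sqrt_abs abs_norm_cancel)
  define Z where "Z = X - X0"
  show ?thesis
    using n by (intro has_derivative_eq_rhs[OF d], unfold Z_def[symmetric])
      (simp add: fun_eq_iff power2_eq_square power3_eq_cube field_simps)
qed

text \<open>With \<open>Q X\<close> the function below, \<open>2 * Q X + DQ X \<bullet> (X - X0)\<close> is the divergence of \<open>Q X *\<^sub>R (X - X0)\<close>; it
  vanishes where \<open>l\<close> is constant. The factor \<open>l\<close> removes the singularity at \<open>X0\<close>.\<close>

lemma C1_gradient_angular:
  assumes P: "C1_gradient P DP" and \<tau>: "0 < \<tau>"
    and l: "\<And>t. (l has_real_derivative l' t) (at t)" "continuous_on UNIV l'" "\<And>t. t \<le> \<tau> \<Longrightarrow> l t = 0 \<and> l' t = 0"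
  shows "\<exists>DQ. C1_gradient (\<lambda>X. l ((norm (X - X0))\<^sup>2) / (norm (X - X0))\<^sup>2 * P ((X - X0) /\<^sub>R norm (X - X0))) DQ \<and>
    (\<forall>X. 2 * (l ((norm (X - X0))\<^sup>2) / (norm (X - X0))\<^sup>2 * P ((X - X0) /\<^sub>R norm (X - X0))) + DQ X \<bullet> (X - X0)
        = 2 * l' ((norm (X - X0))\<^sup>2) * P ((X - X0) /\<^sub>R norm (X - X0)))"
proof -
  let ?t = "\<lambda>X. (norm (X - X0))\<^sup>2" and ?u = "\<lambda>X. (X - X0) /\<^sub>R norm (X - X0)"
  let ?Q = "\<lambda>X. l (?t X) / ?t X * P (?u X)"
  define DQ where "DQ X = (l (?t X) / ?t X) *\<^sub>R (inverse (norm (X - X0)) *\<^sub>R DP (?u X) - ((DP (?u X) \<bullet> (X - X0)) / norm (X - X0) ^ 3) *\<^sub>R (X - X0))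
     + (2 * (l' (?t X) / ?t X - l (?t X) / (?t X)\<^sup>2) * P (?u X)) *\<^sub>R (X - X0)" for X
  have far: "(?Q has_derivative (\<lambda>v. DQ X \<bullet> v)) (at X)" if X: "X \<noteq> X0" for X
  proof -
    have n: "0 < norm (X - X0)" using X by simp
    have Z: "((\<lambda>X. X - X0) has_derivative (\<lambda>v. v)) (at X)"
      by (rule has_derivative_eq_rhs[OF has_derivative_diff[OF has_derivative_ident has_derivative_const]]) simp
    have u: "(?u has_derivative (\<lambda>v. inverse (norm (X - X0)) *\<^sub>R v + (- ((X - X0) \<bullet> v) / (norm (X - X0)) ^ 3) *\<^sub>R (X - X0))) (at X)"
      by (rule has_derivative_scaleR[OF has_derivative_norm_shift[OF X] Z])
    have Pu: "((\<lambda>X. P (?u X)) has_derivative (\<lambda>v. DP (?u X) \<bullet> (inverse (norm (X - X0)) *\<^sub>R v + (- ((X - X0) \<bullet> v) / (norm (X - X0)) ^ 3) *\<^sub>R (X - X0)))) (at X)"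
      by (rule has_derivative_compose[OF u C1_gradientD(1)[OF P]])
    have t: "(?t has_derivative (\<lambda>v. (2 *\<^sub>R (X - X0)) \<bullet> v)) (at X)"
      by (rule C1_gradientD(1)[OF C1_gradient_sqnorm])
    have "((\<lambda>s. l s / s) has_real_derivative (l' (?t X) / ?t X - l (?t X) / (?t X)\<^sup>2)) (at (?t X))"
      by (rule derivative_eq_intros l refl | use n in \<open>simp add: field_simps power2_eq_square\<close>)+
    then have lt: "((\<lambda>s. l s / s) has_derivative (*) (l' (?t X) / ?t X - l (?t X) / (?t X)\<^sup>2)) (at (?t X))"
      by (simp add: has_field_derivative_def)
    have "((\<lambda>X. l (?t X) / ?t X) has_derivative (\<lambda>v. (l' (?t X) / ?t X - l (?t X) / (?t X)\<^sup>2) * ((2 *\<^sub>R (X - X0)) \<bullet> v))) (at X)"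
      by (rule has_derivative_compose[OF t lt])
    note m = has_derivative_mult[OF this Pu]
    define Z where "Z = X - X0"
    show ?thesis
      by (intro has_derivative_eq_rhs[OF m] ext, unfold DQ_def Z_def[symmetric])
        (simp add: inner_add_left inner_add_right inner_diff_left inner_commute algebra_simps)
  qed
  have op: "open {X. ?t X < \<tau>}"
    by (intro open_Collect_less continuous_intros)
  \<comment> \<open>Near the singular point the cut-off and its derivative vanish, which makes all
    the quotients harmless.\<close>
  have near: "?Q X = 0" "DQ X = 0" if "?t X < \<tau>" for X
    using l(3)[of "?t X"] that by (simp_all add: DQ_def)
  have "C1_gradient ?Q DQ"
  proof (rule C1_gradientI)
    fix X
    show "(?Q has_derivative (\<lambda>v. DQ X \<bullet> v)) (at X)"
    proof (cases "X = X0")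
      case True
      have "(?Q has_derivative (\<lambda>v. 0)) (at X)"
        by (rule has_derivative_transform_within_open[where f = "\<lambda>_. 0" and g = ?Q, OF has_derivative_const op])
          (simp_all add: True \<tau> l(3))
      then show ?thesis using near(2)[of X] True \<tau> by simp
    qed (rule far)
  next
    \<comment> \<open>Two open sets cover the plane: away from \<open>X0\<close> the formula for the
      gradient is continuous, near \<open>X0\<close> the gradient is zero.\<close>
    have U: "UNIV = - {X0} \<union> {X. ?t X < \<tau>}" using \<tau> by auto
    define u where "u = ?u"
    have ucont: "continuous_on (- {X0}) u" unfolding u_def by (intro continuous_intros) auto
    have "continuous_on (- {X0}) (\<lambda>X. DP (u X))"
      using continuous_on_compose[OF ucont C1_gradientD(2)[OF P]] by (simp add: comp_def)
    then have "continuous_on (- {X0}) (\<lambda>X. DP (?u X))" unfolding u_def .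
    moreover have "continuous_on (- {X0}) (\<lambda>X. P (u X))"
      using continuous_on_compose[OF ucont C1_gradientD(3)[OF P]] by (simp add: comp_def)
    then have "continuous_on (- {X0}) (\<lambda>X. P (?u X))" unfolding u_def .
    moreover have "continuous_on (- {X0}) (\<lambda>X. l (?t X))" "continuous_on (- {X0}) (\<lambda>X. l' (?t X))"
    proof -
      have "continuous_on UNIV l" by (rule DERIV_continuous_on[OF l(1)])
      then show "continuous_on (- {X0}) (\<lambda>X. l (?t X))" 
        by (rule continuous_on_compose2) (auto intro!: continuous_intros)
      show "continuous_on (- {X0}) (\<lambda>X. l' (?t X))" 
        by (rule continuous_on_compose2[OF l(2)]) (auto intro!: continuous_intros)
    qed
    ultimately have 1: "continuous_on (- {X0}) DQ"
      unfolding DQ_def by (intro continuous_intros) auto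
    have 2: "continuous_on {X. ?t X < \<tau>} DQ"
      by (rule continuous_on_eq[of _ "\<lambda>_. 0"]) (simp_all add: near(2))
    show "continuous_on UNIV DQ"
      unfolding U by (rule continuous_on_open_Un[OF _ op 1 2]) (simp add: open_Compl)
  qed
  moreover have "2 * ?Q X + DQ X \<bullet> (X - X0) = 2 * l' (?t X) * P (?u X)" for X
  proof (cases "X = X0")
    case True
    then show ?thesis using near[of X] l(3)[of 0] \<tau> by simp
  next
    case False
    then have n: "0 < norm (X - X0)" by simp
    have "DQ X \<bullet> (X - X0) = 2 * (l' (?t X) - l (?t X) / ?t X) * P (?u X)"
    proof -
      define Z m d p L L' where "Z = X - X0" and "m = norm (X - X0)" and "d = DP (?u X) \<bullet> Z" and "p = P (?u X)"
        and "L = l (?t X)" and "L' = l' (?t X)"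
      have m: "m \<noteq> 0" "Z \<bullet> Z = m\<^sup>2" using n by (simp_all add: m_def Z_def power2_norm_eq_inner)
      have "DQ X \<bullet> Z = (L / m\<^sup>2) * (inverse m * d - (d / m ^ 3) * (Z \<bullet> Z)) + (2 * (L' / m\<^sup>2 - L / (m\<^sup>2)\<^sup>2) * p) * (Z \<bullet> Z)"
        unfolding DQ_def Z_def[symmetric] by (simp add: inner_add_left inner_diff_left L_def L'_def m_def p_def d_def Z_def)
      \<comment> \<open>The direction Z / |Z| is homogeneous of degree zero, so \<open>P\<close> of
        it has no derivative along \<open>Z\<close>.\<close>
      also have "inverse m * d - (d / m ^ 3) * (Z \<bullet> Z) = 0"
        using m by (simp add: field_simps power2_eq_square power3_eq_cube)
      also have "(2 * (L' / m\<^sup>2 - L / (m\<^sup>2)\<^sup>2) * p) * (Z \<bullet> Z) = 2 * (L' - L / m\<^sup>2) * p"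
        using m by (simp add: field_simps power2_eq_square)
      finally show ?thesis by (simp add: Z_def m_def p_def L_def L'_def)
    qed
    then show ?thesis by (simp add: algebra_simps)
  qed
  ultimately show ?thesis by blast
qed

text \<open>Again an indefinite integral in the radius. Together with
  \<open>continuous_AE_eq\<close> this upgrades identities from almost every radius to every
  radius.\<close>

lemma continuous_ball_integral:
  fixes c :: "real \<times> real \<Rightarrow> real"
  assumes R: "0 < R" and c: "set_integrable lebesgue (ball X0 R) c"
  shows "continuous_on {0<..<R} (\<lambda>r. LINT X:ball X0 r|lebesgue. c X)"
proof -
  have h: "set_integrable lebesgue {0<..<R} (\<lambda>r. circle_integral X0 r c)"
    by (rule polar_coordinates(2)[OF R c])
  then have "(\<lambda>r. circle_integral X0 r c) integrable_on {0<..<R}"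
    by (rule set_lebesgue_integral_eq_integral(1))
  then have "(\<lambda>r. circle_integral X0 r c) integrable_on {0..R}"
    by (simp add: integrable_on_open_interval_real)
  then have "continuous_on {0..R} (\<lambda>r. integral {0..r} (\<lambda>r. circle_integral X0 r c))"
    by (rule indefinite_integral_continuous_1)
  then have 1: "continuous_on {0<..<R} (\<lambda>r. integral {0..r} (\<lambda>r. circle_integral X0 r c))"
    by (rule continuous_on_subset) auto
  have "integral {0..r} (\<lambda>r. circle_integral X0 r c) = (LINT X:ball X0 r|lebesgue. c X)" if r: "r \<in> {0<..<R}" for r
  proof -
    have "set_integrable lebesgue (ball X0 r) c"
      by (rule set_integrable_subset[OF c]) (use r in auto)
    with r have "(LINT X:ball X0 r|lebesgue. c X) = (LINT r:{0<..<r}|lebesgue. circle_integral X0 r c)"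
      by (intro polar_coordinates(3)) auto
    also have "\<dots> = integral {0<..<r} (\<lambda>r. circle_integral X0 r c)"
      by (rule set_lebesgue_integral_eq_integral(2)) (rule set_integrable_subset[OF h], use r in auto)
    finally show ?thesis by (simp add: integral_open_interval_real)
  qed
  with 1 show ?thesis by (rule continuous_on_eq) 
qed

text \<open>The points of disagreement form an open null set, and such a set is empty.\<close>

lemma continuous_AE_eq:
  fixes F G :: "real \<Rightarrow> real"
  assumes F: "continuous_on {a<..<b} F" and G: "continuous_on {a<..<b} G"
    and ae: "AE r in lebesgue. a < r \<and> r < b \<longrightarrow> F r = G r" and r: "a < r" "r < b"
  shows "F r = G r"
proof (rule ccontr)
  assume ne: "F r \<noteq> G r"
  let ?S = "{s \<in> {a<..<b}. F s - G s \<noteq> 0}"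
  have "open ?S"
    using open_Collect_neq[of] continuous_open_preimage[of "{a<..<b}" "\<lambda>s. F s - G s" "- {0}"] F G
    by (auto intro!: continuous_intros simp: vimage_def Int_def)
  moreover have "negligible ?S"
  proof -
    have "{s \<in> space lebesgue. \<not> (a < s \<and> s < b \<longrightarrow> F s = G s)} \<in> null_sets lebesgue"
      using ae unfolding completion.AE_iff_null_sets .
    moreover have "{s \<in> space lebesgue. \<not> (a < s \<and> s < b \<longrightarrow> F s = G s)} = ?S" by auto
    ultimately show ?thesis by (simp add: negligible_iff_null_sets)
  qed
  ultimately have "?S = {}" using open_not_negligible by blast
  with ne r show False by auto
qed

section \<open>Increments of angular integrals between two circles\<close>

lemma circ_diff: "circ X0 r \<theta> - X0 = r *\<^sub>R (cos \<theta>, sin \<theta>)"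
  by (simp add: circ_def)

lemma circ_direction: "0 < r \<Longrightarrow> (circ X0 r \<theta> - X0) /\<^sub>R norm (circ X0 r \<theta> - X0) = (cos \<theta>, sin \<theta>)"
  by (simp add: norm_circ) (simp add: circ_diff)

lemma circ_in_ball: "0 \<le> r \<Longrightarrow> r < R \<Longrightarrow> circ X0 r \<theta> \<in> ball X0 R"
  using norm_circ[of r X0 \<theta>] by (simp add: dist_norm norm_minus_commute)

lemma dist_circ: "0 \<le> r \<Longrightarrow> dist X0 (circ X0 r \<theta>) = r"
  using norm_circ[of r X0 \<theta>] by (simp add: dist_norm norm_minus_commute)

lemma continuous_on_circ: "continuous_on S (\<lambda>p. circ X0 (fst p) (snd p))"
  unfolding circ_def by (intro continuous_intros)

lemma continuous_on_circ': "continuous_on S (circ X0 r)"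
  unfolding circ_def by (intro continuous_intros)

lemma continuous_on_circle:
  assumes "continuous_on (ball X0 R) g" "0 < r" "r < R"
  shows "continuous_on S (\<lambda>\<theta>. g (circ X0 r \<theta>))"
  by (rule continuous_on_compose2[OF assms(1) continuous_on_circ'])
    (use assms in \<open>simp add: image_subset_iff dist_circ\<close>)

lemma set_integrable_interval_continuous:
  fixes f :: "real \<Rightarrow> real"
  assumes "continuous_on {a..b} f"
  shows "set_integrable lebesgue {a..b} f"
    using absolutely_integrable_continuous_real[OF assms] .

lemma set_integral_abs_diff_le:
  fixes f g :: "'a \<Rightarrow> real"
  assumes f: "set_integrable M S f" and g: "set_integrable M S g" and h: "set_integrable M S h"
    and le: "\<And>x. x \<in> S \<Longrightarrow> \<bar>f x - g x\<bar> \<le> h x"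
  shows "\<bar>(LINT x:S|M. f x) - (LINT x:S|M. g x)\<bar> \<le> (LINT x:S|M. h x)"
proof -
  have d: "set_integrable M S (\<lambda>x. f x - g x)" using f g by (rule set_integral_diff(1))
  have "(LINT x:S|M. f x - g x) \<le> (LINT x:S|M. h x)"
    by (rule set_integral_mono[OF d h]) (use le in force)
  moreover have "(LINT x:S|M. g x - f x) \<le> (LINT x:S|M. h x)"
    by (rule set_integral_mono[OF set_integral_diff(1)[OF g f] h]) (use le in force)
  ultimately show ?thesis
    using set_integral_diff(2)[OF f g] set_integral_diff(2)[OF g f] by linarith
qed

lemma set_integral_ball_diff:
  fixes c :: "real \<times> real \<Rightarrow> real"
  assumes c: "set_integrable lebesgue (ball X0 R) c" and "r \<le> s" "s \<le> R"
  shows "(LINT X:ball X0 s - ball X0 r|lebesgue. c X) = (LINT X:ball X0 s|lebesgue. c X) - (LINT X:ball X0 r|lebesgue. c X)"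
proof -
  have 1: "set_integrable lebesgue (ball X0 s - ball X0 r) c" "set_integrable lebesgue (ball X0 r) c"
    by (rule set_integrable_subset[OF c]; use assms in auto)+
  have "ball X0 s = (ball X0 s - ball X0 r) \<union> ball X0 r" using assms by auto
  then have "(LINT X:ball X0 s|lebesgue. c X) = (LINT X:(ball X0 s - ball X0 r) \<union> ball X0 r|lebesgue. c X)"
    by metis
  also have "\<dots> = (LINT X:ball X0 s - ball X0 r|lebesgue. c X) + (LINT X:ball X0 r|lebesgue. c X)"
    by (rule set_integral_Un[OF _ 1]) auto
  finally show ?thesis by simp
qed

text \<open>The flux identity holds only for almost every radius, while the increment needs it at
  \<open>r\<close> and \<open>s\<close> themselves. Both of its sides are continuous in the radius
  since \<open>g\<close> is continuous, hence it holds at every radius above \<open>r / 2\<close>.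
  In the difference only the annulus survives, and there the cut-off field is divergence
  free.\<close>

lemma angular_increment_C1:
  assumes R: "0 < R" and wg: "weak_gradient (ball X0 R) g Dg"
    and gi: "set_integrable lebesgue (ball X0 R) g" and Dgi: "set_integrable lebesgue (ball X0 R) Dg"
    and gc: "continuous_on (ball X0 R) g" and P: "C1_gradient P DP"
    and r: "0 < r" "r \<le> s" "s < R"
  shows "(LINT \<theta>:{0..2*pi}|lebesgue. (g (circ X0 s \<theta>) - g (circ X0 r \<theta>)) * P (cos \<theta>, sin \<theta>)) =
    (LINT X:ball X0 s - ball X0 r|lebesgue. P ((X - X0) /\<^sub>R norm (X - X0)) * (((X - X0) \<bullet> Dg X) / (norm (X - X0))\<^sup>2))"
proof -
  let ?t = "\<lambda>X. (norm (X - X0))\<^sup>2" and ?u = "\<lambda>X. (X - X0) /\<^sub>R norm (X - X0)"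
  \<comment> \<open>Then \<open>2 * \<tau>\<close> is the square of \<open>r / 2\<close>: the
    cut-off equals one at all radii above \<open>r / 2\<close>, an open interval that contains
    \<open>r\<close> and \<open>s\<close>.\<close>
  define \<tau> where "\<tau> = r\<^sup>2 / 8"
  have \<tau>: "0 < \<tau>" using r by (simp add: \<tau>_def)
  from smooth_step[OF \<tau>] obtain l l' where l: "\<And>t. (l has_real_derivative l' t) (at t)" "continuous_on UNIV l'"
     "\<And>t. t \<le> \<tau> \<Longrightarrow> l t = 0 \<and> l' t = 0" "\<And>t. 2 * \<tau> \<le> t \<Longrightarrow> l t = 1 \<and> l' t = 0" by blast
  let ?Q = "\<lambda>X. l (?t X) / ?t X * P (?u X)"
  from C1_gradient_angular[OF P \<tau> l(1,2,3), of X0] obtain DQ where Q: "C1_gradient ?Q DQ"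
    and DQ: "\<And>X. 2 * ?Q X + DQ X \<bullet> (X - X0) = 2 * l' (?t X) * P (?u X)" by blast
  let ?c = "\<lambda>X. (2 * ?Q X + DQ X \<bullet> (X - X0)) * g X + ?Q X * ((X - X0) \<bullet> Dg X)"
  have c1: "set_integrable lebesgue (ball X0 R) (\<lambda>X. (2 * ?Q X + DQ X \<bullet> (X - X0)) * g X)"
    by (intro set_integrable_continuous_mult gi continuous_on_add continuous_on_mult continuous_on_const
         continuous_on_inner continuous_on_diff continuous_on_id C1_gradientD(2,3)[OF Q])
  have c2: "set_integrable lebesgue (ball X0 R) (\<lambda>X. ?Q X * ((X - X0) \<bullet> Dg X))"
    by (intro set_integrable_continuous_mult set_integrable_inner_continuous Dgi continuous_on_diff continuous_on_id continuous_on_const C1_gradientD(3)[OF Q])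
  have c: "set_integrable lebesgue (ball X0 R) ?c" by (rule set_integral_add(1)[OF c1 c2])
  define q where "q r = (LINT \<theta>:{0..2*pi}|lebesgue. g (circ X0 r \<theta>) * P (cos \<theta>, sin \<theta>))" for r
  define C where "C r = (LINT X:ball X0 r|lebesgue. ?c X)" for r
  have tau_le: "2 * \<tau> \<le> \<rho>\<^sup>2" if "r / 2 < \<rho>" for \<rho>
  proof -
    have "(r / 2)\<^sup>2 \<le> \<rho>\<^sup>2" using that r by (intro power_mono) auto
    then show ?thesis by (simp add: \<tau>_def power_divide)
  qed
  have PC: "continuous_on S (\<lambda>\<theta>. P (cos \<theta>, sin \<theta>))" for S
    by (rule continuous_on_compose2[OF C1_gradientD(3)[OF P, of UNIV]]) (auto intro!: continuous_intros)
  have gcirc: "continuous_on {0..2*pi} (\<lambda>\<theta>. g (circ X0 \<rho> \<theta>))" if "0 < \<rho>" "\<rho> < R" for \<rho>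
    using gc that by (rule continuous_on_circle)
  have qi: "set_integrable lebesgue {0..2*pi} (\<lambda>\<theta>. g (circ X0 \<rho> \<theta>) * P (cos \<theta>, sin \<theta>))" if "0 < \<rho>" "\<rho> < R" for \<rho>
    by (intro set_integrable_interval_continuous continuous_on_mult gcirc PC that)
  have ae: "AE \<rho> in lebesgue. r / 2 < \<rho> \<and> \<rho> < R \<longrightarrow> q \<rho> = C \<rho>"
    using weak_gradient_radial_flux[OF R wg gi Dgi Q]
  proof eventually_elim
    case (elim \<rho>)
    show ?case
    proof
      assume \<rho>: "r / 2 < \<rho> \<and> \<rho> < R"
      then have \<rho>0: "0 < \<rho>" using r by auto
      have "circle_integral X0 \<rho> (\<lambda>X. ?t X * ?Q X * g X) =
          (LINT \<theta>:{0..2*pi}|lebesgue. \<rho> * (g (circ X0 \<rho> \<theta>) * P (cos \<theta>, sin \<theta>)))"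
      proof -
        have "?t X * ?Q X * g X * \<rho> = \<rho> * (g X * P (cos \<theta>, sin \<theta>))" if X: "X = circ X0 \<rho> \<theta>" for X \<theta>
        proof -
          have "norm (X - X0) = \<rho>" "?u X = (cos \<theta>, sin \<theta>)"
            unfolding X using norm_circ[of \<rho> X0 \<theta>] circ_direction[OF \<rho>0, of X0 \<theta>] \<rho>0 by simp_all
          then show ?thesis using l(4)[OF tau_le[of \<rho>]] \<rho> \<rho>0 by simp
        qed
        then show ?thesis unfolding circle_integral_def
          by (intro set_lebesgue_integral_cong) auto
      qed
      also have "\<dots> = \<rho> * q \<rho>" by (simp add: q_def)
      finally have "\<rho> * q \<rho> = \<rho> * C \<rho>" using elim \<rho> \<rho>0 by (simp add: C_def)
      then show "q \<rho> = C \<rho>" using \<rho>0 by simp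
    qed
  qed
  have Cc: "continuous_on {r / 2<..<R} C"
    unfolding C_def by (rule continuous_on_subset[OF continuous_ball_integral[OF R c]]) (use r in auto)
  have qc: "continuous_on {r / 2<..<R} q"
  proof -
    have "continuous_on ({r / 2<..<R} \<times> cbox 0 (2*pi)) (\<lambda>p. g (circ X0 (fst p) (snd p)) * P (cos (snd p), sin (snd p)))"
      by (intro continuous_on_mult continuous_on_compose2[OF gc continuous_on_circ]
          continuous_on_compose2[OF C1_gradientD(3)[OF P, of UNIV]] continuous_intros)
        (use r in \<open>auto simp del: mem_ball intro!: circ_in_ball\<close>)
    then have "continuous_on ({r / 2<..<R} \<times> cbox 0 (2*pi)) (\<lambda>(\<rho>, \<theta>). g (circ X0 \<rho> \<theta>) * P (cos \<theta>, sin \<theta>))"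
      by (simp add: case_prod_beta)
    from integral_continuous_on_param[OF this]
    have "continuous_on {r / 2<..<R} (\<lambda>\<rho>. integral {0..2*pi} (\<lambda>\<theta>. g (circ X0 \<rho> \<theta>) * P (cos \<theta>, sin \<theta>)))" by simp
    then show ?thesis
      by (rule continuous_on_eq) (use r set_lebesgue_integral_eq_integral(2)[OF qi] in \<open>auto simp: q_def\<close>)
  qed
  have eq: "q \<rho> = C \<rho>" if "r / 2 < \<rho>" "\<rho> < R" for \<rho>
    by (rule continuous_AE_eq[OF qc Cc ae that])
  have "(LINT \<theta>:{0..2*pi}|lebesgue. (g (circ X0 s \<theta>) - g (circ X0 r \<theta>)) * P (cos \<theta>, sin \<theta>)) = q s - q r"
    unfolding q_def left_diff_distrib using r by (intro set_integral_diff(2) qi) auto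
  also have "\<dots> = C s - C r" using eq[of s] eq[of r] r by simp
  also have "\<dots> = (LINT X:ball X0 s - ball X0 r|lebesgue. ?c X)"
    unfolding C_def by (rule set_integral_ball_diff[OF c, symmetric]) (use r in auto)
  also have "\<dots> = (LINT X:ball X0 s - ball X0 r|lebesgue. P (?u X) * (((X - X0) \<bullet> Dg X) / ?t X))"
  proof (rule set_lebesgue_integral_cong)
    show "\<forall>X. X \<in> ball X0 s - ball X0 r \<longrightarrow> ?c X = P (?u X) * (((X - X0) \<bullet> Dg X) / ?t X)"
    proof (intro allI impI)
      fix X assume "X \<in> ball X0 s - ball X0 r"
      then have "r \<le> norm (X - X0)" by (simp add: dist_norm norm_minus_commute)
      then have "r / 2 < norm (X - X0)" using r by linarith
      then show "?c X = P (?u X) * (((X - X0) \<bullet> Dg X) / ?t X)"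
        unfolding DQ using l(4)[OF tau_le] by simp
    qed
  qed auto
  finally show ?thesis .
qed

text \<open>Both sides are linear in the weight and continuous in its uniform norm on the unit
  circle, so the identity passes from polynomials to continuous weights.\<close>

lemma angular_increment:
  assumes R: "0 < R" and wg: "weak_gradient (ball X0 R) g Dg"
    and gi: "set_integrable lebesgue (ball X0 R) g" and Dgi: "set_integrable lebesgue (ball X0 R) Dg"
    and gc: "continuous_on (ball X0 R) g" and W: "continuous_on (sphere 0 1) W"
    and r: "0 < r" "r \<le> s" "s < R"
  shows "set_integrable lebesgue (ball X0 s - ball X0 r) (\<lambda>X. W ((X - X0) /\<^sub>R norm (X - X0)) * (((X - X0) \<bullet> Dg X) / (norm (X - X0))\<^sup>2))"
    and "(LINT \<theta>:{0..2*pi}|lebesgue. (g (circ X0 s \<theta>) - g (circ X0 r \<theta>)) * W (cos \<theta>, sin \<theta>)) =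
    (LINT X:ball X0 s - ball X0 r|lebesgue. W ((X - X0) /\<^sub>R norm (X - X0)) * (((X - X0) \<bullet> Dg X) / (norm (X - X0))\<^sup>2))"
proof -
  let ?A = "ball X0 s - ball X0 r"
  let ?u = "\<lambda>X. (X - X0) /\<^sub>R norm (X - X0)"
  let ?k = "\<lambda>X. ((X - X0) \<bullet> Dg X) / (norm (X - X0))\<^sup>2"
  let ?g = "\<lambda>\<theta>. g (circ X0 s \<theta>) - g (circ X0 r \<theta>)"
  have As: "?A \<in> sets lebesgue" by auto
  have An: "r \<le> norm (X - X0)" "X \<noteq> X0" if "X \<in> ?A" for X
    using that r by (auto simp: dist_norm norm_minus_commute)
  have ki: "set_integrable lebesgue ?A ?k"
  proof -
    have "set_integrable lebesgue (ball X0 R) (\<lambda>X. (X - X0) \<bullet> Dg X)"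
      by (intro set_integrable_inner_continuous Dgi continuous_intros)
    then have "set_integrable lebesgue ?A (\<lambda>X. (X - X0) \<bullet> Dg X)"
      by (rule set_integrable_subset) (use r in auto)
    then have "set_integrable lebesgue ?A (\<lambda>X. (1 / (norm (X - X0))\<^sup>2) * ((X - X0) \<bullet> Dg X))"
    proof (rule set_integrable_bounded_mult[rotated 2])
      show "set_borel_measurable lebesgue ?A (\<lambda>X. 1 / (norm (X - X0))\<^sup>2)"
        using An(2) by (intro set_borel_measurable_continuous_on continuous_intros As) auto
      show "\<bar>1 / (norm (X - X0))\<^sup>2\<bar> \<le> 1 / r\<^sup>2" if "X \<in> ?A" for X
        using An[OF that] r by (auto intro!: divide_left_mono power_mono mult_pos_pos)
    qed
    then show ?thesis by simp
  qed
  have ka: "set_integrable lebesgue ?A (\<lambda>X. \<bar>?k X\<bar>)" using ki by (rule set_integrable_abs)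
  have usph: "?u X \<in> sphere 0 1" if "X \<in> ?A" for X using An[OF that] by simp
  have Wk: "set_integrable lebesgue ?A (\<lambda>X. V (?u X) * ?k X)" if V: "continuous_on (sphere 0 1) V" for V :: "real \<times> real \<Rightarrow> real"
  proof -
    obtain B where B: "\<forall>x \<in> V ` sphere 0 1. norm x \<le> B"
      using compact_imp_bounded[OF compact_continuous_image[OF V compact_sphere]] unfolding bounded_iff by blast
    show ?thesis
    proof (rule set_integrable_bounded_mult[OF _ _ ki])
      have "continuous_on ?A ?u" using An(2) by (intro continuous_intros) auto
      then have "continuous_on ?A (\<lambda>X. V (?u X))"
        by (rule continuous_on_compose2[OF V]) (use usph in auto)
      then show "set_borel_measurable lebesgue ?A (\<lambda>X. V (?u X))"
        by (rule set_borel_measurable_continuous_on[OF _ As])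
      show "\<bar>V (?u X)\<bar> \<le> B" if "X \<in> ?A" for X using B usph[OF that] by auto
    qed
  qed
  then show "set_integrable lebesgue ?A (\<lambda>X. W (?u X) * ?k X)" using W .
  have gcirc: "continuous_on {0..2*pi} (\<lambda>\<theta>. g (circ X0 \<rho> \<theta>))" if "0 < \<rho>" "\<rho> < R" for \<rho>
    using gc that by (rule continuous_on_circle)
  have gd: "continuous_on {0..2*pi} ?g" using r by (intro continuous_on_diff gcirc) auto
  have Vg: "set_integrable lebesgue {0..2*pi} (\<lambda>\<theta>. ?g \<theta> * V (cos \<theta>, sin \<theta>))" if V: "continuous_on (sphere 0 1) V" for V :: "real \<times> real \<Rightarrow> real"
    by (intro set_integrable_interval_continuous continuous_on_mult gd continuous_on_compose2[OF V] continuous_intros)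
      (auto simp: norm_Pair)
  have gda: "set_integrable lebesgue {0..2*pi} (\<lambda>\<theta>. \<bar>?g \<theta>\<bar>)"
    by (intro set_integrable_interval_continuous continuous_on_rabs gd)
  define A where "A V = (LINT \<theta>:{0..2*pi}|lebesgue. ?g \<theta> * V (cos \<theta>, sin \<theta>))" for V :: "real \<times> real \<Rightarrow> real"
  define B where "B V = (LINT X:?A|lebesgue. V (?u X) * ?k X)" for V :: "real \<times> real \<Rightarrow> real"
  \<comment> \<open>A bound for the sum of the changes of the two sides per unit of the uniform
    distance between two weights.\<close>
  let ?c = "(LINT \<theta>:{0..2*pi}|lebesgue. \<bar>?g \<theta>\<bar>) + (LINT X:?A|lebesgue. \<bar>?k X\<bar>)"
  have "\<bar>A W - B W\<bar> \<le> e * ?c" if e: "0 < e" for e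
  proof -
    obtain P where P: "polynomial_function P" "\<And>x. x \<in> sphere 0 1 \<Longrightarrow> norm (W x - P x) < e"
      using Stone_Weierstrass_polynomial_function[OF compact_sphere W e] by blast
    then have "real_polynomial_function P" by (simp add: real_polynomial_function_eq)
    then obtain DP where DP: "C1_gradient P DP" using C1_gradient_real_polynomial by blast
    note Pc = C1_gradientD(3)[OF DP]
    have AB: "A P = B P" unfolding A_def B_def by (rule angular_increment_C1[OF R wg gi Dgi gc DP r])
    have "\<bar>A W - A P\<bar> \<le> (LINT \<theta>:{0..2*pi}|lebesgue. e * \<bar>?g \<theta>\<bar>)"
      unfolding A_def
    proof (rule set_integral_abs_diff_le[OF Vg[OF W] Vg[OF Pc]])
      show "set_integrable lebesgue {0..2*pi} (\<lambda>\<theta>. e * \<bar>?g \<theta>\<bar>)" using gda by simp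
      fix \<theta>
      have "\<bar>W (cos \<theta>, sin \<theta>) - P (cos \<theta>, sin \<theta>)\<bar> \<le> e"
        using P(2)[of "(cos \<theta>, sin \<theta>)"] by (simp add: norm_Pair)
      then have "\<bar>?g \<theta>\<bar> * \<bar>W (cos \<theta>, sin \<theta>) - P (cos \<theta>, sin \<theta>)\<bar> \<le> \<bar>?g \<theta>\<bar> * e" by (rule mult_left_mono) simp
      then show "\<bar>?g \<theta> * W (cos \<theta>, sin \<theta>) - ?g \<theta> * P (cos \<theta>, sin \<theta>)\<bar> \<le> e * \<bar>?g \<theta>\<bar>"
        by (simp add: abs_mult[symmetric] right_diff_distrib mult.commute)
    qed
    moreover have "\<bar>B W - B P\<bar> \<le> (LINT X:?A|lebesgue. e * \<bar>?k X\<bar>)"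
      unfolding B_def
    proof (rule set_integral_abs_diff_le[OF Wk[OF W] Wk[OF Pc]])
      show "set_integrable lebesgue ?A (\<lambda>X. e * \<bar>?k X\<bar>)" using ka by (rule set_integrable_mult_right)
      fix X assume X: "X \<in> ?A"
      have "\<bar>W (?u X) - P (?u X)\<bar> \<le> e" using P(2)[OF usph[OF X]] by simp
      then have "\<bar>W (?u X) - P (?u X)\<bar> * \<bar>?k X\<bar> \<le> e * \<bar>?k X\<bar>" by (rule mult_right_mono) simp
      then show "\<bar>W (?u X) * ?k X - P (?u X) * ?k X\<bar> \<le> e * \<bar>?k X\<bar>"
        by (simp only: abs_mult[symmetric] left_diff_distrib)
    qed
    ultimately show ?thesis using AB unfolding set_integral_mult_right distrib_left by linarith
  qed
  moreover have "0 \<le> ?c"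
    by (intro add_nonneg_nonneg) (simp_all add: set_lebesgue_integral_def integral_nonneg_AE)
  ultimately have "\<bar>A W - B W\<bar> \<le> 0"
  proof -
    assume *: "\<And>e. 0 < e \<Longrightarrow> \<bar>A W - B W\<bar> \<le> e * ?c" and c: "0 \<le> ?c"
    show ?thesis
    proof (rule field_le_epsilon)
      fix e :: real assume e: "0 < e"
      have "\<bar>A W - B W\<bar> \<le> (e / (?c + 1)) * ?c" by (rule *) (use e c in auto)
      also have "\<dots> = e * (?c / (?c + 1))" by simp
      also have "\<dots> \<le> e * 1" using e c by (intro mult_left_mono) auto
      finally show "\<bar>A W - B W\<bar> \<le> 0 + e" by simp
    qed
  qed
  then show "(LINT \<theta>:{0..2*pi}|lebesgue. ?g \<theta> * W (cos \<theta>, sin \<theta>)) = (LINT X:?A|lebesgue. W (?u X) * ?k X)"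
    by (simp add: A_def B_def)
qed

text \<open>The weight for the squares is the sum of the values of \<open>g\<close> at the two ends
  of a radial segment, times \<open>m\<close> at the end of radius \<open>s\<close>. Uniform
  continuity on the closed disc compares it with \<open>2 * g X * m X\<close> at any point
  \<open>X\<close> of the segment, uniformly in the direction.\<close>

lemma circle_sum_uniform:
  fixes g m :: "real \<times> real \<Rightarrow> real"
  assumes gc: "continuous_on (cball X0 b) g" and mc: "continuous_on (cball X0 b) m" and e: "0 < e"
  shows "\<exists>d>0. \<forall>u X s r. norm u = 1 \<and> 0 \<le> s \<and> s \<le> b \<and> 0 \<le> r \<and> r \<le> b \<and> \<bar>s - r\<bar> < d \<and>
     X = X0 + norm (X - X0) *\<^sub>R u \<and> min r s \<le> norm (X - X0) \<and> norm (X - X0) \<le> max r s \<longrightarrow>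
     \<bar>(g (X0 + s *\<^sub>R u) + g (X0 + r *\<^sub>R u)) * m (X0 + s *\<^sub>R u) - 2 * g X * m X\<bar> \<le> e"
proof -
  obtain C where C: "C \<ge> 0" "\<forall>X\<in>cball X0 b. \<bar>g X\<bar> \<le> C" using bounded_on_ball_continuous[OF gc] by blast
  have um: "uniformly_continuous_on (cball X0 b) m" using mc by (rule compact_uniformly_continuous) simp
  have ug: "uniformly_continuous_on (cball X0 b) (\<lambda>X. g X * m X)"
    using continuous_on_mult[OF gc mc] by (rule compact_uniformly_continuous) simp
  obtain d1 where d1: "d1 > 0" "\<And>x x'. x \<in> cball X0 b \<Longrightarrow> x' \<in> cball X0 b \<Longrightarrow> dist x' x < d1 \<Longrightarrow> dist (g x' * m x') (g x * m x) < e / 4"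
    using ug[unfolded uniformly_continuous_on_def, rule_format, of "e / 4"] e by auto
  \<comment> \<open>This tolerance is later multiplied by a value of \<open>g\<close>; the summand 1
    keeps the denominator positive even if \<open>C\<close> is zero.\<close>
  have "0 < e / (4 * (C + 1))" using e C by simp
  then obtain d2 where d2: "d2 > 0" "\<And>x x'. x \<in> cball X0 b \<Longrightarrow> x' \<in> cball X0 b \<Longrightarrow> dist x' x < d2 \<Longrightarrow> dist (m x') (m x) < e / (4 * (C + 1))"
    using um[unfolded uniformly_continuous_on_def, rule_format, of "e / (4 * (C + 1))"] by auto
  show ?thesis
  proof (intro exI[of _ "min d1 d2"] conjI allI impI)
    show "0 < min d1 d2" using d1 d2 by simp
    fix u X s r
    assume *: "norm u = 1 \<and> 0 \<le> s \<and> s \<le> b \<and> 0 \<le> r \<and> r \<le> b \<and> \<bar>s - r\<bar> < min d1 d2 \<and>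
     X = X0 + norm (X - X0) *\<^sub>R u \<and> min r s \<le> norm (X - X0) \<and> norm (X - X0) \<le> max r s"
    define \<rho> where "\<rho> = norm (X - X0)"
    let ?A = "X0 + s *\<^sub>R u" and ?B = "X0 + r *\<^sub>R u"
    have X: "X = X0 + \<rho> *\<^sub>R u" "min r s \<le> \<rho>" "\<rho> \<le> max r s" "0 \<le> \<rho>" using * by (simp_all add: \<rho>_def)
    have dd: "dist (X0 + p *\<^sub>R u) (X0 + q *\<^sub>R u) = \<bar>p - q\<bar>" for p q
      using * by (simp add: dist_norm scaleR_diff_left[symmetric])
    have inb: "X0 + p *\<^sub>R u \<in> cball X0 b" if "0 \<le> p" "p \<le> b" for p
      using * that by (simp add: dist_norm)
    have A: "?A \<in> cball X0 b" "?B \<in> cball X0 b" "X \<in> cball X0 b"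
      using inb[of s] inb[of r] inb[of \<rho>] X * by (auto simp: max_def split: if_splits)
    have d: "dist ?A X < min d1 d2" "dist ?B X < min d1 d2" "dist ?A ?B < min d1 d2"
      unfolding X(1) dd using X * by (auto simp: min_def max_def abs_if split: if_splits)
    have 1: "\<bar>g ?A * m ?A - g X * m X\<bar> < e / 4" "\<bar>g ?B * m ?B - g X * m X\<bar> < e / 4"
      using d1(2)[of X ?A] d1(2)[of X ?B] A d by (auto simp: dist_real_def)
    have 2: "\<bar>m ?A - m ?B\<bar> < e / (4 * (C + 1))"
      using d2(2)[of ?B ?A] A d by (auto simp: dist_real_def)
    have "\<bar>g ?B * (m ?A - m ?B)\<bar> \<le> (C + 1) * (e / (4 * (C + 1)))"
    proof -
      have "\<bar>g ?B\<bar> \<le> C + 1" using C(2)[rule_format, OF A(2)] by simp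
      then show ?thesis unfolding abs_mult using 2 C by (intro mult_mono) auto
    qed
    also have "\<dots> = e / 4"
    proof -
      have "C + 1 \<noteq> 0" using C by linarith
      then show ?thesis by (simp add: divide_simps)
    qed
    finally have 3: "\<bar>g ?B * (m ?A - m ?B)\<bar> \<le> e / 4" .
    \<comment> \<open>Two errors of the product \<open>g m\<close> and one error of \<open>m\<close>
      alone, each at most \<open>e / 4\<close>.\<close>
    have "(g ?A + g ?B) * m ?A - 2 * g X * m X = (g ?A * m ?A - g X * m X) + (g ?B * m ?B - g X * m X) + g ?B * (m ?A - m ?B)"
      by (simp add: algebra_simps)
    also have "\<bar>\<dots>\<bar> \<le> e" using 1 3 e by linarith
    finally show "\<bar>(g ?A + g ?B) * m ?A - 2 * g X * m X\<bar> \<le> e" .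
  qed
qed

text \<open>A difference of squares is the difference times the sum; the sum times \<open>m\<close>
  serves as the angular weight. Replacing this weight by \<open>2 * g X * m X\<close> costs
  \<open>e\<close> times the integral of the modulus of the radial derivative over the annulus,
  which is of the order of \<open>e * \<bar>s - r\<bar>\<close> at a good radius
  \<open>r\<close>.\<close>

lemma circle_square_increment:
  assumes R: "0 < R" and wg: "weak_gradient (ball X0 R) g Dg"
    and gi: "set_integrable lebesgue (ball X0 R) g" and Dgi: "set_integrable lebesgue (ball X0 R) Dg"
    and gc: "continuous_on (ball X0 R) g" and mc: "continuous_on (ball X0 R) m" and b: "b < R" and e: "0 < e"
  shows "\<exists>d>0. \<forall>r s. 0 < r \<and> r \<le> b \<and> 0 < s \<and> s \<le> b \<and> \<bar>s - r\<bar> < d \<longrightarrow>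
    \<bar>(LINT \<theta>:{0..2*pi}|lebesgue. ((g (circ X0 s \<theta>))\<^sup>2 - (g (circ X0 r \<theta>))\<^sup>2) * m (circ X0 s \<theta>))
      - sgn (s - r) * (LINT X:ball X0 (max r s) - ball X0 (min r s)|lebesgue. (2 * g X * m X) * (((X - X0) \<bullet> Dg X) / (norm (X - X0))\<^sup>2))\<bar>
    \<le> e * (LINT X:ball X0 (max r s) - ball X0 (min r s)|lebesgue. \<bar>((X - X0) \<bullet> Dg X) / (norm (X - X0))\<^sup>2\<bar>)"
proof -
  have gb: "continuous_on (cball X0 b) g" and mb: "continuous_on (cball X0 b) m"
    by (rule continuous_on_subset[OF gc] continuous_on_subset[OF mc]; use b in auto)+
  obtain d where d: "d > 0" "\<And>u X s r. norm u = 1 \<Longrightarrow> 0 \<le> s \<Longrightarrow> s \<le> b \<Longrightarrow> 0 \<le> r \<Longrightarrow> r \<le> b \<Longrightarrow> \<bar>s - r\<bar> < d \<Longrightarrow>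
     X = X0 + norm (X - X0) *\<^sub>R u \<Longrightarrow> min r s \<le> norm (X - X0) \<Longrightarrow> norm (X - X0) \<le> max r s \<Longrightarrow>
     \<bar>(g (X0 + s *\<^sub>R u) + g (X0 + r *\<^sub>R u)) * m (X0 + s *\<^sub>R u) - 2 * g X * m X\<bar> \<le> e"
    using circle_sum_uniform[OF gb mb e] by blast
  show ?thesis
  proof (intro exI[of _ d] conjI allI impI)
    fix r s assume *: "0 < r \<and> r \<le> b \<and> 0 < s \<and> s \<le> b \<and> \<bar>s - r\<bar> < d"
    let ?A = "ball X0 (max r s) - ball X0 (min r s)"
    let ?k = "\<lambda>X. ((X - X0) \<bullet> Dg X) / (norm (X - X0))\<^sup>2"
    let ?u = "\<lambda>X. (X - X0) /\<^sub>R norm (X - X0)"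
    let ?W = "\<lambda>u. (g (X0 + s *\<^sub>R u) + g (X0 + r *\<^sub>R u)) * m (X0 + s *\<^sub>R u)"
    have in_ball: "X0 + p *\<^sub>R u \<in> ball X0 R" if "0 < p" "p \<le> b" "u \<in> sphere 0 1" for p u
      using that b by (auto simp: dist_norm)
    have cc: "continuous_on (sphere 0 1) (\<lambda>u. h (X0 + p *\<^sub>R u))" if "continuous_on (ball X0 R) h" "0 < p" "p \<le> b" for h :: "real \<times> real \<Rightarrow> real" and p
      by (rule continuous_on_compose2[OF that(1)]) (use that in_ball in \<open>auto intro!: continuous_intros simp del: mem_ball mem_sphere\<close>)
    have Wc: "continuous_on (sphere 0 1) ?W"
      by (intro continuous_on_mult continuous_on_add cc gc mc) (use * in auto)
    have r: "0 < min r s" "min r s \<le> max r s" "max r s < R" using * b by auto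
    note inc = angular_increment[OF R wg gi Dgi gc Wc r]
    have circW: "?W (cos \<theta>, sin \<theta>) = (g (circ X0 s \<theta>) + g (circ X0 r \<theta>)) * m (circ X0 s \<theta>)" for \<theta>
      by (simp add: circ_def)
    have T: "(LINT \<theta>:{0..2*pi}|lebesgue. ((g (circ X0 s \<theta>))\<^sup>2 - (g (circ X0 r \<theta>))\<^sup>2) * m (circ X0 s \<theta>))
        = sgn (s - r) * (LINT X:?A|lebesgue. ?W (?u X) * ?k X)"
    proof -
      \<comment> \<open>\<open>angular_increment\<close> orders the radii. Exchanging them keeps the
        sum of the two values and reverses the difference, which the factor
        \<open>sgn (s - r)\<close> records.\<close>
      have "((g (circ X0 s \<theta>))\<^sup>2 - (g (circ X0 r \<theta>))\<^sup>2) * m (circ X0 s \<theta>) =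
         sgn (s - r) * ((g (circ X0 (max r s) \<theta>) - g (circ X0 (min r s) \<theta>)) * ?W (cos \<theta>, sin \<theta>))" for \<theta>
        unfolding circW by (auto simp: max_def min_def sgn_if power2_eq_square algebra_simps)
      then have "(LINT \<theta>:{0..2*pi}|lebesgue. ((g (circ X0 s \<theta>))\<^sup>2 - (g (circ X0 r \<theta>))\<^sup>2) * m (circ X0 s \<theta>))
        = (LINT \<theta>:{0..2*pi}|lebesgue. sgn (s - r) * ((g (circ X0 (max r s) \<theta>) - g (circ X0 (min r s) \<theta>)) * ?W (cos \<theta>, sin \<theta>)))"
        by presburger
      also have "\<dots> = sgn (s - r) * (LINT X:?A|lebesgue. ?W (?u X) * ?k X)"
        unfolding set_integral_mult_right inc(2) ..
      finally show ?thesis .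
    qed
    have k: "set_integrable lebesgue ?A ?k"
      using angular_increment(1)[OF R wg gi Dgi gc continuous_on_const[of _ 1] r] by simp
    have gm: "set_integrable lebesgue ?A (\<lambda>X. (2 * g X * m X) * ?k X)"
    proof -
      have "continuous_on (cball X0 b) (\<lambda>X. 2 * g X * m X)"
        by (intro continuous_on_mult continuous_on_const gb mb)
      moreover from bounded_on_ball_continuous[OF this] obtain B where B: "\<forall>X\<in>cball X0 b. \<bar>2 * g X * m X\<bar> \<le> B" by blast
      ultimately show ?thesis
      proof (intro set_integrable_bounded_mult[OF _ _ k])
        show "set_borel_measurable lebesgue ?A (\<lambda>X. 2 * g X * m X)"
          if "continuous_on (cball X0 b) (\<lambda>X. 2 * g X * m X)"
          by (intro set_borel_measurable_continuous_on continuous_on_subset[OF that]) (use * in auto)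
        show "\<bar>2 * g X * m X\<bar> \<le> B" if "X \<in> ?A" for X
          using B that * by (auto simp: max_def split: if_splits)
      qed
    qed
    have "\<bar>(LINT X:?A|lebesgue. ?W (?u X) * ?k X) - (LINT X:?A|lebesgue. (2 * g X * m X) * ?k X)\<bar>
       \<le> (LINT X:?A|lebesgue. e * \<bar>?k X\<bar>)"
    proof (rule set_integral_abs_diff_le[OF inc(1) gm])
      show "set_integrable lebesgue ?A (\<lambda>X. e * \<bar>?k X\<bar>)"
        by (rule set_integrable_mult_right[OF set_integrable_abs[OF k]])
      fix X assume X: "X \<in> ?A"
      then have n: "min r s \<le> norm (X - X0)" "norm (X - X0) \<le> max r s"
        by (auto simp: dist_norm norm_minus_commute min_def max_def split: if_splits)
      then have n0: "0 < norm (X - X0)" using r by linarith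
      have "\<bar>?W (?u X) - 2 * g X * m X\<bar> \<le> e"
        by (rule d(2)) (use * n n0 in auto)
      then have "\<bar>?W (?u X) - 2 * g X * m X\<bar> * \<bar>?k X\<bar> \<le> e * \<bar>?k X\<bar>" by (rule mult_right_mono) simp
      then show "\<bar>?W (?u X) * ?k X - (2 * g X * m X) * ?k X\<bar> \<le> e * \<bar>?k X\<bar>"
        by (simp only: abs_mult[symmetric] left_diff_distrib)
    qed
    then have D: "\<bar>(LINT X:?A|lebesgue. ?W (?u X) * ?k X) - (LINT X:?A|lebesgue. (2 * g X * m X) * ?k X)\<bar>
       \<le> e * (LINT X:?A|lebesgue. \<bar>?k X\<bar>)" unfolding set_integral_mult_right .
    moreover have "0 \<le> e * (LINT X:?A|lebesgue. \<bar>?k X\<bar>)"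
      using e by (simp add: set_lebesgue_integral_def integral_nonneg_AE)
    ultimately show "\<bar>(LINT \<theta>:{0..2*pi}|lebesgue. ((g (circ X0 s \<theta>))\<^sup>2 - (g (circ X0 r \<theta>))\<^sup>2) * m (circ X0 s \<theta>))
      - sgn (s - r) * (LINT X:?A|lebesgue. (2 * g X * m X) * ?k X)\<bar> \<le> e * (LINT X:?A|lebesgue. \<bar>?k X\<bar>)"
      unfolding T by (auto simp: sgn_if)
  qed (rule d)
qed

text \<open>The lower bound \<open>a\<close> keeps the radii away from the singularity of 1 / |Z|^2.
  The increment splits into the change of \<open>g\<close>, controlled by
  \<open>circle_square_increment\<close>, and the change of the weight \<open>1 / fst X\<close>,
  which is smooth in the radius.\<close>

lemma circle_square_derivative_aux:
  assumes R: "0 < R" and wg: "weak_gradient (ball X0 R) g Dg"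
    and gi: "set_integrable lebesgue (ball X0 R) g" and Dgi: "set_integrable lebesgue (ball X0 R) Dg"
    and gc: "continuous_on (ball X0 R) g" and pos: "\<forall>X\<in>ball X0 R. 0 < fst X"
    and ab: "0 < a" "a < b" "b < R"
  shows "AE r in lebesgue. a < r \<and> r < b \<longrightarrow>
    ((\<lambda>r. LINT \<theta>:{0..2*pi}|lebesgue. 1 / fst (circ X0 r \<theta>) * (g (circ X0 r \<theta>))\<^sup>2) has_real_derivative
      circle_integral X0 r (\<lambda>X. 2 * g X / fst X * ((X - X0) \<bullet> Dg X)) / r^2
      - circle_integral X0 r (\<lambda>X. (fst X - fst X0) / (fst X)\<^sup>2 * (g X)\<^sup>2) / r^2) (at r)"
proof -
  let ?m = "\<lambda>X::real\<times>real. 1 / fst X"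
  let ?k = "\<lambda>X. ((X - X0) \<bullet> Dg X) / (norm (X - X0))\<^sup>2"
  \<comment> \<open>Agrees with \<open>?k\<close> at distance at least \<open>a\<close> from
    \<open>X0\<close>, and is integrable on the whole disc because its factor in front of the inner
    product is bounded.\<close>
  let ?K = "\<lambda>X. 1 / max (a\<^sup>2) ((norm (X - X0))\<^sup>2) * ((X - X0) \<bullet> Dg X)"
  have b: "0 < b" using ab by simp
  have mc: "continuous_on (ball X0 R) ?m" using pos by (intro continuous_intros) force
  have sub: "cball X0 b \<subseteq> ball X0 R" using ab by auto
  have Dgb: "set_integrable lebesgue (ball X0 b) Dg"
    by (rule set_integrable_subset[OF Dgi]) (use ab in auto)
  have "continuous_on (cball X0 b) (\<lambda>X. 1 / max (a\<^sup>2) ((norm (X - X0))\<^sup>2))"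
  proof (intro continuous_intros ballI)
    show "max (a\<^sup>2) ((norm (X - X0))\<^sup>2) \<noteq> 0" for X using ab zero_less_power2[of a] by (auto simp: max_def)
  qed
  then have Ki: "set_integrable lebesgue (ball X0 b) ?K"
    by (rule set_integrable_continuous_mult) (intro set_integrable_inner_continuous Dgb continuous_intros)
  have Ka: "set_integrable lebesgue (ball X0 b) (\<lambda>X. \<bar>?K X\<bar>)" using Ki by (rule set_integrable_abs)
  have Ni: "set_integrable lebesgue (ball X0 b) (\<lambda>X. (2 * g X * ?m X) * ?K X)"
    by (intro set_integrable_continuous_mult Ki continuous_on_mult continuous_on_const
        continuous_on_subset[OF gc sub] continuous_on_subset[OF mc sub])
  have Keq: "?K X = ?k X" if "a \<le> norm (X - X0)" for X
  proof -
    have "a\<^sup>2 \<le> (norm (X - X0))\<^sup>2" using that ab by (intro power_mono) auto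
    then show ?thesis by (simp add: max_absorb2)
  qed
  let ?M = "\<lambda>s. LINT X:ball X0 s|lebesgue. \<bar>?K X\<bar>"
  let ?N = "\<lambda>s. LINT X:ball X0 s|lebesgue. (2 * g X * ?m X) * ?K X"
  have gcirc: "continuous_on S (\<lambda>\<theta>. g (circ X0 s \<theta>))" "continuous_on S (\<lambda>\<theta>. ?m (circ X0 s \<theta>))"
    if "0 < s" "s < R" for s S
    using continuous_on_circle[OF gc that] continuous_on_circle[OF mc that] .
  show ?thesis
    using AE_has_derivative_ball_integral[OF b Ka] AE_has_derivative_ball_integral[OF b Ni]
  proof eventually_elim
    case (elim r)
    show ?case
    proof
      assume rab: "a < r \<and> r < b"
      then have r: "0 < r" "r < b" "r < R" using ab by auto
      define M' N' where "M' = circle_integral X0 r (\<lambda>X. \<bar>?K X\<bar>)"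
        and "N' = circle_integral X0 r (\<lambda>X. (2 * g X * ?m X) * ?K X)"
      have M: "(?M has_real_derivative M') (at r)" and N: "(?N has_real_derivative N') (at r)"
        using elim r by (simp_all add: M'_def N'_def)
      \<comment> \<open>\<open>T1\<close> changes the function with the weight taken at
        \<open>s\<close>, \<open>T2\<close> changes the weight with the function frozen at
        \<open>r\<close>.\<close>
      define T1 where "T1 s = (LINT \<theta>:{0..2*pi}|lebesgue. ((g (circ X0 s \<theta>))\<^sup>2 - (g (circ X0 r \<theta>))\<^sup>2) * ?m (circ X0 s \<theta>))" for s
      define T2 where "T2 s = (LINT \<theta>:{0..2*pi}|lebesgue. (g (circ X0 r \<theta>))\<^sup>2 * ?m (circ X0 s \<theta>))" for s
      define \<Delta> where "\<Delta> s = T1 s - (?N s - ?N r)" for s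
      have \<Delta>r: "\<Delta> r = 0" by (simp add: \<Delta>_def T1_def)
      \<comment> \<open>\<open>?N\<close> and \<open>?M\<close> are the disc integrals of the main
        term and of the error bound. As \<open>?M\<close> is differentiable at \<open>r\<close> and
        \<open>e\<close> is arbitrary, the difference \<open>\<Delta>\<close> is of smaller order
        than \<open>s - r\<close>.\<close>
      have \<Delta>: "\<exists>d>0. \<forall>s. \<bar>s - r\<bar> < d \<longrightarrow> \<bar>\<Delta> s\<bar> \<le> e * \<bar>?M s - ?M r\<bar>" if e: "0 < e" for e
      proof -
        let ?P = "\<lambda>r s. \<bar>(LINT \<theta>:{0..2*pi}|lebesgue. ((g (circ X0 s \<theta>))\<^sup>2 - (g (circ X0 r \<theta>))\<^sup>2) * ?m (circ X0 s \<theta>))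
          - sgn (s - r) * (LINT X:ball X0 (max r s) - ball X0 (min r s)|lebesgue. (2 * g X * ?m X) * ?k X)\<bar>
            \<le> e * (LINT X:ball X0 (max r s) - ball X0 (min r s)|lebesgue. \<bar>?k X\<bar>)"
        obtain d where d0: "d > 0" and dP: "\<forall>r s. 0 < r \<and> r \<le> b \<and> 0 < s \<and> s \<le> b \<and> \<bar>s - r\<bar> < d \<longrightarrow> ?P r s"
          using circle_square_increment[OF R wg gi Dgi gc mc ab(3) e] by (elim exE conjE)
        have d: "d > 0" "\<And>s. 0 < s \<Longrightarrow> s \<le> b \<Longrightarrow> \<bar>s - r\<bar> < d \<Longrightarrow>
          \<bar>T1 s - sgn (s - r) * (LINT X:ball X0 (max r s) - ball X0 (min r s)|lebesgue. (2 * g X * ?m X) * ?k X)\<bar>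
            \<le> e * (LINT X:ball X0 (max r s) - ball X0 (min r s)|lebesgue. \<bar>?k X\<bar>)"
          unfolding T1_def by (rule d0, rule dP[rule_format], use r in simp)
        show ?thesis
        proof (intro exI[of _ "min d (min (r - a) (b - r))"] conjI allI impI)
          show "0 < min d (min (r - a) (b - r))" using d rab by simp
          fix s assume "\<bar>s - r\<bar> < min d (min (r - a) (b - r))"
          then have s: "\<bar>s - r\<bar> < d" "a < s" "s < b" by auto
          let ?A = "ball X0 (max r s) - ball X0 (min r s)"
          have An: "a \<le> norm (X - X0)" if "X \<in> ?A" for X
          proof -
            have "X \<notin> ball X0 (min r s)" using that by blast
            then have "min r s \<le> norm (X - X0)" by (simp only: mem_ball dist_norm norm_minus_commute[of X0] not_less)
            moreover have "a \<le> min r s" using s rab by simp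
            ultimately show ?thesis by (rule order_trans[rotated])
          qed
          have mm: "min r s \<le> max r s" "max r s \<le> b" using s rab by auto
          have 1: "(LINT X:?A|lebesgue. (2 * g X * ?m X) * ?k X) = ?N (max r s) - ?N (min r s)"
          proof -
            have "(LINT X:?A|lebesgue. (2 * g X * ?m X) * ?k X) = (LINT X:?A|lebesgue. (2 * g X * ?m X) * ?K X)"
              by (rule set_lebesgue_integral_cong, simp, intro allI impI, simp only: Keq[OF An])
            also have "\<dots> = ?N (max r s) - ?N (min r s)" by (rule set_integral_ball_diff[OF Ni mm])
            finally show ?thesis .
          qed
          have 2: "(LINT X:?A|lebesgue. \<bar>?k X\<bar>) = ?M (max r s) - ?M (min r s)"
          proof -
            have "(LINT X:?A|lebesgue. \<bar>?k X\<bar>) = (LINT X:?A|lebesgue. \<bar>?K X\<bar>)"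
              by (rule set_lebesgue_integral_cong, simp, intro allI impI, simp only: Keq[OF An])
            also have "\<dots> = ?M (max r s) - ?M (min r s)" by (rule set_integral_ball_diff[OF Ka mm])
            finally show ?thesis .
          qed
          have nn: "0 \<le> ?M (max r s) - ?M (min r s)"
            unfolding 2[symmetric] by (simp add: set_lebesgue_integral_def integral_nonneg_AE)
          have "sgn (s - r) * (?N (max r s) - ?N (min r s)) = ?N s - ?N r"
            by (auto simp: sgn_if max_def min_def)
          moreover have "?M (max r s) - ?M (min r s) = \<bar>?M s - ?M r\<bar>"
            using nn by (auto simp: max_def min_def)
          moreover have "\<bar>T1 s - sgn (s - r) * (?N (max r s) - ?N (min r s))\<bar> \<le> e * (?M (max r s) - ?M (min r s))"
            using d(2)[of s] s ab unfolding 1 2 by simp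
          ultimately show "\<bar>\<Delta> s\<bar> \<le> e * \<bar>?M s - ?M r\<bar>"
            unfolding \<Delta>_def by presburger
        qed
      qed
      have "(\<Delta> has_real_derivative 0) (at r)"
        unfolding has_field_derivative_iff
      proof (rule tendstoI)
        fix \<epsilon> :: real assume \<epsilon>: "0 < \<epsilon>"
        \<comment> \<open>The quotients of \<open>?M\<close> are eventually below
          \<open>\<bar>M'\<bar> + 1\<close>, so those of \<open>\<Delta>\<close> are at most
          \<open>\<epsilon> / 2\<close>.\<close>
        define e where "e = \<epsilon> / (2 * (\<bar>M'\<bar> + 1))"
        have e: "0 < e" using \<epsilon> by (simp add: e_def add_nonneg_pos)
        obtain d where d: "d > 0" "\<And>s. \<bar>s - r\<bar> < d \<Longrightarrow> \<bar>\<Delta> s\<bar> \<le> e * \<bar>?M s - ?M r\<bar>"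
          using \<Delta>[OF e] by blast
        have "((\<lambda>s. \<bar>(?M s - ?M r) / (s - r)\<bar>) \<longlongrightarrow> \<bar>M'\<bar>) (at r)"
          using M unfolding has_field_derivative_iff by (rule tendsto_rabs)
        then have "\<forall>\<^sub>F s in at r. \<bar>(?M s - ?M r) / (s - r)\<bar> < \<bar>M'\<bar> + 1"
          by (rule order_tendstoD) simp
        moreover have "\<forall>\<^sub>F s in at r. s \<noteq> r \<and> \<bar>s - r\<bar> < d"
          unfolding eventually_at using d(1) by (auto simp: dist_real_def)
        ultimately show "\<forall>\<^sub>F s in at r. dist ((\<Delta> s - \<Delta> r) / (s - r)) 0 < \<epsilon>"
        proof eventually_elim
          case (elim s)
          have "\<bar>\<Delta> s\<bar> / \<bar>s - r\<bar> \<le> e * \<bar>?M s - ?M r\<bar> / \<bar>s - r\<bar>"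
            using d(2)[of s] elim by (intro divide_right_mono) auto
          also have "\<dots> = e * \<bar>(?M s - ?M r) / (s - r)\<bar>" by simp
          also have "\<dots> \<le> e * (\<bar>M'\<bar> + 1)" using elim e by (intro mult_left_mono) auto
          also have "\<dots> = \<epsilon> / 2" by (simp add: e_def add_nonneg_eq_0_iff field_simps)
          also have "\<dots> < \<epsilon>" using \<epsilon> by simp
          finally show ?case by (simp add: \<Delta>r dist_real_def)
        qed
      qed
      from DERIV_add[OF this DERIV_diff[OF N DERIV_const[of "?N r"]]]
      have dT1: "(T1 has_real_derivative N') (at r)" by (simp add: \<Delta>_def)
      have posc: "0 < fst (circ X0 s \<theta>)" if "0 < s" "s < R" for s \<theta>
        using pos circ_in_ball[of s R X0 \<theta>] that by simp
      have dT2: "(T2 has_real_derivative (LINT \<theta>:{0..2*pi}|lebesgue. (g (circ X0 r \<theta>))\<^sup>2 * (- cos \<theta> / (fst (circ X0 r \<theta>))\<^sup>2))) (at r)"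
      proof -
        obtain B where B: "0 \<le> B" "\<forall>X\<in>cball X0 b. \<bar>?m X\<bar> \<le> B"
          using bounded_on_ball_continuous[OF continuous_on_subset[OF mc sub]] by blast
        have inc: "circ X0 s \<theta> \<in> cball X0 b" if "0 < s" "s < b" for s \<theta>
          using that by (simp add: dist_circ)
        show ?thesis unfolding T2_def
        proof (rule has_derivative_set_integral_parameter[where d = "min r (b - r)" and H = "\<lambda>\<theta>. (g (circ X0 r \<theta>))\<^sup>2 * B\<^sup>2"])
          show "0 < min r (b - r)" using r by simp
          show "set_integrable lebesgue {0..2*pi} (\<lambda>\<theta>. (g (circ X0 r \<theta>))\<^sup>2 * ?m (circ X0 s \<theta>))"
            if "\<bar>s - r\<bar> < min r (b - r)" for s
            by (intro set_integrable_interval_continuous continuous_on_mult continuous_on_power gcirc) (use that ab r in auto)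
          show "set_integrable lebesgue {0..2*pi} (\<lambda>\<theta>. (g (circ X0 r \<theta>))\<^sup>2 * B\<^sup>2)"
            by (intro set_integrable_interval_continuous continuous_on_mult continuous_on_power continuous_on_const gcirc) (use r in auto)
          show "set_borel_measurable lebesgue {0..2*pi} (\<lambda>\<theta>. (g (circ X0 r \<theta>))\<^sup>2 * (- cos \<theta> / (fst (circ X0 r \<theta>))\<^sup>2))"
          proof (rule set_borel_measurable_continuous_on)
            have "continuous_on {0..2*pi} (\<lambda>\<theta>. (g (circ X0 r \<theta>))\<^sup>2 * (- cos \<theta> * (?m (circ X0 r \<theta>))\<^sup>2))"
              by (intro continuous_on_mult continuous_on_power continuous_on_minus continuous_on_cos continuous_on_id gcirc r)
            then show "continuous_on {0..2*pi} (\<lambda>\<theta>. (g (circ X0 r \<theta>))\<^sup>2 * (- cos \<theta> / (fst (circ X0 r \<theta>))\<^sup>2))"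
              by (simp add: power_divide)
          qed auto
          show "AE \<theta> in lebesgue. \<theta> \<in> {0..2*pi} \<longrightarrow> ((\<lambda>s. (g (circ X0 r \<theta>))\<^sup>2 * ?m (circ X0 s \<theta>)) has_real_derivative
            (g (circ X0 r \<theta>))\<^sup>2 * (- cos \<theta> / (fst (circ X0 r \<theta>))\<^sup>2)) (at r)"
          proof (intro AE_I2 impI)
            fix \<theta>
            have f: "fst (circ X0 s \<theta>) = fst X0 + s * cos \<theta>" for s by (simp add: circ_def)
            have p: "fst X0 + r * cos \<theta> \<noteq> 0" using posc[of r \<theta>] r f by simp
            show "((\<lambda>s. (g (circ X0 r \<theta>))\<^sup>2 * ?m (circ X0 s \<theta>)) has_real_derivative
              (g (circ X0 r \<theta>))\<^sup>2 * (- cos \<theta> / (fst (circ X0 r \<theta>))\<^sup>2)) (at r)"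
              unfolding f by (rule derivative_eq_intros refl p | simp add: power2_eq_square)+
          qed
          fix s \<theta> assume s: "\<bar>s - r\<bar> < min r (b - r)"
          then have s': "0 < s" "s < b" by auto
          let ?x = "fst (circ X0 s \<theta>)" and ?y = "fst (circ X0 r \<theta>)"
          have p: "0 < ?x" "0 < ?y" using posc[of s \<theta>] posc[of r \<theta>] s' r ab by auto
          have "?m (circ X0 s \<theta>) - ?m (circ X0 r \<theta>) = - ((s - r) * cos \<theta>) * (?m (circ X0 s \<theta>) * ?m (circ X0 r \<theta>))"
            using p by (simp add: circ_def field_simps)
          also have "\<bar>\<dots>\<bar> = \<bar>s - r\<bar> * \<bar>cos \<theta>\<bar> * (\<bar>?m (circ X0 s \<theta>)\<bar> * \<bar>?m (circ X0 r \<theta>)\<bar>)"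
            by (simp add: abs_mult)
          also have "\<dots> \<le> \<bar>s - r\<bar> * 1 * (B * B)"
            by (intro mult_mono mult_nonneg_nonneg abs_ge_zero order_refl abs_cos_le_one
               B(2)[rule_format, OF inc[OF s']] B(2)[rule_format, OF inc[OF r(1,2)]]) (use B in auto)
          finally have l: "\<bar>?m (circ X0 s \<theta>) - ?m (circ X0 r \<theta>)\<bar> \<le> B\<^sup>2 * \<bar>s - r\<bar>" by (simp add: power2_eq_square mult.commute)
          have "\<bar>(g (circ X0 r \<theta>))\<^sup>2 * ?m (circ X0 s \<theta>) - (g (circ X0 r \<theta>))\<^sup>2 * ?m (circ X0 r \<theta>)\<bar>
             = (g (circ X0 r \<theta>))\<^sup>2 * \<bar>?m (circ X0 s \<theta>) - ?m (circ X0 r \<theta>)\<bar>"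
            by (simp only: right_diff_distrib[symmetric] abs_mult abs_power2)
          also have "\<dots> \<le> (g (circ X0 r \<theta>))\<^sup>2 * (B\<^sup>2 * \<bar>s - r\<bar>)" by (intro mult_left_mono l) simp
          finally show "\<bar>(g (circ X0 r \<theta>))\<^sup>2 * ?m (circ X0 s \<theta>) - (g (circ X0 r \<theta>))\<^sup>2 * ?m (circ X0 r \<theta>)\<bar>
             \<le> (g (circ X0 r \<theta>))\<^sup>2 * B\<^sup>2 * \<bar>s - r\<bar>" by (simp add: mult.assoc)
        qed
      qed
      have split: "T1 s + T2 s = (LINT \<theta>:{0..2*pi}|lebesgue. 1 / fst (circ X0 s \<theta>) * (g (circ X0 s \<theta>))\<^sup>2)" if s: "0 < s" "s < R" for s
      proof -
        have "set_integrable lebesgue {0..2*pi} (\<lambda>\<theta>. ((g (circ X0 s \<theta>))\<^sup>2 - (g (circ X0 r \<theta>))\<^sup>2) * ?m (circ X0 s \<theta>))"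
          "set_integrable lebesgue {0..2*pi} (\<lambda>\<theta>. (g (circ X0 r \<theta>))\<^sup>2 * ?m (circ X0 s \<theta>))"
          by (intro set_integrable_interval_continuous continuous_on_mult continuous_on_diff continuous_on_power gcirc s r)+
        then have "T1 s + T2 s = (LINT \<theta>:{0..2*pi}|lebesgue. ((g (circ X0 s \<theta>))\<^sup>2 - (g (circ X0 r \<theta>))\<^sup>2) * ?m (circ X0 s \<theta>) + (g (circ X0 r \<theta>))\<^sup>2 * ?m (circ X0 s \<theta>))"
          unfolding T1_def T2_def by (rule set_integral_add(2)[symmetric])
        also have "\<dots> = (LINT \<theta>:{0..2*pi}|lebesgue. 1 / fst (circ X0 s \<theta>) * (g (circ X0 s \<theta>))\<^sup>2)"
          by (rule set_lebesgue_integral_cong) (auto simp: add_divide_distrib[symmetric])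
        finally show ?thesis .
      qed
      have "\<forall>\<^sub>F s in nhds r. s \<in> {0<..<R}"
        using r by (intro eventually_nhds_in_open) auto
      then have ev: "\<forall>\<^sub>F s in nhds r. T1 s + T2 s = (LINT \<theta>:{0..2*pi}|lebesgue. 1 / fst (circ X0 s \<theta>) * (g (circ X0 s \<theta>))\<^sup>2)"
        by eventually_elim (rule split; simp)
      have N': "N' = circle_integral X0 r (\<lambda>X. 2 * g X / fst X * ((X - X0) \<bullet> Dg X)) / r^2"
      proof -
        have "N' = (LINT \<theta>:{0..2*pi}|lebesgue. (1 / r\<^sup>2) * (2 * g (circ X0 r \<theta>) / fst (circ X0 r \<theta>) * ((circ X0 r \<theta> - X0) \<bullet> Dg (circ X0 r \<theta>)) * r))"
          unfolding N'_def circle_integral_def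
        proof (rule set_lebesgue_integral_cong, simp, intro allI impI)
          fix \<theta>
          have "a \<le> norm (circ X0 r \<theta> - X0)" using rab r by (simp add: norm_circ)
          note K = Keq[OF this]
          show "(2 * g (circ X0 r \<theta>) * ?m (circ X0 r \<theta>)) * ?K (circ X0 r \<theta>) * r =
             (1 / r\<^sup>2) * (2 * g (circ X0 r \<theta>) / fst (circ X0 r \<theta>) * ((circ X0 r \<theta> - X0) \<bullet> Dg (circ X0 r \<theta>)) * r)"
            unfolding K using r by (simp add: norm_circ)
        qed
        then show ?thesis unfolding set_integral_mult_right circle_integral_def by simp
      qed
      have T2': "(LINT \<theta>:{0..2*pi}|lebesgue. (g (circ X0 r \<theta>))\<^sup>2 * (- cos \<theta> / (fst (circ X0 r \<theta>))\<^sup>2))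
         = - (circle_integral X0 r (\<lambda>X. (fst X - fst X0) / (fst X)\<^sup>2 * (g X)\<^sup>2) / r^2)"
      proof -
        have "(LINT \<theta>:{0..2*pi}|lebesgue. (g (circ X0 r \<theta>))\<^sup>2 * (- cos \<theta> / (fst (circ X0 r \<theta>))\<^sup>2))
          = (LINT \<theta>:{0..2*pi}|lebesgue. - (1 / r\<^sup>2) * ((fst (circ X0 r \<theta>) - fst X0) / (fst (circ X0 r \<theta>))\<^sup>2 * (g (circ X0 r \<theta>))\<^sup>2 * r))"
        proof (rule set_lebesgue_integral_cong, simp, intro allI impI)
          fix \<theta>
          have f: "fst (circ X0 r \<theta>) - fst X0 = r * cos \<theta>" by (simp add: circ_def)
          show "(g (circ X0 r \<theta>))\<^sup>2 * (- cos \<theta> / (fst (circ X0 r \<theta>))\<^sup>2) =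
            - (1 / r\<^sup>2) * ((fst (circ X0 r \<theta>) - fst X0) / (fst (circ X0 r \<theta>))\<^sup>2 * (g (circ X0 r \<theta>))\<^sup>2 * r)"
            unfolding f using r by (simp add: field_simps power2_eq_square)
        qed
        then show ?thesis unfolding set_integral_mult_right circle_integral_def by simp
      qed
      from DERIV_add[OF dT1 dT2, unfolded N' T2']
      show "((\<lambda>r. LINT \<theta>:{0..2*pi}|lebesgue. 1 / fst (circ X0 r \<theta>) * (g (circ X0 r \<theta>))\<^sup>2) has_real_derivative
      circle_integral X0 r (\<lambda>X. 2 * g X / fst X * ((X - X0) \<bullet> Dg X)) / r^2
      - circle_integral X0 r (\<lambda>X. (fst X - fst X0) / (fst X)\<^sup>2 * (g X)\<^sup>2) / r^2) (at r)"
        unfolding DERIV_cong_ev[OF refl ev refl] by simp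
    qed
  qed
qed

text \<open>The lower bounds 1 / (n + 1) exhaust the positive radii, and countably many null sets
  have a null union. The first term of the derivative comes from the arc length factor
  \<open>r\<close>.\<close>

lemma AE_has_derivative_circle_square:
  assumes R: "0 < R" and wg: "weak_gradient (ball X0 R) g Dg"
    and gi: "set_integrable lebesgue (ball X0 R) g" and Dgi: "set_integrable lebesgue (ball X0 R) Dg"
    and gc: "continuous_on (ball X0 R) g" and pos: "\<forall>X\<in>ball X0 R. 0 < fst X"
    and b: "b < R"
  shows "AE r in lebesgue. 0 < r \<and> r < b \<longrightarrow>
    ((\<lambda>r. circle_integral X0 r (\<lambda>X. 1 / fst X * (g X)\<^sup>2)) has_real_derivative
      circle_integral X0 r (\<lambda>X. 1 / fst X * (g X)\<^sup>2) / r
      + circle_integral X0 r (\<lambda>X. 2 * g X / fst X * ((X - X0) \<bullet> Dg X)) / r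
      - circle_integral X0 r (\<lambda>X. (fst X - fst X0) / (fst X)\<^sup>2 * (g X)\<^sup>2) / r) (at r)"
proof -
  have "AE r in lebesgue. \<forall>n::nat. inverse (real (Suc n)) < b \<longrightarrow> inverse (real (Suc n)) < r \<and> r < b \<longrightarrow>
    ((\<lambda>r. LINT \<theta>:{0..2*pi}|lebesgue. 1 / fst (circ X0 r \<theta>) * (g (circ X0 r \<theta>))\<^sup>2) has_real_derivative
      circle_integral X0 r (\<lambda>X. 2 * g X / fst X * ((X - X0) \<bullet> Dg X)) / r^2
      - circle_integral X0 r (\<lambda>X. (fst X - fst X0) / (fst X)\<^sup>2 * (g X)\<^sup>2) / r^2) (at r)"
    unfolding AE_all_countable
  proof (intro allI)
    fix n :: nat
    show "AE r in lebesgue. inverse (real (Suc n)) < b \<longrightarrow> inverse (real (Suc n)) < r \<and> r < b \<longrightarrow>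
    ((\<lambda>r. LINT \<theta>:{0..2*pi}|lebesgue. 1 / fst (circ X0 r \<theta>) * (g (circ X0 r \<theta>))\<^sup>2) has_real_derivative
      circle_integral X0 r (\<lambda>X. 2 * g X / fst X * ((X - X0) \<bullet> Dg X)) / r^2
      - circle_integral X0 r (\<lambda>X. (fst X - fst X0) / (fst X)\<^sup>2 * (g X)\<^sup>2) / r^2) (at r)"
    proof (cases "inverse (real (Suc n)) < b")
      case True
      have "0 < inverse (real (Suc n))" by simp
      from circle_square_derivative_aux[OF R wg gi Dgi gc pos this True b] show ?thesis
        by eventually_elim simp
    qed simp
  qed
  then show ?thesis
  proof eventually_elim
    case (elim r)
    show ?case
    proof
      assume r: "0 < r \<and> r < b"
      then obtain n where n: "inverse (real (Suc n)) < r" using reals_Archimedean by blast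
      let ?q = "\<lambda>r. LINT \<theta>:{0..2*pi}|lebesgue. 1 / fst (circ X0 r \<theta>) * (g (circ X0 r \<theta>))\<^sup>2"
      \<comment> \<open>The arc length factor is split off, so that the product rule applies to the
        angular integral \<open>?q\<close>.\<close>
      have e: "(\<lambda>r. circle_integral X0 r (\<lambda>X. 1 / fst X * (g X)\<^sup>2)) = (\<lambda>r. r * ?q r)"
        unfolding circle_integral_def set_integral_mult_left by (simp only: mult.commute)
      have d: "(?q has_real_derivative circle_integral X0 r (\<lambda>X. 2 * g X / fst X * ((X - X0) \<bullet> Dg X)) / r^2
      - circle_integral X0 r (\<lambda>X. (fst X - fst X0) / (fst X)\<^sup>2 * (g X)\<^sup>2) / r^2) (at r)"
        using elim n r by (meson less_trans)
      show "((\<lambda>r. circle_integral X0 r (\<lambda>X. 1 / fst X * (g X)\<^sup>2)) has_real_derivative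
      circle_integral X0 r (\<lambda>X. 1 / fst X * (g X)\<^sup>2) / r
      + circle_integral X0 r (\<lambda>X. 2 * g X / fst X * ((X - X0) \<bullet> Dg X)) / r
      - circle_integral X0 r (\<lambda>X. (fst X - fst X0) / (fst X)\<^sup>2 * (g X)\<^sup>2) / r) (at r)"
        unfolding e fun_cong[OF e]
        by (rule DERIV_cong[OF DERIV_mult[OF DERIV_ident d]]) (use r in \<open>simp add: field_simps power2_eq_square\<close>)
    qed
  qed
qed


subsection \<open>The weighted Sobolev space on a disc\<close>

lemma set_borel_measurable_add:
  fixes f g :: "'a \<Rightarrow> 'b::{second_countable_topology, real_normed_vector}"
  assumes "set_borel_measurable M S f" "set_borel_measurable M S g"
  shows "set_borel_measurable M S (\<lambda>x. f x + g x)"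
  using borel_measurable_add[of "\<lambda>x. indicator S x *\<^sub>R f x" M "\<lambda>x. indicator S x *\<^sub>R g x"] assms
  unfolding set_borel_measurable_def scaleR_add_right by blast

lemma set_borel_measurable_power2:
  fixes f :: "'a \<Rightarrow> real"
  assumes "set_borel_measurable M S f"
  shows "set_borel_measurable M S (\<lambda>x. (f x)\<^sup>2)"
  using set_borel_measurable_mult[OF assms assms] by (simp add: power2_eq_square)

lemma set_borel_measurable_norm:
  fixes f :: "'a \<Rightarrow> 'b::{second_countable_topology, real_normed_vector}"
  assumes "set_borel_measurable M S f"
  shows "set_borel_measurable M S (\<lambda>x. norm (f x))"
proof -
  have e: "(\<lambda>x. indicator S x *\<^sub>R norm (f x)) = (\<lambda>x. norm (indicator S x *\<^sub>R f x))"
    by (auto simp: indicator_def)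
  show ?thesis
    using assms unfolding set_borel_measurable_def e by (rule measurable_compose[OF _ borel_measurable_norm])
qed

lemma set_integrable_const_ball:
  fixes X0 :: "real \<times> real"
  shows "set_integrable lebesgue (ball X0 R) (\<lambda>X. c::real)"
proof -
  have "integrable lebesgue (indicat_real (ball X0 R))"
    using emeasure_lborel_ball_finite[of X0 R] by (intro integrable_real_indicator) auto
  then show ?thesis unfolding set_integrable_def by simp
qed

lemma set_integrable_cong_on:
  assumes "set_integrable M S f" "\<And>x. x \<in> S \<Longrightarrow> f x = g x"
  shows "set_integrable M S g"
  by (rule iffD1[OF set_integrable_cong[OF refl refl] assms(1)]) (rule assms(2))

lemma set_integrable_bound_real:
  fixes g :: "'a \<Rightarrow> 'b::{banach, second_countable_topology}"
  assumes f: "set_integrable M S f" and g: "set_borel_measurable M S g" and le: "\<And>x. x \<in> S \<Longrightarrow> norm (g x) \<le> (f x :: real)"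
  shows "set_integrable M S g"
proof (rule set_integrable_bound[OF f g])
  show "AE x in M. x \<in> S \<longrightarrow> norm (g x) \<le> norm (f x)"
    by (intro AE_I2 impI) (use le in force)
qed

text \<open>The closed disc is used, so that compactness bounds \<open>1 / fst X\<close>.\<close>

definition positive_disc :: "real \<times> real \<Rightarrow> real \<Rightarrow> bool" where
  "positive_disc X0 R \<longleftrightarrow> 0 < R \<and> (\<forall>X\<in>cball X0 R. 0 < fst X)"

lemma positive_discD:
  assumes "positive_disc X0 R"
  shows "0 < R" "X \<in> cball X0 R \<Longrightarrow> 0 < fst X" "X \<in> ball X0 R \<Longrightarrow> 0 < fst X"
    "continuous_on (cball X0 R) (\<lambda>X. 1 / fst X)"
proof -
  have p: "X \<in> cball X0 R \<Longrightarrow> 0 < fst X" for X using assms unfolding positive_disc_def by blast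
  show "0 < R" using assms unfolding positive_disc_def by blast
  show "X \<in> cball X0 R \<Longrightarrow> 0 < fst X" by (rule p)
  show "X \<in> ball X0 R \<Longrightarrow> 0 < fst X" using p[of X] by simp
  show "continuous_on (cball X0 R) (\<lambda>X. 1 / fst X)"
    by (intro continuous_intros ballI) (use p in force)
qed

text \<open>Both \<open>fst X\<close> and its inverse are bounded on the disc, so the weighted space
  is the ordinary one with the two squares integrable separately.\<close>

lemma W12w_ball_iff:
  assumes d: "positive_disc X0 R"
  shows "W12w (ball X0 R) g Dg \<longleftrightarrow>
    set_borel_measurable lebesgue (ball X0 R) g \<and> set_borel_measurable lebesgue (ball X0 R) Dg \<and>
    weak_gradient (ball X0 R) g Dg \<and>
    set_integrable lebesgue (ball X0 R) (\<lambda>X. (g X)\<^sup>2) \<and> set_integrable lebesgue (ball X0 R) (\<lambda>X. (norm (Dg X))\<^sup>2)"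
proof -
  let ?B = "ball X0 R"
  let ?S = "\<lambda>X. (g X)\<^sup>2 + (norm (Dg X))\<^sup>2"
  have "set_integrable lebesgue ?B (\<lambda>X. 1 / fst X * ?S X) \<longleftrightarrow>
     set_integrable lebesgue ?B (\<lambda>X. (g X)\<^sup>2) \<and> set_integrable lebesgue ?B (\<lambda>X. (norm (Dg X))\<^sup>2)"
    if m: "set_borel_measurable lebesgue ?B g" "set_borel_measurable lebesgue ?B Dg"
  proof (intro iffI conjI; (elim conjE)?)
    assume i: "set_integrable lebesgue ?B (\<lambda>X. 1 / fst X * ?S X)"
    have "set_integrable lebesgue ?B (\<lambda>X. fst X * (1 / fst X * ?S X))"
      by (rule set_integrable_continuous_mult[OF _ i]) (intro continuous_intros)
    then have S: "set_integrable lebesgue ?B ?S"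
      by (rule set_integrable_cong_on) (use positive_discD(3)[OF d] in force)
    show "set_integrable lebesgue ?B (\<lambda>X. (g X)\<^sup>2)"
      by (rule set_integrable_bound_real[OF S]) (simp_all add: set_borel_measurable_power2 m)
    show "set_integrable lebesgue ?B (\<lambda>X. (norm (Dg X))\<^sup>2)"
      by (rule set_integrable_bound_real[OF S]) (simp_all add: set_borel_measurable_power2 set_borel_measurable_norm m)
  next
    assume "set_integrable lebesgue ?B (\<lambda>X. (g X)\<^sup>2)" "set_integrable lebesgue ?B (\<lambda>X. (norm (Dg X))\<^sup>2)"
    then show "set_integrable lebesgue ?B (\<lambda>X. 1 / fst X * ?S X)"
      by (intro set_integrable_continuous_mult positive_discD(4)[OF d] set_integral_add(1))
  qed
  then show ?thesis unfolding W12w_def by blast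
qed

lemma W12w_ballD:
  assumes d: "positive_disc X0 R" and w: "W12w (ball X0 R) g Dg"
  shows "set_borel_measurable lebesgue (ball X0 R) g" "set_borel_measurable lebesgue (ball X0 R) Dg"
    "weak_gradient (ball X0 R) g Dg"
    "set_integrable lebesgue (ball X0 R) (\<lambda>X. (g X)\<^sup>2)" "set_integrable lebesgue (ball X0 R) (\<lambda>X. (norm (Dg X))\<^sup>2)"
    "set_integrable lebesgue (ball X0 R) g" "set_integrable lebesgue (ball X0 R) Dg"
proof -
  show 1: "set_borel_measurable lebesgue (ball X0 R) g" "set_borel_measurable lebesgue (ball X0 R) Dg"
    "weak_gradient (ball X0 R) g Dg"
    "set_integrable lebesgue (ball X0 R) (\<lambda>X. (g X)\<^sup>2)" "set_integrable lebesgue (ball X0 R) (\<lambda>X. (norm (Dg X))\<^sup>2)"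
    using w unfolding W12w_ball_iff[OF d] by blast+
  \<comment> \<open>On a disc, which has finite measure, square integrability implies
    integrability.\<close>
  have le: "a \<le> 1 + a\<^sup>2" for a :: real
    using zero_le_power2[of "a - 1/2"] by (simp add: power2_eq_square algebra_simps)
  show "set_integrable lebesgue (ball X0 R) g"
    by (rule set_integrable_bound_real[OF set_integral_add(1)[OF set_integrable_const_ball[of _ _ 1] 1(4)] 1(1)])
      (use le[of "\<bar>g _\<bar>"] in simp)
  show "set_integrable lebesgue (ball X0 R) Dg"
    by (rule set_integrable_bound_real[OF set_integral_add(1)[OF set_integrable_const_ball[of _ _ 1] 1(5)] 1(2)])
      (use le[of "norm (Dg _)"] in simp)
qed

section \<open>Sums, smooth multiples and compact perturbations in the Sobolev space\<close>

lemma power2_add_le: "(a + b)\<^sup>2 \<le> 2 * a\<^sup>2 + 2 * (b::real)\<^sup>2"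
  using zero_le_power2[of "a - b"] by (simp add: power2_eq_square algebra_simps)

lemma norm_add_power2_le: "(norm (a + b))\<^sup>2 \<le> 2 * (norm a)\<^sup>2 + 2 * (norm b)\<^sup>2"
  using power_mono[OF norm_triangle_ineq[of a b] norm_ge_zero, of 2] power2_add_le[of "norm a" "norm b"] by linarith

lemma weak_gradient_add:
  assumes g: "weak_gradient S g Dg" and k: "weak_gradient S k Dk"
  shows "weak_gradient S (\<lambda>X. g X + k X) (\<lambda>X. Dg X + Dk X)"
  unfolding weak_gradient_def
proof (intro conjI allI impI; (elim conjE)?)
  fix K assume "compact K" "K \<subseteq> S"
  then show "set_integrable lebesgue K (\<lambda>X. g X + k X)" "set_integrable lebesgue K (\<lambda>X. Dg X + Dk X)"
    using g k unfolding weak_gradient_def by (simp_all add: set_integral_add(1))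
next
  fix \<eta> D\<eta> assume t: "test_fun S \<eta> D\<eta>"
  note 1 = weak_gradient_test_integrable[OF g t] and 2 = weak_gradient_test_integrable[OF k t]
  show "(LINT X:S|lebesgue. (g X + k X) *\<^sub>R D\<eta> X) = - (LINT X:S|lebesgue. \<eta> X *\<^sub>R (Dg X + Dk X))"
    unfolding scaleR_add_left scaleR_add_right set_integral_add(2)[OF 1(1) 2(1)] set_integral_add(2)[OF 1(2) 2(2)] 1(3) 2(3)
    by (simp only: minus_add_distrib)
qed

lemma add_eq_uminus_swap:
  fixes a b c :: "'a::ab_group_add"
  assumes "a + b = - c"
  shows "b = - (c + a)"
proof -
  have "b = - c - a" using assms by (metis add_diff_cancel_left')
  then show ?thesis by simp
qed

text \<open>The weak gradient of \<open>g\<close> is tested with \<open>\<eta> q\<close>; the term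
  with \<open>Dq\<close> changes sides.\<close>

lemma weak_gradient_C1_mult:
  assumes g: "weak_gradient S g Dg" and q: "C1_gradient q Dq"
  shows "weak_gradient S (\<lambda>X. q X * g X) (\<lambda>X. q X *\<^sub>R Dg X + g X *\<^sub>R Dq X)"
  unfolding weak_gradient_def
proof (intro conjI allI impI; (elim conjE)?)
  fix K assume K: "compact K" "K \<subseteq> S"
  then have gK: "set_integrable lebesgue K g" "set_integrable lebesgue K Dg"
    using g unfolding weak_gradient_def by simp_all
  have Ks: "K \<in> sets lebesgue" using K(1) by (simp add: borel_compact sets_lebesgue_borel)
  have mult: "set_integrable lebesgue K (\<lambda>X. p X *\<^sub>R w X)"
    if p: "continuous_on UNIV p" and w: "set_integrable lebesgue K w" for p :: "real \<times> real \<Rightarrow> real" and w :: "real \<times> real \<Rightarrow> 'b::{banach, second_countable_topology}"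
  proof -
    have pK: "continuous_on K p" using p continuous_on_subset by blast
    obtain B where "\<forall>x \<in> p ` K. norm x \<le> B"
      using compact_imp_bounded[OF compact_continuous_image[OF pK K(1)]] unfolding bounded_iff by blast
    then have B: "\<And>X. X \<in> K \<Longrightarrow> \<bar>p X\<bar> \<le> B" by simp
    show ?thesis by (rule set_integrable_bounded_scaleR[OF set_borel_measurable_continuous_on[OF pK Ks] B w])
  qed
  show "set_integrable lebesgue K (\<lambda>X. q X * g X)"
    using mult[OF C1_gradientD(3)[OF q] gK(1)] by simp
  have "set_integrable lebesgue K (\<lambda>X. (fst (Dq X) *\<^sub>R g X) *\<^sub>R (1::real,0::real) + (snd (Dq X) *\<^sub>R g X) *\<^sub>R (0,1))"
    by (intro set_integral_add(1) set_integrable_scaleR_left impI mult gK continuous_on_fst continuous_on_snd C1_gradientD(2)[OF q])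
  moreover have "(fst (Dq X) *\<^sub>R g X) *\<^sub>R (1::real,0::real) + (snd (Dq X) *\<^sub>R g X) *\<^sub>R (0,1) = g X *\<^sub>R Dq X" for X
    by (simp add: prod_eq_iff)
  ultimately have "set_integrable lebesgue K (\<lambda>X. g X *\<^sub>R Dq X)" by simp
  then show "set_integrable lebesgue K (\<lambda>X. q X *\<^sub>R Dg X + g X *\<^sub>R Dq X)"
    by (rule set_integral_add(1)[OF mult[OF C1_gradientD(3)[OF q] gK(2)]])
next
  fix \<eta> D\<eta> assume t: "test_fun S \<eta> D\<eta>"
  have C\<eta>: "C1_gradient \<eta> D\<eta>" using t unfolding test_fun_def C1_gradient_def by blast
  obtain K where K: "compact K" "K \<subseteq> S" "\<And>X. X \<notin> K \<Longrightarrow> \<eta> X = 0" "\<And>X. X \<notin> K \<Longrightarrow> D\<eta> X = 0"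
    using test_fun_support[OF t] by blast
  have gK: "set_integrable lebesgue K g" "set_integrable lebesgue K Dg"
    using g[unfolded weak_gradient_def, THEN conjunct1] K(1,2) by blast+
  have pr: "set_integrable lebesgue S (\<lambda>X. g X *\<^sub>R P X)"
    if P: "continuous_on UNIV P" "\<And>X. X \<notin> K \<Longrightarrow> P X = 0" for P :: "real \<times> real \<Rightarrow> real \<times> real"
  proof -
    have "set_integrable lebesgue S (\<lambda>X. fst (P X) *\<^sub>R g X)" "set_integrable lebesgue S (\<lambda>X. snd (P X) *\<^sub>R g X)"
      by (rule set_integrable_compact_support[OF K(1,2) gK(1)]; simp add: P continuous_on_fst continuous_on_snd)+
    then have "set_integrable lebesgue S (\<lambda>X. (fst (P X) *\<^sub>R g X) *\<^sub>R (1::real,0::real) + (snd (P X) *\<^sub>R g X) *\<^sub>R (0,1))"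
      by (intro set_integral_add(1) set_integrable_scaleR_left impI)
    moreover have "(fst (P X) *\<^sub>R g X) *\<^sub>R (1::real,0::real) + (snd (P X) *\<^sub>R g X) *\<^sub>R (0,1) = g X *\<^sub>R P X" for X
      by (simp add: prod_eq_iff)
    ultimately show ?thesis by simp
  qed
  have i1: "set_integrable lebesgue S (\<lambda>X. g X *\<^sub>R (\<eta> X *\<^sub>R Dq X))"
    by (rule pr) (simp_all add: K(3) continuous_on_scaleR C1_gradientD(3)[OF C\<eta>] C1_gradientD(2)[OF q])
  have i2: "set_integrable lebesgue S (\<lambda>X. g X *\<^sub>R (q X *\<^sub>R D\<eta> X))"
    by (rule pr) (simp_all add: K(4) continuous_on_scaleR C1_gradientD(2)[OF C\<eta>] C1_gradientD(3)[OF q])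
  note T = weak_gradient_test_integrable[OF g test_fun_mult[OF t q]]
  have e2: "\<eta> X *\<^sub>R (q X *\<^sub>R Dg X + g X *\<^sub>R Dq X) = (\<eta> X * q X) *\<^sub>R Dg X + g X *\<^sub>R (\<eta> X *\<^sub>R Dq X)" for X
    by (simp add: scaleR_add_right mult.commute)
  have e1: "(q X * g X) *\<^sub>R D\<eta> X = g X *\<^sub>R (q X *\<^sub>R D\<eta> X)" for X by (simp add: mult.commute)
  have "(LINT X:S|lebesgue. g X *\<^sub>R (\<eta> X *\<^sub>R Dq X)) + (LINT X:S|lebesgue. g X *\<^sub>R (q X *\<^sub>R D\<eta> X))
      = - (LINT X:S|lebesgue. (\<eta> X * q X) *\<^sub>R Dg X)"
    using T(3) unfolding scaleR_add_right set_integral_add(2)[OF i1 i2] .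
  then show "(LINT X:S|lebesgue. (q X * g X) *\<^sub>R D\<eta> X) = - (LINT X:S|lebesgue. \<eta> X *\<^sub>R (q X *\<^sub>R Dg X + g X *\<^sub>R Dq X))"
    unfolding e1 e2 set_integral_add(2)[OF T(2) i1] by (rule add_eq_uminus_swap)
qed

lemma W12w_add:
  assumes d: "positive_disc X0 R" and g: "W12w (ball X0 R) g Dg" and k: "W12w (ball X0 R) k Dk"
  shows "W12w (ball X0 R) (\<lambda>X. g X + k X) (\<lambda>X. Dg X + Dk X)"
proof -
  note G = W12w_ballD[OF d g] and K = W12w_ballD[OF d k]
  have m: "set_borel_measurable lebesgue (ball X0 R) (\<lambda>X. g X + k X)" "set_borel_measurable lebesgue (ball X0 R) (\<lambda>X. Dg X + Dk X)"
    by (intro set_borel_measurable_add G K)+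
  have "set_integrable lebesgue (ball X0 R) (\<lambda>X. (g X + k X)\<^sup>2)"
    by (rule set_integrable_bound_real[where f = "\<lambda>X. 2 * (g X)\<^sup>2 + 2 * (k X)\<^sup>2"])
      (auto intro!: set_borel_measurable_power2 m G K power2_add_le)
  moreover have "set_integrable lebesgue (ball X0 R) (\<lambda>X. (norm (Dg X + Dk X))\<^sup>2)"
    by (rule set_integrable_bound_real[where f = "\<lambda>X. 2 * (norm (Dg X))\<^sup>2 + 2 * (norm (Dk X))\<^sup>2"])
      (auto intro!: set_borel_measurable_power2 set_borel_measurable_norm m G K norm_add_power2_le)
  ultimately show ?thesis unfolding W12w_ball_iff[OF d]
    using m weak_gradient_add[OF G(3) K(3)] by blast
qed

lemma W12w_C1_mult:
  assumes d: "positive_disc X0 R" and g: "W12w (ball X0 R) g Dg" and q: "C1_gradient q Dq"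
  shows "W12w (ball X0 R) (\<lambda>X. q X * g X) (\<lambda>X. q X *\<^sub>R Dg X + g X *\<^sub>R Dq X)"
proof -
  let ?B = "ball X0 R"
  note G = W12w_ballD[OF d g]
  note qc = C1_gradientD(3)[OF q] and Dqc = C1_gradientD(2)[OF q]
  have mq: "set_borel_measurable lebesgue ?B q" "set_borel_measurable lebesgue ?B Dq"
    by (intro set_borel_measurable_continuous_on qc Dqc; simp)+
  have m: "set_borel_measurable lebesgue ?B (\<lambda>X. q X * g X)" "set_borel_measurable lebesgue ?B (\<lambda>X. q X *\<^sub>R Dg X + g X *\<^sub>R Dq X)"
    by (intro set_borel_measurable_add set_borel_measurable_mult set_borel_measurable_scaleR mq G)+
  have "set_integrable lebesgue ?B (\<lambda>X. (q X)\<^sup>2 * (g X)\<^sup>2)"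
    by (intro set_integrable_continuous_mult continuous_on_power qc G)
  then have 1: "set_integrable lebesgue ?B (\<lambda>X. (q X * g X)\<^sup>2)" by (simp add: power_mult_distrib)
  have "set_integrable lebesgue ?B (\<lambda>X. (2 * (q X)\<^sup>2) * (norm (Dg X))\<^sup>2 + (2 * (norm (Dq X))\<^sup>2) * (g X)\<^sup>2)"
    by (intro set_integral_add(1) set_integrable_continuous_mult continuous_on_mult continuous_on_const continuous_on_power continuous_on_norm qc Dqc G)
  then have 2: "set_integrable lebesgue ?B (\<lambda>X. (norm (q X *\<^sub>R Dg X + g X *\<^sub>R Dq X))\<^sup>2)"
  proof (rule set_integrable_bound_real)
    show "norm ((norm (q X *\<^sub>R Dg X + g X *\<^sub>R Dq X))\<^sup>2) \<le> (2 * (q X)\<^sup>2) * (norm (Dg X))\<^sup>2 + (2 * (norm (Dq X))\<^sup>2) * (g X)\<^sup>2" for X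
      using norm_add_power2_le[of "q X *\<^sub>R Dg X" "g X *\<^sub>R Dq X"] by (simp add: power_mult_distrib mult.commute mult.left_commute)
  qed (intro set_borel_measurable_power2 set_borel_measurable_norm m)
  show ?thesis unfolding W12w_ball_iff[OF d]
    using m 1 2 weak_gradient_C1_mult[OF G(3) q] by blast
qed

text \<open>The difference of \<open>\<phi>\<close> and \<open>g\<close> extends continuously by
  zero to the plane. Added to the approximants of \<open>g\<close> it leaves the approximation
  errors unchanged, and it leaves the values on the circle unchanged because the circle does not
  meet \<open>K\<close>. Hence the same \<open>h\<close> is a trace of both functions.\<close>

lemma same_trace_compact_perturbation:
  assumes d: "positive_disc X0 R" and t: "has_trace X0 R g Dg h"
    and w: "W12w (ball X0 R) \<phi> D\<phi>" and K: "compact K" "K \<subseteq> ball X0 R" and eq: "\<And>X. X \<notin> K \<Longrightarrow> \<phi> X = g X"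
    and c: "continuous_on (ball X0 R) \<phi>" "continuous_on (ball X0 R) g"
  shows "same_trace X0 R \<phi> D\<phi> g Dg"
proof -
  obtain u Du where u: "\<And>n::nat. continuous_on (cball X0 R) (u n)" "\<And>n. W12w (ball X0 R) (u n) (Du n)"
    and l1: "(\<lambda>n. LINT X:ball X0 R|lebesgue. 1 / fst X * ((u n X - g X)\<^sup>2 + (norm (Du n X - Dg X))\<^sup>2)) \<longlonglongrightarrow> 0"
    and l2: "(\<lambda>n. circle_integral X0 R (\<lambda>X. (u n X - h X)\<^sup>2)) \<longlonglongrightarrow> 0"
    using t unfolding has_trace_def by blast
  have g: "W12w (ball X0 R) g Dg" and hL: "circle_L2 X0 R h" using t unfolding has_trace_def by blast+
  have mg: "W12w (ball X0 R) (\<lambda>X. - g X) (\<lambda>X. - Dg X)"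
    using W12w_C1_mult[OF d g C1_gradient_const[of "-1"]] by simp
  let ?v = "\<lambda>n X. u n X + (\<phi> X + - g X)" and ?Dv = "\<lambda>n X. Du n X + (D\<phi> X + - Dg X)"
  have vW: "W12w (ball X0 R) (?v n) (?Dv n)" for n
    by (intro W12w_add[OF d] u w mg)
  have U: "UNIV = ball X0 R \<union> - K" using K by auto
  have "continuous_on UNIV (\<lambda>X. \<phi> X + - g X)"
    unfolding U
  proof (rule continuous_on_open_Un)
    show "open (- K)" using K(1) by (simp add: compact_imp_closed open_Compl)
    show "continuous_on (ball X0 R) (\<lambda>X. \<phi> X + - g X)" by (intro continuous_on_add continuous_on_minus c)
    show "continuous_on (- K) (\<lambda>X. \<phi> X + - g X)"
      by (rule continuous_on_eq[of _ "\<lambda>_. 0"]) (simp_all add: eq)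
  qed simp
  then have vc: "continuous_on (cball X0 R) (?v n)" for n
    by (rule continuous_on_add[OF u(1) continuous_on_subset]) simp_all
  have circle: "circle_integral X0 R (\<lambda>X. (?v n X - h X)\<^sup>2) = circle_integral X0 R (\<lambda>X. (u n X - h X)\<^sup>2)" for n
  proof -
    have "circ X0 R \<theta> \<notin> K" for \<theta>
      using K(2) dist_circ[of R X0 \<theta>] positive_discD(1)[OF d] by (metis less_eq_real_def less_irrefl mem_ball subsetD)
    then show ?thesis unfolding circle_integral_def by (simp add: eq)
  qed
  have "has_trace X0 R \<phi> D\<phi> h"
    unfolding has_trace_def
  proof (intro conjI w hL exI[of _ ?v] exI[of _ ?Dv] allI vc vW)
    have "?v n X - \<phi> X = u n X - g X" "?Dv n X - D\<phi> X = Du n X - Dg X" for n X by simp_all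
    then show "(\<lambda>n. LINT X:ball X0 R|lebesgue. 1 / fst X * ((?v n X - \<phi> X)\<^sup>2 + (norm (?Dv n X - D\<phi> X))\<^sup>2)) \<longlonglongrightarrow> 0"
      using l1 by presburger
    show "(\<lambda>n. circle_integral X0 R (\<lambda>X. (?v n X - h X)\<^sup>2)) \<longlonglongrightarrow> 0"
      unfolding circle by (rule l2)
  qed
  with t show ?thesis unfolding same_trace_def by blast
qed

section \<open>Growth of the vorticity and of its primitive\<close>

lemma prim_has_derivative:
  assumes "\<And>z. f differentiable (at (z::real))"
  shows "(prim f has_real_derivative f z) (at z)"
proof -
  have c: "continuous_on S f" for S
    using assms by (meson differentiable_imp_continuous_within continuous_at_imp_continuous_on)
  \<comment> \<open>An interval with both 0 and \<open>z\<close> in its interior, so that the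
    one-sided statement at its ends is avoided.\<close>
  let ?a = "- \<bar>z\<bar> - 1" and ?b = "\<bar>z\<bar> + 1"
  have z: "z \<in> {?a<..<?b}" by auto
  have "((\<lambda>u. LBINT y=0..u. f y) has_vector_derivative f z) (at z within {?a..?b})"
    using interval_integral_FTC2[of ?a 0 ?b f z] c z by (simp add: zero_ereal_def)
  then have "((\<lambda>u. LBINT y=0..u. f y) has_vector_derivative f z) (at z within {?a<..<?b})"
    by (rule has_vector_derivative_within_subset) auto
  then have "((\<lambda>u. LBINT y=0..u. f y) has_vector_derivative f z) (at z)"
    using z by (simp only: at_within_open[OF z open_greaterThanLessThan])
  then show ?thesis
    unfolding has_real_derivative_iff_has_vector_derivative prim_def[abs_def] .
qed

text \<open>A bounded derivative gives \<open>f\<close> at most linear and its primitive at most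
  quadratic growth. This is what makes \<open>prim f (\<psi> X)\<close> and
  \<open>\<psi> X * f (\<psi> X)\<close> integrable for a square integrable
  \<open>\<psi>\<close>.\<close>

lemma vorticity_bounds:
  assumes f: "\<And>z. f differentiable (at (z::real))" and f': "\<And>z. - F0 \<le> deriv f z \<and> deriv f z \<le> 0" and F0: "0 \<le> F0"
  shows "\<bar>f z\<bar> \<le> \<bar>f 0\<bar> + F0 * \<bar>z\<bar>"
    and "\<bar>prim f u - prim f v\<bar> \<le> (\<bar>f 0\<bar> + F0 * max \<bar>u\<bar> \<bar>v\<bar>) * \<bar>u - v\<bar>"
    and "\<bar>prim f z\<bar> \<le> (\<bar>f 0\<bar> + F0 * \<bar>z\<bar>) * \<bar>z\<bar>"
proof -
  have df: "(f has_real_derivative deriv f z) (at z)" for z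
    using f[of z] by (simp add: real_differentiable_def DERIV_deriv_iff_real_differentiable)
  have fb: "\<bar>f z\<bar> \<le> \<bar>f 0\<bar> + F0 * \<bar>z\<bar>" for z
  proof -
    have "norm (f z - f 0) \<le> F0 * norm (z - 0)"
    proof (rule field_differentiable_bound[of UNIV])
      show "(f has_field_derivative deriv f x) (at x within UNIV)" for x using df by simp
      show "norm (deriv f x) \<le> F0" for x using f'[of x] by simp
    qed auto
    then show ?thesis by simp
  qed
  then show "\<bar>f z\<bar> \<le> \<bar>f 0\<bar> + F0 * \<bar>z\<bar>" .
  have pb: "\<bar>prim f u - prim f v\<bar> \<le> (\<bar>f 0\<bar> + F0 * max \<bar>u\<bar> \<bar>v\<bar>) * \<bar>u - v\<bar>" for u v
  proof -
    let ?M = "max \<bar>u\<bar> \<bar>v\<bar>"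
    have "norm (prim f u - prim f v) \<le> (\<bar>f 0\<bar> + F0 * ?M) * norm (u - v)"
    proof (rule field_differentiable_bound[of "{-?M..?M}"])
      show "(prim f has_field_derivative f x) (at x within {-?M..?M})" for x
        using prim_has_derivative[OF f] by (rule has_field_derivative_at_within)
      show "norm (f x) \<le> \<bar>f 0\<bar> + F0 * ?M" if "x \<in> {-?M..?M}" for x
      proof -
        have "\<bar>x\<bar> \<le> ?M" using that by (simp only: atLeastAtMost_iff abs_le_iff minus_le_iff simp_thms)
        then have "F0 * \<bar>x\<bar> \<le> F0 * ?M" using F0 by (rule mult_left_mono)
        then show ?thesis using fb[of x] by simp
      qed
    qed auto
    then show ?thesis by simp
  qed
  then show "\<bar>prim f u - prim f v\<bar> \<le> (\<bar>f 0\<bar> + F0 * max \<bar>u\<bar> \<bar>v\<bar>) * \<bar>u - v\<bar>" .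
  have "prim f 0 = 0" by (simp add: prim_def zero_ereal_def)
  then show "\<bar>prim f z\<bar> \<le> (\<bar>f 0\<bar> + F0 * \<bar>z\<bar>) * \<bar>z\<bar>" using pb[of z 0] by simp
qed

lemma set_borel_measurable_indicator_pos:
  fixes g :: "real \<times> real \<Rightarrow> real"
  assumes "continuous_on (ball X0 R) g"
  shows "set_borel_measurable lebesgue (ball X0 R) (\<lambda>X. indicat_real {Y. 0 < g Y} X)"
proof -
  have "open (ball X0 R \<inter> g -` {0<..})"
    using assms by (rule continuous_open_preimage) auto
  then have "indicat_real (ball X0 R \<inter> g -` {0<..}) \<in> borel_measurable lebesgue"
    by (intro borel_measurable_indicator) auto
  moreover have "(\<lambda>X. indicat_real (ball X0 R) X *\<^sub>R indicat_real {Y. 0 < g Y} X) = indicat_real (ball X0 R \<inter> g -` {0<..})"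
    by (auto simp: indicator_def)
  ultimately show ?thesis unfolding set_borel_measurable_def by simp
qed


subsection \<open>Outer variation\<close>

text \<open>A trace \<open>h\<close> is fixed because membership of a competitor in the comparison
  class is shown by exhibiting a common trace.\<close>

locale disc_minimizer =
  fixes f :: "real \<Rightarrow> real" and F0 :: real and X0 :: "real \<times> real" and R :: real
    and \<psi> :: "real \<times> real \<Rightarrow> real" and D\<psi> :: "real \<times> real \<Rightarrow> real \<times> real" and h :: "real \<times> real \<Rightarrow> real"
  assumes disc: "positive_disc X0 R"
    and f_diff: "\<And>z. f differentiable (at z)" and f_deriv: "\<And>z. - F0 \<le> deriv f z \<and> deriv f z \<le> 0"
    and F0: "0 \<le> F0"
    and minim: "local_minimizer f X0 R \<psi> D\<psi>" and trace: "has_trace X0 R \<psi> D\<psi> h"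
    and cont: "continuous_on (ball X0 R) \<psi>"
begin

abbreviation "B \<equiv> ball X0 R"

lemma W12w_psi: "W12w B \<psi> D\<psi>"
  using minim unfolding local_minimizer_def by blast

lemmas R_pos = positive_discD(1)[OF disc]
  and fst_pos = positive_discD(3)[OF disc]
  and inverse_fst_cont = positive_discD(4)[OF disc]

lemmas psi_meas = W12w_ballD(1)[OF disc W12w_psi]
  and Dpsi_meas = W12w_ballD(2)[OF disc W12w_psi]
  and psi_weak = W12w_ballD(3)[OF disc W12w_psi]
  and psi2_int = W12w_ballD(4)[OF disc W12w_psi]
  and Dpsi2_int = W12w_ballD(5)[OF disc W12w_psi]
  and psi_int = W12w_ballD(6)[OF disc W12w_psi]
  and Dpsi_int = W12w_ballD(7)[OF disc W12w_psi]

lemma f_cont: "continuous_on S f"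
  using f_diff by (meson differentiable_imp_continuous_within continuous_at_imp_continuous_on)

lemma prim_cont: "continuous_on S (prim f)"
  using prim_has_derivative[OF f_diff] by (meson DERIV_isCont continuous_at_imp_continuous_on)

lemmas f_bound = vorticity_bounds(1)[OF f_diff f_deriv F0]
  and prim_lipschitz = vorticity_bounds(2)[OF f_diff f_deriv F0]
  and prim_bound = vorticity_bounds(3)[OF f_diff f_deriv F0]

lemma mult_bound: "(\<bar>f 0\<bar> + F0 * \<bar>z\<bar>) * \<bar>z\<bar> \<le> \<bar>f 0\<bar> + (\<bar>f 0\<bar> + F0) * z\<^sup>2"
proof -
  have "\<bar>z\<bar> \<le> 1 + z\<^sup>2"
    using zero_le_power2[of "\<bar>z\<bar> - 1/2"] by (simp add: power2_eq_square algebra_simps)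
  then have "\<bar>f 0\<bar> * \<bar>z\<bar> \<le> \<bar>f 0\<bar> * (1 + z\<^sup>2)" by (rule mult_left_mono) simp
  then show ?thesis by (simp add: algebra_simps power2_eq_square)
qed

lemma growth_int:
  assumes "set_integrable lebesgue B (\<lambda>X. (g X)\<^sup>2)"
  shows "set_integrable lebesgue B (\<lambda>X. \<bar>f 0\<bar> + (\<bar>f 0\<bar> + F0) * (g X)\<^sup>2)"
  by (intro set_integral_add(1) set_integrable_const_ball set_integrable_mult_right assms)

lemma prim_int:
  assumes "continuous_on B g" "set_integrable lebesgue B (\<lambda>X. (g X)\<^sup>2)"
  shows "set_integrable lebesgue B (\<lambda>X. prim f (g X))"
proof (rule set_integrable_bound_real[OF growth_int[OF assms(2)]])
  show "set_borel_measurable lebesgue B (\<lambda>X. prim f (g X))"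
    by (intro set_borel_measurable_continuous_on continuous_on_compose2[OF prim_cont assms(1)]) auto
  show "norm (prim f (g X)) \<le> \<bar>f 0\<bar> + (\<bar>f 0\<bar> + F0) * (g X)\<^sup>2" for X
    using prim_bound[of "g X"] mult_bound[of "g X"] by simp
qed

lemma psi_f_int: "set_integrable lebesgue B (\<lambda>X. \<psi> X * f (\<psi> X))"
proof (rule set_integrable_bound_real[OF growth_int[OF psi2_int]])
  show "set_borel_measurable lebesgue B (\<lambda>X. \<psi> X * f (\<psi> X))"
    by (intro set_borel_measurable_continuous_on continuous_on_mult cont continuous_on_compose2[OF f_cont cont]) auto
  show "norm (\<psi> X * f (\<psi> X)) \<le> \<bar>f 0\<bar> + (\<bar>f 0\<bar> + F0) * (\<psi> X)\<^sup>2" for X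
    using mult_right_mono[OF f_bound[of "\<psi> X"] abs_ge_zero[of "\<psi> X"]] mult_bound[of "\<psi> X"]
    by (simp add: abs_mult mult.commute)
qed

lemma inner_sq_int: "set_integrable lebesgue B (\<lambda>X. ((X - X0) \<bullet> D\<psi> X)\<^sup>2)"
proof (rule set_integrable_bound_real)
  show "set_integrable lebesgue B (\<lambda>X. (norm (X - X0))\<^sup>2 * (norm (D\<psi> X))\<^sup>2)"
    by (intro set_integrable_continuous_mult Dpsi2_int continuous_intros)
  show "set_borel_measurable lebesgue B (\<lambda>X. ((X - X0) \<bullet> D\<psi> X)\<^sup>2)"
    by (intro set_borel_measurable_power2 set_integrable_imp_measurable set_integrable_inner_continuous Dpsi_int continuous_intros)
  show "norm (((X - X0) \<bullet> D\<psi> X)\<^sup>2) \<le> (norm (X - X0))\<^sup>2 * (norm (D\<psi> X))\<^sup>2" for X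
    using Cauchy_Schwarz_ineq[of "X - X0" "D\<psi> X"] by (simp add: power2_norm_eq_inner)
qed

lemma psi_inner_int: "set_integrable lebesgue B (\<lambda>X. 2 * \<psi> X / fst X * ((X - X0) \<bullet> D\<psi> X))"
proof -
  have "set_integrable lebesgue B (\<lambda>X. \<psi> X * ((X - X0) \<bullet> D\<psi> X))"
  proof (rule set_integrable_bound_real)
    show "set_integrable lebesgue B (\<lambda>X. (\<psi> X)\<^sup>2 + ((X - X0) \<bullet> D\<psi> X)\<^sup>2)"
      by (intro set_integral_add(1) psi2_int inner_sq_int)
    show "set_borel_measurable lebesgue B (\<lambda>X. \<psi> X * ((X - X0) \<bullet> D\<psi> X))"
      by (intro set_borel_measurable_mult psi_meas set_integrable_imp_measurable set_integrable_inner_continuous Dpsi_int continuous_intros)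
    show "norm (\<psi> X * ((X - X0) \<bullet> D\<psi> X)) \<le> (\<psi> X)\<^sup>2 + ((X - X0) \<bullet> D\<psi> X)\<^sup>2" for X
    proof -
      define q where "q = (X - X0) \<bullet> D\<psi> X"
      have "2 * (\<bar>\<psi> X\<bar> * \<bar>q\<bar>) \<le> (\<psi> X)\<^sup>2 + q\<^sup>2"
        using zero_le_power2[of "\<bar>\<psi> X\<bar> - \<bar>q\<bar>"] by (simp add: power2_diff)
      moreover have "0 \<le> \<bar>\<psi> X\<bar> * \<bar>q\<bar>" by simp
      ultimately show ?thesis unfolding q_def[symmetric] real_norm_def abs_mult by linarith
    qed
  qed
  then have "set_integrable lebesgue B (\<lambda>X. 2 * (1 / fst X) * (\<psi> X * ((X - X0) \<bullet> D\<psi> X)))"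
    by (rule set_integrable_continuous_mult[rotated]) (intro continuous_on_mult continuous_on_const inverse_fst_cont)
  then show ?thesis by (simp add: mult_ac)
qed

lemma indicator_int:
  fixes g :: "real \<times> real \<Rightarrow> real"
  assumes "continuous_on B g"
  shows "set_integrable lebesgue B (\<lambda>X. indicat_real {Y. 0 < g Y} X)"
  by (rule set_integrable_bound_real[OF set_integrable_const_ball[of _ _ 1] set_borel_measurable_indicator_pos[OF assms]])
    (simp add: indicator_def)

lemma J_integrand_int:
  assumes "continuous_on B g" "W12w B g Dg"
  shows "set_integrable lebesgue B (\<lambda>X. 1 / fst X * (norm (Dg X))\<^sup>2 - 2 * fst X * prim f (g X)
        - fst X * snd X * indicator {Y. 0 < g Y} X)"
  by (intro set_integral_diff(1) set_integrable_continuous_mult inverse_fst_cont W12w_ballD[OF disc assms(2)]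
      prim_int indicator_int assms(1) continuous_intros)

lemma competitor:
  assumes "W12w B \<phi> D\<phi>" "compact K" "K \<subseteq> B" "\<And>X. X \<notin> K \<Longrightarrow> \<phi> X = \<psi> X" "continuous_on B \<phi>"
  shows "J_fun f X0 R \<psi> D\<psi> \<le> J_fun f X0 R \<phi> D\<phi>"
  using minim same_trace_compact_perturbation[OF disc trace assms cont] assms(1)
  unfolding local_minimizer_def by blast

text \<open>For small \<open>e\<close> the competitor \<open>(1 + e * \<zeta>) * \<psi>\<close> has the positivity set of \<open>\<psi>\<close>, so the discontinuous
  term of the functional does not change.\<close>

lemma outer_variation:
  assumes \<alpha>: "\<alpha> < R\<^sup>2"
  defines "p \<equiv> \<lambda>X. max 0 (\<alpha> - (norm (X - X0))\<^sup>2)"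
  shows "(LINT X:B|lebesgue. p X ^ 3 * (2 * (1 / fst X * (norm (D\<psi> X))\<^sup>2 - fst X * \<psi> X * f (\<psi> X)))
     - 6 * p X ^ 2 * (2 * \<psi> X / fst X * ((X - X0) \<bullet> D\<psi> X))) = 0"
proof -
  define \<zeta> where "\<zeta> X = p X ^ 3" for X
  define D\<zeta> where "D\<zeta> X = (2 * (- 3 * p X ^ 2)) *\<^sub>R (X - X0)" for X
  have tf: "test_fun B \<zeta> D\<zeta>"
    using test_fun_truncated_cubic[OF R_pos \<alpha>, of X0] unfolding \<zeta>_def[abs_def] D\<zeta>_def[abs_def] p_def .
  then have C\<zeta>: "C1_gradient \<zeta> D\<zeta>" unfolding test_fun_def C1_gradient_def by blast
  obtain K where K: "compact K" "K \<subseteq> B" "\<And>X. X \<notin> K \<Longrightarrow> \<zeta> X = 0"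
    using tf unfolding test_fun_def by blast
  obtain C where C: "0 \<le> C" "\<And>X. X \<in> cball X0 R \<Longrightarrow> \<bar>\<zeta> X\<bar> \<le> C"
    using bounded_on_ball_continuous[OF C1_gradientD(3)[OF C\<zeta>]] by blast
  \<comment> \<open>The gradient of \<open>\<zeta> X * \<psi> X\<close>, hence the direction in
    which the gradient of the competitor moves.\<close>
  define v where "v X = \<zeta> X *\<^sub>R D\<psi> X + \<psi> X *\<^sub>R D\<zeta> X" for X
  have Wv: "W12w B (\<lambda>X. \<zeta> X * \<psi> X) v"
    unfolding v_def[abs_def] by (rule W12w_C1_mult[OF disc W12w_psi C\<zeta>])
  note v_meas = W12w_ballD(2)[OF disc Wv] and v2_int = W12w_ballD(5)[OF disc Wv]
  \<comment> \<open>For \<open>\<bar>e\<bar> < d\<close> the modulus of \<open>e * \<zeta> X\<close>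
    stays below C / (C + 1), so the factor in front of \<open>\<psi>\<close> is positive.\<close>
  define d where "d = 1 / (C + 1)"
  have d: "0 < d" "d \<le> 1" using C by (auto simp: d_def)
  have small: "0 < 1 + e * \<zeta> X" if "\<bar>e\<bar> < d" "X \<in> B" for e X
  proof -
    have "\<bar>e * \<zeta> X\<bar> \<le> \<bar>e\<bar> * C" unfolding abs_mult using C(2)[of X] that(2) by (intro mult_left_mono) auto
    also have "\<dots> \<le> d * C" using that C by (intro mult_right_mono) auto
    also have "\<dots> < 1" using C by (simp add: d_def)
    finally show ?thesis by linarith
  qed
  define G where "G e X = 1 / fst X * (norm (D\<psi> X + e *\<^sub>R v X))\<^sup>2 - 2 * fst X * prim f ((1 + e * \<zeta> X) * \<psi> X)
        - fst X * snd X * indicator {Y. 0 < \<psi> Y} X" for e X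
  define G' where "G' X = 2 / fst X * (D\<psi> X \<bullet> v X) - 2 * fst X * (f (\<psi> X) * (\<zeta> X * \<psi> X))" for X
  let ?\<phi> = "\<lambda>e X. (1 + e * \<zeta> X) * \<psi> X"
  have W\<phi>: "W12w B (?\<phi> e) (\<lambda>X. D\<psi> X + e *\<^sub>R v X)" for e
  proof -
    have "C1_gradient (\<lambda>X. 1 + e * \<zeta> X) (\<lambda>X. e *\<^sub>R D\<zeta> X)"
      using C1_gradient_add[OF C1_gradient_const[of 1] C1_gradient_mult[OF C1_gradient_const[of e] C\<zeta>]] by simp
    from W12w_C1_mult[OF disc W12w_psi this]
    show ?thesis by (simp add: v_def scaleR_add_left scaleR_add_right add.assoc mult.commute)
  qed
  have \<phi>c: "continuous_on B (?\<phi> e)" for e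
    by (intro continuous_on_mult continuous_on_add continuous_on_const cont C1_gradientD(3)[OF C\<zeta>])
  have ind: "indicat_real {Y. 0 < ?\<phi> e Y} X = indicat_real {Y. 0 < \<psi> Y} X" if "\<bar>e\<bar> < d" "X \<in> B" for e X
    using small[OF that] by (simp add: indicator_def zero_less_mult_iff)
  have Geq: "1 / fst X * (norm (D\<psi> X + e *\<^sub>R v X))\<^sup>2 - 2 * fst X * prim f (?\<phi> e X)
        - fst X * snd X * indicator {Y. 0 < ?\<phi> e Y} X = G e X" if "\<bar>e\<bar> < d" "X \<in> B" for e X
    unfolding G_def ind[OF that] ..
  have J: "J_fun f X0 R (?\<phi> e) (\<lambda>X. D\<psi> X + e *\<^sub>R v X) = (LINT X:B|lebesgue. G e X)" if "\<bar>e\<bar> < d" for e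
    unfolding J_fun_def by (rule set_lebesgue_integral_cong) (use Geq[OF that] in auto)
  have Gint: "set_integrable lebesgue B (G e)" if "\<bar>e\<bar> < d" for e
    by (rule set_integrable_cong_on[OF J_integrand_int[OF \<phi>c W\<phi>] Geq[OF that]])
  have J0: "J_fun f X0 R \<psi> D\<psi> = (LINT X:B|lebesgue. G 0 X)"
    using J[of 0] d by simp
  have le: "(LINT X:B|lebesgue. G 0 X) \<le> (LINT X:B|lebesgue. G e X)" if "\<bar>e\<bar> < d" for e
    unfolding J[OF that, symmetric] J0[symmetric]
    by (rule competitor[OF W\<phi> K(1,2) _ \<phi>c]) (simp add: K(3))
  \<comment> \<open>The primitive is compared at two arguments of size at most (1 + C) |\<psi>| and
    at distance at most C |e| |\<psi>|; \<open>M\<close> collects the constants of the resulting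
    quadratic bound.\<close>
  define M where "M = (\<bar>f 0\<bar> + F0) * (1 + C) * C"
  let ?H = "\<lambda>X. 1 / fst X * ((norm (D\<psi> X))\<^sup>2 + 2 * (norm (v X))\<^sup>2) + 2 * fst X * (M * (1 + 2 * (\<psi> X)\<^sup>2))"
  have "((\<lambda>e. LINT X:B|lebesgue. G e X) has_real_derivative (LINT X:B|lebesgue. G' X)) (at 0)"
  proof (rule has_derivative_set_integral_parameter[OF d(1), where H = ?H])
    show "set_integrable lebesgue B (G e)" if "\<bar>e - 0\<bar> < d" for e using Gint that by simp
    show "set_integrable lebesgue B ?H"
      by (intro set_integral_add(1) set_integrable_continuous_mult inverse_fst_cont Dpsi2_int v2_int psi2_int
          set_integrable_mult_right set_integrable_const_ball continuous_intros)
    have mi: "set_borel_measurable lebesgue B (\<lambda>X. D\<psi> X \<bullet> v X)"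
    proof -
      have e: "(\<lambda>X. indicator B X *\<^sub>R (D\<psi> X \<bullet> v X)) = (\<lambda>X. (indicator B X *\<^sub>R D\<psi> X) \<bullet> (indicator B X *\<^sub>R v X))"
        by (auto simp: indicator_def)
      show ?thesis using Dpsi_meas v_meas unfolding set_borel_measurable_def e by (rule borel_measurable_inner)
    qed
    have c2: "continuous_on B (\<lambda>X. 2 / fst X)"
      using continuous_on_mult[OF continuous_on_const[of B 2] continuous_on_subset[OF inverse_fst_cont ball_subset_cball]] by simp
    have "set_borel_measurable lebesgue B (\<lambda>X. 2 / fst X * (D\<psi> X \<bullet> v X))"
      by (intro set_borel_measurable_mult mi set_borel_measurable_continuous_on c2) simp
    moreover have "set_borel_measurable lebesgue B (\<lambda>X. - (2 * fst X * (f (\<psi> X) * (\<zeta> X * \<psi> X))))"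
      by (intro set_borel_measurable_continuous_on continuous_intros cont C1_gradientD(3)[OF C\<zeta>]
          continuous_on_compose2[OF f_cont[of UNIV] cont]) auto
    ultimately show "set_borel_measurable lebesgue B G'"
      unfolding G'_def[abs_def] diff_conv_add_uminus by (rule set_borel_measurable_add)
    show "AE X in lebesgue. X \<in> B \<longrightarrow> ((\<lambda>e. G e X) has_real_derivative G' X) (at 0)"
    proof (intro AE_I2 impI)
      fix X assume "X \<in> B"
      have n: "(norm (D\<psi> X + e *\<^sub>R v X))\<^sup>2 = (norm (D\<psi> X))\<^sup>2 + 2 * e * (D\<psi> X \<bullet> v X) + e\<^sup>2 * (norm (v X))\<^sup>2" for e
        unfolding power2_norm_eq_inner by (simp add: inner_add_left inner_add_right inner_commute power2_eq_square algebra_simps)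
      have lin: "((\<lambda>e. (1 + e * \<zeta> X) * \<psi> X) has_real_derivative \<zeta> X * \<psi> X) (at 0)"
        by (auto intro!: derivative_eq_intros)
      have p': "((\<lambda>e. prim f ((1 + e * \<zeta> X) * \<psi> X)) has_real_derivative f ((1 + 0 * \<zeta> X) * \<psi> X) * (\<zeta> X * \<psi> X)) (at 0)"
        by (rule DERIV_chain2[OF prim_has_derivative[OF f_diff] lin])
      show "((\<lambda>e. G e X) has_real_derivative G' X) (at 0)"
        unfolding G_def n G'_def by (rule derivative_eq_intros p' refl | simp)+
    qed
    fix e X assume e: "\<bar>e - 0\<bar> < d" and X: "X \<in> B"
    have e1: "\<bar>e\<bar> \<le> 1" using e d by simp
    \<comment> \<open>The quadratic term in \<open>e\<close> is absorbed into the linear one, as the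
      bound by \<open>?H\<close> has to be linear in \<open>\<bar>e\<bar>\<close>.\<close>
    have e2: "e\<^sup>2 \<le> \<bar>e\<bar>" using e1 by (metis abs_ge_zero mult_left_le power2_abs power2_eq_square)
    have x: "0 < fst X" using fst_pos X by simp
    let ?w = "D\<psi> X" and ?v = "v X"
    have n: "(norm (?w + e *\<^sub>R ?v))\<^sup>2 - (norm ?w)\<^sup>2 = 2 * e * (?w \<bullet> ?v) + e\<^sup>2 * (norm ?v)\<^sup>2"
      unfolding power2_norm_eq_inner by (simp add: inner_add_left inner_add_right inner_commute power2_eq_square algebra_simps)
    have "\<bar>(norm (?w + e *\<^sub>R ?v))\<^sup>2 - (norm ?w)\<^sup>2\<bar> \<le> \<bar>e\<bar> * ((norm ?w)\<^sup>2 + 2 * (norm ?v)\<^sup>2)"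
    proof -
      have "\<bar>2 * (?w \<bullet> ?v)\<bar> \<le> (norm ?w)\<^sup>2 + (norm ?v)\<^sup>2"
        using Cauchy_Schwarz_ineq2[of ?w ?v] zero_le_power2[of "norm ?w - norm ?v"] by (simp add: power2_diff abs_mult)
      then have "\<bar>e\<bar> * \<bar>2 * (?w \<bullet> ?v)\<bar> \<le> \<bar>e\<bar> * ((norm ?w)\<^sup>2 + (norm ?v)\<^sup>2)" by (rule mult_left_mono) simp
      moreover have "e\<^sup>2 * (norm ?v)\<^sup>2 \<le> \<bar>e\<bar> * (norm ?v)\<^sup>2" using e2 by (rule mult_right_mono) simp
      moreover have "\<bar>2 * e * (?w \<bullet> ?v) + e\<^sup>2 * (norm ?v)\<^sup>2\<bar> \<le> \<bar>e\<bar> * \<bar>2 * (?w \<bullet> ?v)\<bar> + e\<^sup>2 * (norm ?v)\<^sup>2"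
        by (rule order_trans[OF abs_triangle_ineq]) (simp add: abs_mult)
      ultimately show ?thesis unfolding n by (simp add: algebra_simps)
    qed
    then have 1: "1 / fst X * \<bar>(norm (?w + e *\<^sub>R ?v))\<^sup>2 - (norm ?w)\<^sup>2\<bar> \<le> 1 / fst X * (\<bar>e\<bar> * ((norm ?w)\<^sup>2 + 2 * (norm ?v)\<^sup>2))"
      by (rule mult_left_mono) (use x in simp)
    have \<zeta>C: "\<bar>\<zeta> X\<bar> \<le> C" using C(2) X by simp
    have "\<bar>prim f (?\<phi> e X) - prim f (\<psi> X)\<bar> \<le> \<bar>e\<bar> * (M * (1 + 2 * (\<psi> X)\<^sup>2))"
    proof -
      have ez: "\<bar>e * \<zeta> X\<bar> \<le> C" unfolding abs_mult using mult_mono[OF e1 \<zeta>C] C by simp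
      have "\<bar>?\<phi> e X\<bar> \<le> (1 + C) * \<bar>\<psi> X\<bar>" unfolding abs_mult using ez by (intro mult_right_mono) auto
      moreover have "\<bar>\<psi> X\<bar> \<le> (1 + C) * \<bar>\<psi> X\<bar>" using C by (simp add: algebra_simps)
      ultimately have mx: "max \<bar>?\<phi> e X\<bar> \<bar>\<psi> X\<bar> \<le> (1 + C) * \<bar>\<psi> X\<bar>" by simp
      have "\<bar>?\<phi> e X - \<psi> X\<bar> = \<bar>e\<bar> * (\<bar>\<zeta> X\<bar> * \<bar>\<psi> X\<bar>)" by (simp add: algebra_simps abs_mult)
      also have "\<dots> \<le> \<bar>e\<bar> * (C * \<bar>\<psi> X\<bar>)" using \<zeta>C by (intro mult_left_mono mult_right_mono) auto
      finally have df: "\<bar>?\<phi> e X - \<psi> X\<bar> \<le> \<bar>e\<bar> * (C * \<bar>\<psi> X\<bar>)" .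
      have "\<bar>prim f (?\<phi> e X) - prim f (\<psi> X)\<bar> \<le> (\<bar>f 0\<bar> + F0 * ((1 + C) * \<bar>\<psi> X\<bar>)) * (\<bar>e\<bar> * (C * \<bar>\<psi> X\<bar>))"
        by (rule order_trans[OF prim_lipschitz]) (intro mult_mono add_mono mult_left_mono mx df order_refl F0 add_nonneg_nonneg mult_nonneg_nonneg; use C F0 in simp)
      also have "\<dots> = \<bar>e\<bar> * (C * (\<bar>f 0\<bar> * \<bar>\<psi> X\<bar> + F0 * (1 + C) * (\<psi> X)\<^sup>2))"
        by (simp add: algebra_simps power2_eq_square)
      also have "\<dots> \<le> \<bar>e\<bar> * (M * (1 + 2 * (\<psi> X)\<^sup>2))"
      proof (rule mult_left_mono)
        have p1: "\<bar>\<psi> X\<bar> \<le> 1 + (\<psi> X)\<^sup>2"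
          using zero_le_power2[of "\<bar>\<psi> X\<bar> - 1/2"] by (simp add: power2_eq_square algebra_simps)
        have "\<bar>f 0\<bar> * \<bar>\<psi> X\<bar> \<le> (\<bar>f 0\<bar> * (1 + C)) * (1 + (\<psi> X)\<^sup>2)"
          using C by (intro mult_mono p1) (auto simp: algebra_simps)
        moreover have "F0 * (1 + C) * (\<psi> X)\<^sup>2 \<le> F0 * (1 + C) * (1 + 2 * (\<psi> X)\<^sup>2)"
          using C F0 by (intro mult_left_mono) auto
        moreover have "(\<bar>f 0\<bar> * (1 + C)) * (1 + (\<psi> X)\<^sup>2) \<le> (\<bar>f 0\<bar> * (1 + C)) * (1 + 2 * (\<psi> X)\<^sup>2)"
          using C by (intro mult_left_mono) auto
        ultimately have "\<bar>f 0\<bar> * \<bar>\<psi> X\<bar> + F0 * (1 + C) * (\<psi> X)\<^sup>2 \<le> (\<bar>f 0\<bar> + F0) * (1 + C) * (1 + 2 * (\<psi> X)\<^sup>2)"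
          unfolding distrib_right by linarith
        from mult_left_mono[OF this C(1)]
        show "C * (\<bar>f 0\<bar> * \<bar>\<psi> X\<bar> + F0 * (1 + C) * (\<psi> X)\<^sup>2) \<le> M * (1 + 2 * (\<psi> X)\<^sup>2)"
          by (simp only: M_def mult.commute mult.left_commute mult.assoc)
      qed simp
      finally show ?thesis .
    qed
    then have 2: "2 * fst X * \<bar>prim f (?\<phi> e X) - prim f (\<psi> X)\<bar> \<le> 2 * fst X * (\<bar>e\<bar> * (M * (1 + 2 * (\<psi> X)\<^sup>2)))"
      by (rule mult_left_mono) (use x in simp)
    have "G e X - G 0 X = 1 / fst X * ((norm (?w + e *\<^sub>R ?v))\<^sup>2 - (norm ?w)\<^sup>2) - 2 * fst X * (prim f (?\<phi> e X) - prim f (\<psi> X))"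
      by (simp add: G_def right_diff_distrib)
    also have "\<bar>\<dots>\<bar> \<le> 1 / fst X * \<bar>(norm (?w + e *\<^sub>R ?v))\<^sup>2 - (norm ?w)\<^sup>2\<bar> + 2 * fst X * \<bar>prim f (?\<phi> e X) - prim f (\<psi> X)\<bar>"
      by (rule order_trans[OF abs_triangle_ineq4]) (use x in \<open>simp add: abs_mult\<close>)
    also have "\<dots> \<le> 1 / fst X * (\<bar>e\<bar> * ((norm ?w)\<^sup>2 + 2 * (norm ?v)\<^sup>2)) + 2 * fst X * (\<bar>e\<bar> * (M * (1 + 2 * (\<psi> X)\<^sup>2)))"
      using 1 2 by (rule add_mono)
    also have "\<dots> = ?H X * \<bar>e\<bar>" by (simp add: algebra_simps)
    finally show "\<bar>G e X - G 0 X\<bar> \<le> ?H X * \<bar>e - 0\<bar>" by simp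
  qed
  \<comment> \<open>Both signs of \<open>e\<close> are allowed, so 0 is an interior minimum of a
    differentiable function.\<close>
  then have z: "(LINT X:B|lebesgue. G' X) = 0"
    by (rule DERIV_local_min[OF _ d(1)]) (use le in auto)
  \<comment> \<open>The part of \<open>v\<close> with \<open>D\<zeta>\<close> carries the derivative
    of the cubic and produces the term with coefficient 6.\<close>
  have e: "G' X = p X ^ 3 * (2 * (1 / fst X * (norm (D\<psi> X))\<^sup>2 - fst X * \<psi> X * f (\<psi> X)))
     - 6 * p X ^ 2 * (2 * \<psi> X / fst X * ((X - X0) \<bullet> D\<psi> X))" for X
    unfolding G'_def v_def \<zeta>_def D\<zeta>_def power2_norm_eq_inner
    by (simp add: inner_add_right inner_commute algebra_simps diff_divide_distrib add_divide_distrib)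
  show ?thesis using z unfolding e .
qed

text \<open>The energy identity: formally, the Euler-Lagrange equation integrated against
  \<open>\<psi>\<close> over the disc, multiplied by 2 r.\<close>

lemma outer_variation_circles:
  "AE r in lebesgue. 0 < r \<and> r < R \<longrightarrow>
    circle_integral X0 r (\<lambda>X. 2 * \<psi> X / fst X * ((X - X0) \<bullet> D\<psi> X)) =
    r * (LINT X:ball X0 r|lebesgue. 2 * (1 / fst X * (norm (D\<psi> X))\<^sup>2 - fst X * \<psi> X * f (\<psi> X)))"
proof (rule radial_variation_identity[OF R_pos])
  show "set_integrable lebesgue B (\<lambda>X. 2 * (1 / fst X * (norm (D\<psi> X))\<^sup>2 - fst X * \<psi> X * f (\<psi> X)))"
    unfolding mult.assoc[of "fst _"]
    by (intro set_integrable_mult_right set_integral_diff(1) set_integrable_continuous_mult inverse_fst_cont Dpsi2_int psi_f_int continuous_intros)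
qed (rule psi_inner_int, rule outer_variation)

end


subsection \<open>Inner variation\<close>

locale radial_cutoff =
  fixes X0 :: "real \<times> real" and R \<alpha> :: real
  assumes R: "0 < R" and \<alpha>: "0 < \<alpha>" "\<alpha> < R\<^sup>2"
begin

text \<open>The cut-off \<open>k\<close> is a function of \<open>t\<close> with first and second derivatives \<open>k1\<close> and \<open>k2\<close> in \<open>t\<close>. The derivative
  of \<open>shift e\<close> has the tangential eigenvalue \<open>a e\<close> and the radial eigenvalue \<open>b e\<close>, and \<open>7 * R ^ 6\<close> bounds
  \<open>\<bar>k\<bar> + 2 * t * \<bar>k1\<bar>\<close>.\<close>

definition t :: "real \<times> real \<Rightarrow> real" where "t X = (norm (X - X0))\<^sup>2"
definition k :: "real \<times> real \<Rightarrow> real" where "k X = max 0 (\<alpha> - t X) ^ 3"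
definition k1 :: "real \<times> real \<Rightarrow> real" where "k1 X = - 3 * max 0 (\<alpha> - t X) ^ 2"
definition k2 :: "real \<times> real \<Rightarrow> real" where "k2 X = 6 * max 0 (\<alpha> - t X)"
definition a :: "real \<Rightarrow> real \<times> real \<Rightarrow> real" where "a e X = 1 + e * k X"
definition b :: "real \<Rightarrow> real \<times> real \<Rightarrow> real" where "b e X = 1 + e * (k X + 2 * t X * k1 X)"
definition shift :: "real \<Rightarrow> real \<times> real \<Rightarrow> real \<times> real" where "shift e X = X0 + a e X *\<^sub>R (X - X0)"
definition small :: "real \<Rightarrow> bool" where "small e \<longleftrightarrow> \<bar>e\<bar> * (7 * R ^ 6) \<le> 1 / 2"

lemma t_eq: "t X = (fst X - fst X0)\<^sup>2 + (snd X - snd X0)\<^sup>2"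
  by (simp add: t_def norm_prod_def)

lemma C1_k: "C1_gradient k (\<lambda>X. (2 * k1 X) *\<^sub>R (X - X0))"
  using test_fun_truncated_cubic[OF R \<alpha>(2), of X0]
  unfolding test_fun_def C1_gradient_def k_def[abs_def] k1_def t_def by blast

text \<open>This is the reason for the third power: the entries of the cofactor matrix contain
  \<open>k1\<close>, and test functions are multiplied by them.\<close>

lemma C1_k1: "C1_gradient k1 (\<lambda>X. (2 * k2 X) *\<^sub>R (X - X0))"
proof -
  have "((\<lambda>s. - 3 * max 0 (\<alpha> - s) ^ 2) has_real_derivative 6 * max 0 (\<alpha> - s)) (at s)" for s
  proof -
    have "((\<lambda>t. \<alpha> - t) has_real_derivative -1) (at s)" by (auto intro!: derivative_eq_intros)
    from DERIV_cmult[OF DERIV_chain2[OF has_derivative_pos_power[of 0] this], of "-3"] show ?thesis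
      by (simp add: eval_nat_numeral)
  qed
  moreover have "continuous_on UNIV (\<lambda>s. 6 * max 0 (\<alpha> - s))" by (intro continuous_intros)
  ultimately have "C1_gradient (\<lambda>X. - 3 * max 0 (\<alpha> - (norm (X - X0))\<^sup>2) ^ 2)
      (\<lambda>X. (6 * max 0 (\<alpha> - (norm (X - X0))\<^sup>2)) *\<^sub>R 2 *\<^sub>R (X - X0))"
    by (rule C1_gradient_compose[OF C1_gradient_sqnorm])
  then show ?thesis unfolding k1_def[abs_def] k2_def[abs_def] t_def by (simp add: mult.commute)
qed

lemma k_cont: "continuous_on S k" and k1_cont: "continuous_on S k1"
  using C1_gradientD(3)[OF C1_k] C1_gradientD(3)[OF C1_k1] .

lemma t_cont: "continuous_on S t"
  unfolding t_def by (intro continuous_intros)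

lemma outside: "\<alpha> \<le> t X \<Longrightarrow> k X = 0" "\<alpha> \<le> t X \<Longrightarrow> k1 X = 0"
  by (simp_all add: k_def k1_def)

text \<open>The positive part is at most R^2, and where it does not vanish \<open>t X\<close> is at
  most R^2 too. The sum R^6 + 2 * 3 * R^6 of these bounds is the constant in
  \<open>small\<close>.\<close>

lemma bounds: "0 \<le> t X" "\<bar>k X\<bar> \<le> R ^ 6" "t X * \<bar>k1 X\<bar> \<le> 3 * R ^ 6"
proof -
  show t0: "0 \<le> t X" by (simp add: t_def)
  let ?p = "max 0 (\<alpha> - t X)"
  have p: "0 \<le> ?p" "?p \<le> R\<^sup>2" using \<alpha> t0 by auto
  have "?p ^ 3 \<le> (R\<^sup>2) ^ 3" using p by (intro power_mono) auto
  then show "\<bar>k X\<bar> \<le> R ^ 6" by (simp add: k_def power_mult[symmetric])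
  show "t X * \<bar>k1 X\<bar> \<le> 3 * R ^ 6"
  proof (cases "\<alpha> \<le> t X")
    case True
    then show ?thesis by (simp add: outside)
  next
    case False
    then have t1: "t X \<le> R\<^sup>2" using \<alpha> by linarith
    have "?p ^ 2 \<le> (R\<^sup>2) ^ 2" using p by (intro power_mono) auto
    with t1 t0 p have "t X * ?p ^ 2 \<le> R\<^sup>2 * (R\<^sup>2) ^ 2" by (intro mult_mono) auto
    also have "\<dots> = R ^ 6" by (simp add: power_mult[symmetric] power_add[symmetric])
    finally show ?thesis by (simp add: k1_def abs_mult)
  qed
qed

lemma ab_bounds:
  assumes e: "small e"
  shows "1 / 2 \<le> a e X" "1 / 2 \<le> b e X"
proof -
  have e7: "\<bar>e\<bar> * (7 * R ^ 6) \<le> 1 / 2" using e unfolding small_def .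
  have "\<bar>e * k X\<bar> \<le> \<bar>e\<bar> * (7 * R ^ 6)"
    unfolding abs_mult using bounds(2)[of X] R by (intro mult_left_mono) auto
  with e7 show "1 / 2 \<le> a e X" unfolding a_def by linarith
  have "\<bar>k X + 2 * t X * k1 X\<bar> \<le> \<bar>k X\<bar> + 2 * (t X * \<bar>k1 X\<bar>)"
    by (rule order_trans[OF abs_triangle_ineq]) (simp add: abs_mult bounds(1))
  also have "\<dots> \<le> 7 * R ^ 6" using bounds(2,3)[of X] by linarith
  finally have "\<bar>e * (k X + 2 * t X * k1 X)\<bar> \<le> \<bar>e\<bar> * (7 * R ^ 6)"
    unfolding abs_mult by (rule mult_left_mono) simp
  with e7 show "1 / 2 \<le> b e X" unfolding b_def by linarith
qed

section \<open>The radial shift as a bijection of the disc\<close>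

lemma shift_derivative:
  "(shift e has_derivative (\<lambda>v. a e X *\<^sub>R v + (2 * e * k1 X * ((X - X0) \<bullet> v)) *\<^sub>R (X - X0))) (at X within S)"
proof -
  have Z: "((\<lambda>X. X - X0) has_derivative (\<lambda>v. v)) (at X within S)"
    by (rule has_derivative_eq_rhs[OF has_derivative_diff[OF has_derivative_ident has_derivative_const]]) simp
  have a: "((\<lambda>X. a e X) has_derivative (\<lambda>v. e * (((2 * k1 X) *\<^sub>R (X - X0)) \<bullet> v))) (at X within S)"
    unfolding a_def by (rule has_derivative_eq_rhs[OF has_derivative_add[OF has_derivative_const has_derivative_mult_right[OF C1_gradientD(1)[OF C1_k]]]]) simp
  show ?thesis
    unfolding shift_def[abs_def]
    by (rule has_derivative_eq_rhs[OF has_derivative_add[OF has_derivative_const has_derivative_scaleR[OF a Z]]])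
      (simp add: fun_eq_iff algebra_simps)
qed

text \<open>The shift is the identity plus \<open>e\<close> times a field with Lipschitz constant at
  most \<open>7 * R ^ 6\<close>. For a small \<open>e\<close> the perturbation has Lipschitz
  constant at most one half, so distances shrink at most by a factor of two; this gives injectivity
  and a Lipschitz inverse.\<close>

lemma shift_lower:
  assumes e: "small e"
  shows "norm (X - Y) \<le> 2 * norm (shift e X - shift e Y)"
proof -
  let ?V = "\<lambda>X. k X *\<^sub>R (X - X0)"
  have "norm (?V X - ?V Y) \<le> (7 * R ^ 6) * norm (X - Y)"
  proof (rule differentiable_bound[of UNIV])
    fix X
    have Z: "((\<lambda>X. X - X0) has_derivative (\<lambda>v. v)) (at X within UNIV)"
      by (rule has_derivative_eq_rhs[OF has_derivative_diff[OF has_derivative_ident has_derivative_const]]) simp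
    show "(?V has_derivative (\<lambda>v. k X *\<^sub>R v + (((2 * k1 X) *\<^sub>R (X - X0)) \<bullet> v) *\<^sub>R (X - X0))) (at X within UNIV)"
      by (rule has_derivative_scaleR[OF C1_gradientD(1)[OF C1_k] Z])
    show "onorm (\<lambda>v. k X *\<^sub>R v + (((2 * k1 X) *\<^sub>R (X - X0)) \<bullet> v) *\<^sub>R (X - X0)) \<le> 7 * R ^ 6"
    proof (rule onorm_le)
      fix v
      have "\<bar>((2 * k1 X) *\<^sub>R (X - X0)) \<bullet> v\<bar> \<le> 2 * \<bar>k1 X\<bar> * norm (X - X0) * norm v"
        by (rule order_trans[OF Cauchy_Schwarz_ineq2]) (simp add: abs_mult)
      then have "\<bar>((2 * k1 X) *\<^sub>R (X - X0)) \<bullet> v\<bar> * norm (X - X0) \<le> 2 * \<bar>k1 X\<bar> * norm (X - X0) * norm v * norm (X - X0)"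
        by (rule mult_right_mono) simp
      also have "\<dots> = 2 * (t X * \<bar>k1 X\<bar>) * norm v" by (simp add: t_def power2_eq_square)
      also have "\<dots> \<le> 6 * R ^ 6 * norm v" using bounds(3)[of X] by (intro mult_right_mono) auto
      finally have 1: "norm ((((2 * k1 X) *\<^sub>R (X - X0)) \<bullet> v) *\<^sub>R (X - X0)) \<le> 6 * R ^ 6 * norm v" by simp
      have 2: "norm (k X *\<^sub>R v) \<le> R ^ 6 * norm v"
        using bounds(2)[of X] by (simp add: mult_right_mono)
      have "norm (k X *\<^sub>R v + (((2 * k1 X) *\<^sub>R (X - X0)) \<bullet> v) *\<^sub>R (X - X0)) \<le> R ^ 6 * norm v + 6 * R ^ 6 * norm v"
        by (rule norm_triangle_mono[OF 2 1])
      then show "norm (k X *\<^sub>R v + (((2 * k1 X) *\<^sub>R (X - X0)) \<bullet> v) *\<^sub>R (X - X0)) \<le> 7 * R ^ 6 * norm v"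
        by (simp add: mult_ac)
    qed
  qed auto
  then have "\<bar>e\<bar> * norm (?V X - ?V Y) \<le> \<bar>e\<bar> * ((7 * R ^ 6) * norm (X - Y))"
    by (rule mult_left_mono) simp
  also have "\<dots> = (\<bar>e\<bar> * (7 * R ^ 6)) * norm (X - Y)" by simp
  also have "\<dots> \<le> 1 / 2 * norm (X - Y)" using e unfolding small_def by (rule mult_right_mono) simp
  finally have 1: "norm (e *\<^sub>R (?V X - ?V Y)) \<le> 1 / 2 * norm (X - Y)" by simp
  have "shift e X - shift e Y = (X - Y) + e *\<^sub>R (?V X - ?V Y)"
    by (simp add: shift_def a_def algebra_simps)
  then have "norm (X - Y) - norm (e *\<^sub>R (?V X - ?V Y)) \<le> norm (shift e X - shift e Y)"
    using norm_diff_ineq[of "X - Y" "e *\<^sub>R (?V X - ?V Y)"] by simp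
  with 1 show ?thesis by linarith
qed

lemma shift_inj:
  assumes "small e"
  shows "inj (shift e)"
proof (rule injI)
  fix X Y assume "shift e X = shift e Y"
  then show "X = Y" using shift_lower[OF assms, of X Y] by simp
qed

lemma shift_outside: "\<alpha> \<le> t X \<Longrightarrow> shift e X = X"
  by (simp add: shift_def a_def outside)

lemma notin_ball: "X \<notin> ball X0 R \<Longrightarrow> \<alpha> \<le> t X"
proof -
  assume "X \<notin> ball X0 R"
  then have "R \<le> norm (X - X0)" by (simp add: dist_norm norm_minus_commute)
  then have "R\<^sup>2 \<le> t X" unfolding t_def using R by (intro power_mono) auto
  with \<alpha> show ?thesis by simp
qed

text \<open>A point carried out of the disc would land where the shift is the identity, so its image
  would be a fixed point; injectivity then makes it its own image.\<close>

lemma shift_in_ball: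
  assumes e: "small e" and X: "X \<in> ball X0 R"
  shows "shift e X \<in> ball X0 R"
proof (rule ccontr)
  assume n: "shift e X \<notin> ball X0 R"
  then have "shift e (shift e X) = shift e X" by (intro shift_outside notin_ball)
  then have "shift e X = X" using shift_inj[OF e] by (simp add: inj_eq)
  with n X show False by simp
qed

text \<open>Rays from the centre are preserved, so the intermediate value theorem for the radius,
  from 0 to \<open>R\<close>, finds the preimage.\<close>

lemma shift_onto_ball:
  assumes e: "small e" and Y: "Y \<in> ball X0 R"
  shows "\<exists>X\<in>ball X0 R. shift e X = Y"
proof (cases "Y = X0")
  case True
  then show ?thesis using R by (intro bexI[of _ X0]) (simp_all add: shift_def)
next
  case False
  define s where "s = norm (Y - X0)"
  have s: "0 < s" "s < R" using False Y by (simp_all add: s_def dist_norm norm_minus_commute)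
  let ?g = "\<lambda>r. r * (1 + e * max 0 (\<alpha> - r\<^sup>2) ^ 3)"
  have "\<exists>r\<ge>0. r \<le> R \<and> ?g r = s"
  proof (rule IVT')
    show "?g 0 \<le> s" "s \<le> ?g R" "0 \<le> R" using s \<alpha> by simp_all
    show "continuous_on {0..R} ?g" by (intro continuous_intros)
  qed
  then obtain r where r: "0 \<le> r" "r \<le> R" "?g r = s" by blast
  have "r \<noteq> R"
  proof
    assume "r = R"
    then have "?g r = R" using \<alpha> by simp
    with r s show False by simp
  qed
  with r have rR: "r < R" by simp
  define X where "X = X0 + (r / s) *\<^sub>R (Y - X0)"
  have n: "norm (X - X0) = r" using s r by (simp add: X_def s_def[symmetric])
  have "shift e X = X0 + ((1 + e * max 0 (\<alpha> - r\<^sup>2) ^ 3) * (r / s)) *\<^sub>R (Y - X0)"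
    unfolding shift_def a_def k_def t_def n by (simp add: X_def)
  also have "(1 + e * max 0 (\<alpha> - r\<^sup>2) ^ 3) * (r / s) = 1" using r(3) s by (simp add: field_simps)
  finally have "shift e X = Y" by simp
  moreover have "X \<in> ball X0 R" using n rR by (simp add: dist_norm norm_minus_commute)
  ultimately show ?thesis by blast
qed

lemma shift_image: "small e \<Longrightarrow> shift e ` ball X0 R = ball X0 R"
  using shift_in_ball shift_onto_ball by (auto simp: image_iff) metis

lemma shift_surj: "small e \<Longrightarrow> surj (shift e)"
  using shift_onto_ball shift_outside[OF notin_ball] by (metis surjI surj_def)

definition unshift :: "real \<Rightarrow> real \<times> real \<Rightarrow> real \<times> real" where "unshift e = inv (shift e)"

lemma unshift:
  assumes "small e"
  shows "unshift e (shift e X) = X" "shift e (unshift e Y) = Y"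
  unfolding unshift_def using shift_inj[OF assms] shift_surj[OF assms] by (simp_all add: surj_f_inv_f)

lemma unshift_in_ball: "small e \<Longrightarrow> Y \<in> ball X0 R \<Longrightarrow> unshift e Y \<in> ball X0 R"
  using shift_onto_ball[of e Y] unshift(1)[of e] by metis

lemma unshift_outside: "small e \<Longrightarrow> \<alpha> \<le> t Y \<Longrightarrow> unshift e Y = Y"
  using unshift(1)[of e Y] shift_outside[of Y e] by simp

lemma unshift_cont:
  assumes e: "small e"
  shows "continuous_on S (unshift e)"
proof -
  have "dist (unshift e Y) (unshift e Y') \<le> 2 * dist Y Y'" for Y Y'
    using shift_lower[OF e, of "unshift e Y" "unshift e Y'"] by (simp add: unshift(2)[OF e] dist_norm)
  then have "2-lipschitz_on S (unshift e)" by (auto intro!: lipschitz_onI)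
  then show ?thesis by (rule lipschitz_on_continuous_on)
qed

text \<open>The derivative of the shift is symmetric with the positive eigenvalues
  \<open>a e X\<close> and \<open>b e X\<close>; their product is the Jacobian.\<close>

lemma change_variables:
  fixes F :: "real \<times> real \<Rightarrow> real"
  assumes e: "small e"
  shows "set_integrable lebesgue (ball X0 R) (\<lambda>X. (a e X * b e X) * F (shift e X)) \<longleftrightarrow> set_integrable lebesgue (ball X0 R) F"
    and "(LINT X:ball X0 R|lebesgue. (a e X * b e X) * F (shift e X)) = (LINT X:ball X0 R|lebesgue. F X)"
proof -
  have S: "ball X0 R \<in> sets lebesgue" by simp
  have inj: "inj_on (shift e) (ball X0 R)" using shift_inj[OF e] inj_on_subset by blast
  let ?D = "\<lambda>X v. a e X *\<^sub>R v + (2 * e * k1 X * ((X - X0) \<bullet> v)) *\<^sub>R (X - X0)"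
  have jac: "a e X * b e X = \<bar>fst (?D X (1,0)) * snd (?D X (0,1)) - fst (?D X (0,1)) * snd (?D X (1,0))\<bar>" for X
  proof -
    have be: "b e X = a e X + 2 * e * k1 X * ((fst X - fst X0)\<^sup>2 + (snd X - snd X0)\<^sup>2)"
      by (simp add: a_def b_def t_eq algebra_simps)
    have "fst (?D X (1,0)) * snd (?D X (0,1)) - fst (?D X (0,1)) * snd (?D X (1,0)) = a e X * b e X"
      unfolding be by (simp add: inner_prod_def algebra_simps power2_eq_square)
    moreover have "0 \<le> a e X * b e X" using ab_bounds[OF e, of X] by simp
    ultimately show ?thesis by simp
  qed
  note cov = change_of_variables_plane[OF S shift_derivative inj jac]
  show "set_integrable lebesgue (ball X0 R) (\<lambda>X. (a e X * b e X) * F (shift e X)) \<longleftrightarrow> set_integrable lebesgue (ball X0 R) F"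
    using cov(1)[of F] unfolding shift_image[OF e] .
  show "(LINT X:ball X0 R|lebesgue. (a e X * b e X) * F (shift e X)) = (LINT X:ball X0 R|lebesgue. F X)"
    using cov(2)[of F] unfolding shift_image[OF e] .
qed

end

lemma set_integrable_pair:
  fixes w :: "'a \<Rightarrow> real \<times> real"
  assumes "set_integrable M S (\<lambda>x. fst (w x))" "set_integrable M S (\<lambda>x. snd (w x))"
  shows "set_integrable M S w"
proof -
  have "set_integrable M S (\<lambda>x. fst (w x) *\<^sub>R (1::real, 0::real) + snd (w x) *\<^sub>R (0, 1))"
    by (intro set_integral_add(1) set_integrable_scaleR_left impI assms)
  moreover have "fst (w x) *\<^sub>R (1::real, 0::real) + snd (w x) *\<^sub>R (0, 1) = w x" for x
    by (simp add: prod_eq_iff)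
  ultimately show ?thesis by simp
qed

text \<open>With the factor \<open>e\<close> pulled out, the difference quotient at 0 is the
  integrand \<open>r e X * w X\<close> itself. Joint continuity of \<open>r\<close> on a compact set
  gives its limit and a uniform bound, and no derivative of \<open>r\<close> in \<open>e\<close> has
  to be computed.\<close>

lemma DERIV_integral_linear_perturbation:
  fixes r :: "real \<Rightarrow> real \<times> real \<Rightarrow> real"
  assumes d: "0 < d" and r: "continuous_on ({-d..d} \<times> cball X0 R) (\<lambda>p. r (fst p) (snd p))"
    and w: "set_integrable lebesgue (ball X0 R) w"
  shows "((\<lambda>e. LINT X:ball X0 R|lebesgue. e * (r e X * w X)) has_real_derivative (LINT X:ball X0 R|lebesgue. r 0 X * w X)) (at 0)"
    and "\<And>e. \<bar>e\<bar> \<le> d \<Longrightarrow> set_integrable lebesgue (ball X0 R) (\<lambda>X. e * (r e X * w X))"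
proof -
  have c1: "continuous_on (cball X0 R) (r e)" if "\<bar>e\<bar> \<le> d" for e
  proof -
    have "continuous_on (cball X0 R) (\<lambda>X. r (fst (e, X)) (snd (e, X)))"
      by (rule continuous_on_compose2[OF r]) (use that in \<open>auto intro!: continuous_intros\<close>)
    then show ?thesis by simp
  qed
  have ri: "set_integrable lebesgue (ball X0 R) (\<lambda>X. r e X * w X)" if "\<bar>e\<bar> \<le> d" for e
    by (rule set_integrable_continuous_mult[OF c1[OF that] w])
  then show ei: "\<And>e. \<bar>e\<bar> \<le> d \<Longrightarrow> set_integrable lebesgue (ball X0 R) (\<lambda>X. e * (r e X * w X))"
    by (intro set_integrable_mult_right)
  have "compact ({-d..d} \<times> cball X0 R)" by (intro compact_Times compact_Icc compact_cball)
  from compact_imp_bounded[OF compact_continuous_image[OF r this]]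
  obtain M where "\<forall>x \<in> (\<lambda>p. r (fst p) (snd p)) ` ({-d..d} \<times> cball X0 R). norm x \<le> M"
    unfolding bounded_iff by blast
  then have M0: "\<bar>r e X\<bar> \<le> M" if "e \<in> {-d..d}" "X \<in> cball X0 R" for e X
    using that by auto
  have M: "\<bar>r e X\<bar> \<le> M" if "\<bar>e\<bar> \<le> d" "X \<in> cball X0 R" for e X
    by (rule M0[OF _ that(2)]) (use that(1) in auto)
  show "((\<lambda>e. LINT X:ball X0 R|lebesgue. e * (r e X * w X)) has_real_derivative (LINT X:ball X0 R|lebesgue. r 0 X * w X)) (at 0)"
  proof (rule has_derivative_set_integral_parameter[OF d, where H = "\<lambda>X. M * \<bar>w X\<bar>"])
    show "set_integrable lebesgue (ball X0 R) (\<lambda>X. e * (r e X * w X))" if "\<bar>e - 0\<bar> < d" for e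
      using that by (intro ei) simp
    show "set_integrable lebesgue (ball X0 R) (\<lambda>X. M * \<bar>w X\<bar>)"
      by (intro set_integrable_mult_right set_integrable_abs w)
    show "set_borel_measurable lebesgue (ball X0 R) (\<lambda>X. r 0 X * w X)"
      using ri[of 0] d by (intro set_integrable_imp_measurable) simp
    show "AE X in lebesgue. X \<in> ball X0 R \<longrightarrow> ((\<lambda>e. e * (r e X * w X)) has_real_derivative r 0 X * w X) (at 0)"
    proof (intro AE_I2 impI)
      fix X assume X: "X \<in> ball X0 R"
      have "continuous_on {-d..d} (\<lambda>e. r (fst (e, X)) (snd (e, X)))"
        by (rule continuous_on_compose2[OF r]) (use X in \<open>auto intro!: continuous_intros\<close>)
      then have "isCont (\<lambda>e. r e X) 0"
        using d by (intro continuous_on_interior[of "{-d..d}"]) (auto simp: interior_atLeastAtMost_real)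
      then have "((\<lambda>e. r e X * w X) \<longlongrightarrow> r 0 X * w X) (at 0)"
        by (intro tendsto_mult tendsto_const) (simp add: isCont_def)
      then have "((\<lambda>e. (e * (r e X * w X) - 0 * (r 0 X * w X)) / (e - 0)) \<longlongrightarrow> r 0 X * w X) (at 0)"
        by (rule Lim_transform_eventually) (auto simp: eventually_at_filter intro!: always_eventually)
      then show "((\<lambda>e. e * (r e X * w X)) has_real_derivative r 0 X * w X) (at 0)"
        unfolding has_field_derivative_iff .
    qed
    fix e X assume e: "\<bar>e - 0\<bar> < d" and X: "X \<in> ball X0 R"
    have "\<bar>r e X\<bar> \<le> M" using M e X by simp
    then have "\<bar>e\<bar> * (\<bar>r e X\<bar> * \<bar>w X\<bar>) \<le> \<bar>e\<bar> * (M * \<bar>w X\<bar>)"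
      by (intro mult_left_mono mult_right_mono) auto
    then show "\<bar>e * (r e X * w X) - 0 * (r 0 X * w X)\<bar> \<le> M * \<bar>w X\<bar> * \<bar>e - 0\<bar>"
      by (simp add: abs_mult mult_ac)
  qed
qed

section \<open>Transport of a weak gradient by the shift\<close>

context radial_cutoff
begin

text \<open>The inverse of the (symmetric) derivative of \<open>shift e\<close> at \<open>X\<close>, applied to \<open>w X\<close>.\<close>

definition pushed :: "real \<Rightarrow> (real \<times> real \<Rightarrow> real \<times> real) \<Rightarrow> real \<times> real \<Rightarrow> real \<times> real" where
  "pushed e w X = (1 / a e X) *\<^sub>R w X - (2 * e * k1 X * ((X - X0) \<bullet> w X) / (a e X * b e X)) *\<^sub>R (X - X0)"

lemma b_eq: "b e X = a e X + 2 * e * k1 X * t X"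
  by (simp add: a_def b_def algebra_simps)

lemma b_eq': "b e X = a e X + 2 * e * k1 X * ((fst X - fst X0) * (fst X - fst X0) + (snd X - snd X0) * (snd X - snd X0))"
  unfolding b_eq t_eq by (simp add: power2_eq_square)

lemma a_cont: "continuous_on S (a e)" and b_cont: "continuous_on S (b e)"
  unfolding a_def[abs_def] b_def[abs_def] by (intro continuous_intros k_cont k1_cont t_cont)+

lemma shift_cont: "continuous_on S (shift e)"
  unfolding shift_def[abs_def] by (intro continuous_intros a_cont)

lemma C1_a: "C1_gradient (a e) (\<lambda>X. (2 * e * k1 X) *\<^sub>R (X - X0))"
  using C1_gradient_add[OF C1_gradient_const[of 1] C1_gradient_cmult[OF C1_k, of e]]
  unfolding a_def[abs_def] by (simp add: mult_ac)

lemma pushed_components: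
  assumes "small e"
  shows "(a e X * b e X) * fst (pushed e w X) = b e X * fst (w X) - 2 * e * k1 X * ((X - X0) \<bullet> w X) * (fst X - fst X0)"
    and "(a e X * b e X) * snd (pushed e w X) = b e X * snd (w X) - 2 * e * k1 X * ((X - X0) \<bullet> w X) * (snd X - snd X0)"
  using ab_bounds[OF assms, of X] by (simp_all add: pushed_def field_simps)

text \<open>The transformed Dirichlet density with its Jacobian. Only the radial component of
  \<open>w X\<close> is affected differently from the others, hence the correction by the square of
  the inner product with \<open>X - X0\<close>.\<close>

lemma pushed_norm:
  assumes "small e"
  shows "(a e X * b e X) * (norm (pushed e w X))\<^sup>2 =
    b e X / a e X * (norm (w X))\<^sup>2 - 2 * e * k1 X * (a e X + b e X) / (a e X * b e X) * ((X - X0) \<bullet> w X)\<^sup>2"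
proof -
  define A C s q T W where "A = a e X" and "C = b e X" and "s = 2 * e * k1 X" and "q = (X - X0) \<bullet> w X" and "T = t X" and "W = (norm (w X))\<^sup>2"
  have nz: "A \<noteq> 0" "C \<noteq> 0" using ab_bounds[OF assms, of X] by (auto simp: A_def C_def)
  \<comment> \<open>The radial and the tangential eigenvalue differ by \<open>s * T\<close>; this
    eliminates |Z|^2 from the square.\<close>
  have sT: "s * T = C - A" unfolding A_def C_def s_def T_def b_eq by simp
  have "(norm (pushed e w X))\<^sup>2 = W / A\<^sup>2 - 2 * (1 / A) * (s * q / (A * C)) * q + (s * q / (A * C))\<^sup>2 * T"
  proof -
    define Z v where "Z = X - X0" and "v = w X"
    show ?thesis
      unfolding pushed_def A_def[symmetric] C_def[symmetric] s_def[symmetric] q_def power2_norm_eq_inner W_def T_def t_def Z_def[symmetric] v_def[symmetric]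
      by (simp add: inner_diff_left inner_diff_right inner_commute power2_eq_square algebra_simps)
  qed
  also have "(s * q / (A * C))\<^sup>2 * T = s * q\<^sup>2 / (A * C)\<^sup>2 * (s * T)" by (simp add: power2_eq_square)
  finally have "(A * C) * (norm (pushed e w X))\<^sup>2 = (A * C) * (W / A\<^sup>2 - 2 * (1 / A) * (s * q / (A * C)) * q + s * q\<^sup>2 / (A * C)\<^sup>2 * (C - A))"
    unfolding sT by simp
  also have "\<dots> = C / A * W - s * (A + C) / (A * C) * q\<^sup>2"
    using nz by (simp add: field_simps power2_eq_square)
  finally show ?thesis unfolding A_def C_def s_def q_def W_def .
qed

text \<open>By symmetry of the derivative of the shift, the chain rule gives that derivative applied
  to \<open>D\<eta>\<close>, with no transpose to keep track of.\<close>

lemma test_fun_shift: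
  assumes e: "small e" and \<eta>: "test_fun (ball X0 R) \<eta> D\<eta>"
  shows "test_fun (ball X0 R) (\<lambda>X. \<eta> (shift e X))
    (\<lambda>X. a e X *\<^sub>R D\<eta> (shift e X) + (2 * e * k1 X * ((X - X0) \<bullet> D\<eta> (shift e X))) *\<^sub>R (X - X0))"
  unfolding test_fun_def
proof (intro conjI allI)
  have C: "C1_gradient \<eta> D\<eta>" using \<eta> unfolding test_fun_def C1_gradient_def by blast
  fix X
  show "((\<lambda>X. \<eta> (shift e X)) has_derivative (\<lambda>v. (a e X *\<^sub>R D\<eta> (shift e X) + (2 * e * k1 X * ((X - X0) \<bullet> D\<eta> (shift e X))) *\<^sub>R (X - X0)) \<bullet> v)) (at X)"
    by (rule has_derivative_eq_rhs[OF has_derivative_compose[OF shift_derivative C1_gradientD(1)[OF C]]])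
      (simp add: fun_eq_iff inner_add_left inner_add_right inner_commute)
  have "continuous_on UNIV (\<lambda>X. D\<eta> (shift e X))"
    by (rule continuous_on_compose2[OF C1_gradientD(2)[OF C, of UNIV] shift_cont]) simp
  then show "continuous_on UNIV (\<lambda>X. a e X *\<^sub>R D\<eta> (shift e X) + (2 * e * k1 X * ((X - X0) \<bullet> D\<eta> (shift e X))) *\<^sub>R (X - X0))"
    by (intro continuous_intros a_cont k1_cont)
  obtain K where K: "compact K" "K \<subseteq> ball X0 R" "\<forall>X. X \<notin> K \<longrightarrow> \<eta> X = 0"
    using \<eta> unfolding test_fun_def by blast
  show "\<exists>K. compact K \<and> K \<subseteq> ball X0 R \<and> (\<forall>X. X \<notin> K \<longrightarrow> \<eta> (shift e X) = 0)"
  \<comment> \<open>The support is pulled back by the continuous inverse, so it stays compact and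
    inside the disc.\<close>
  proof (intro exI[of _ "unshift e ` K"] conjI allI impI)
    show "compact (unshift e ` K)" by (rule compact_continuous_image[OF unshift_cont[OF e] K(1)])
    show "unshift e ` K \<subseteq> ball X0 R" using K(2) unshift_in_ball[OF e] by blast
    fix X assume "X \<notin> unshift e ` K"
    then have "shift e X \<notin> K" using unshift(1)[OF e, of X] by (metis imageI)
    then show "\<eta> (shift e X) = 0" using K(3) by blast
  qed
qed

text \<open>After the change of variables the Jacobian times the inverse derivative is the cofactor matrix of the
  derivative of \<open>shift e\<close>. Its rows are divergence free, so testing with them leaves only derivatives of the
  transported test function.\<close>

lemma weak_gradient_shift:
  assumes e: "small e" and wg: "weak_gradient (ball X0 R) g Dg"
    and gi: "set_integrable lebesgue (ball X0 R) g" and Dgi: "set_integrable lebesgue (ball X0 R) Dg"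
  shows "set_integrable lebesgue (ball X0 R) (\<lambda>Y. g (unshift e Y))"
    and "set_integrable lebesgue (ball X0 R) (\<lambda>Y. pushed e Dg (unshift e Y))"
    and "weak_gradient (ball X0 R) (\<lambda>Y. g (unshift e Y)) (\<lambda>Y. pushed e Dg (unshift e Y))"
proof -
  let ?B = "ball X0 R"
  let ?\<phi> = "\<lambda>Y. g (unshift e Y)" and ?D\<phi> = "\<lambda>Y. pushed e Dg (unshift e Y)"
  note [simp] = unshift(1)[OF e]
  note cv = change_variables[OF e]
  have "set_integrable lebesgue ?B (\<lambda>X. (a e X * b e X) * g X)"
    by (intro set_integrable_continuous_mult continuous_on_mult a_cont b_cont gi)
  then show \<phi>i: "set_integrable lebesgue ?B ?\<phi>" using cv(1)[of ?\<phi>] by simp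
  have "set_integrable lebesgue ?B (\<lambda>X. b e X * fst (Dg X) - (2 * e * k1 X * (fst X - fst X0)) * ((X - X0) \<bullet> Dg X))"
    by (intro set_integral_diff(1) set_integrable_continuous_mult set_integrable_inner_continuous set_integrable_fst_snd Dgi
        b_cont k1_cont continuous_intros)
  then have 1: "set_integrable lebesgue ?B (\<lambda>Y. fst (?D\<phi> Y))"
    unfolding cv(1)[of "\<lambda>Y. fst (?D\<phi> Y)", symmetric] unshift(1)[OF e] pushed_components[OF e]
    by (simp only: mult_ac)
  have "set_integrable lebesgue ?B (\<lambda>X. b e X * snd (Dg X) - (2 * e * k1 X * (snd X - snd X0)) * ((X - X0) \<bullet> Dg X))"
    by (intro set_integral_diff(1) set_integrable_continuous_mult set_integrable_inner_continuous set_integrable_fst_snd Dgi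
        b_cont k1_cont continuous_intros)
  then have 2: "set_integrable lebesgue ?B (\<lambda>Y. snd (?D\<phi> Y))"
    unfolding cv(1)[of "\<lambda>Y. snd (?D\<phi> Y)", symmetric] unshift(1)[OF e] pushed_components[OF e]
    by (simp only: mult_ac)
  show D\<phi>i: "set_integrable lebesgue ?B ?D\<phi>" by (rule set_integrable_pair[OF 1 2])
  show "weak_gradient ?B ?\<phi> ?D\<phi>"
    unfolding weak_gradient_def
  proof (intro conjI allI impI; (elim conjE)?)
    fix K assume "compact K" "K \<subseteq> ?B"
    moreover from this have "K \<in> sets lebesgue" by (simp add: borel_compact sets_lebesgue_borel)
    ultimately show "set_integrable lebesgue K ?\<phi>" "set_integrable lebesgue K ?D\<phi>"
      using \<phi>i D\<phi>i by (blast intro: set_integrable_subset)+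
  next
    fix \<eta> D\<eta> assume \<eta>: "test_fun ?B \<eta> D\<eta>"
    define \<theta> where "\<theta> X = \<eta> (shift e X)" for X
    define D\<theta> where "D\<theta> X = a e X *\<^sub>R D\<eta> (shift e X) + (2 * e * k1 X * ((X - X0) \<bullet> D\<eta> (shift e X))) *\<^sub>R (X - X0)" for X
    have \<theta>: "test_fun ?B \<theta> D\<theta>"
      using test_fun_shift[OF e \<eta>] unfolding \<theta>_def[abs_def] D\<theta>_def[abs_def] .
    define z1 z2 where "z1 X = fst X - fst X0" and "z2 X = snd X - snd X0" for X :: "real \<times> real"
    have Cz: "C1_gradient z1 (\<lambda>X. (1, 0))" "C1_gradient z2 (\<lambda>X. (0, 1))"
      unfolding z1_def[abs_def] z2_def[abs_def] by (rule C1_gradient_fst C1_gradient_snd)+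
    \<comment> \<open>The derivative matrix is a I + 2 e k1 Z Z^T. Its cofactor matrix has the
      diagonal entries \<open>Q1\<close> and \<open>Q3\<close>, in which the squares of the
      coordinates are exchanged, and the off-diagonal entry \<open>Q2\<close>.\<close>
    note Q1 = C1_gradient_add[OF C1_a[of e] C1_gradient_cmult[OF C1_gradient_mult[OF C1_k1 C1_gradient_mult[OF Cz(2) Cz(2)]], of "2 * e"]]
    note Q2 = C1_gradient_cmult[OF C1_gradient_mult[OF C1_k1 C1_gradient_mult[OF Cz(1) Cz(2)]], of "- (2 * e)"]
    note Q3 = C1_gradient_add[OF C1_a[of e] C1_gradient_cmult[OF C1_gradient_mult[OF C1_k1 C1_gradient_mult[OF Cz(1) Cz(1)]], of "2 * e"]]
    note dv1 = weak_gradient_divergence[OF wg test_fun_mult[OF \<theta> Q1] test_fun_mult[OF \<theta> Q2]]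
    note dv2 = weak_gradient_divergence[OF wg test_fun_mult[OF \<theta> Q2] test_fun_mult[OF \<theta> Q3]]
    \<comment> \<open>The right-hand side is \<open>g\<close> times the divergence of
      \<open>\<theta>\<close> times the first cofactor row. In it the derivatives of the entries
      cancel, including all terms with \<open>k2\<close>; what remains is the cofactor row applied
      to \<open>D\<theta>\<close>, that is, the Jacobian times the derivative of
      \<open>\<eta>\<close> at the image point.\<close>
    have L1: "(a e X * b e X) * (?\<phi> (shift e X) * fst (D\<eta> (shift e X))) =
      g X * (fst (\<theta> X *\<^sub>R ((2 * e * k1 X) *\<^sub>R (X - X0) + (2 * e) *\<^sub>R (k1 X *\<^sub>R (z2 X *\<^sub>R (0, 1) + z2 X *\<^sub>R (0, 1)) + (z2 X * z2 X) *\<^sub>R (2 * k2 X) *\<^sub>R (X - X0))) + (a e X + 2 * e * (k1 X * (z2 X * z2 X))) *\<^sub>R D\<theta> X) +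
        snd (\<theta> X *\<^sub>R (- (2 * e)) *\<^sub>R (k1 X *\<^sub>R (z1 X *\<^sub>R (0, 1) + z2 X *\<^sub>R (1, 0)) + (z1 X * z2 X) *\<^sub>R (2 * k2 X) *\<^sub>R (X - X0)) + (- (2 * e) * (k1 X * (z1 X * z2 X))) *\<^sub>R D\<theta> X))" for X
      unfolding D\<theta>_def b_eq' z1_def z2_def by (simp add: inner_prod_def algebra_simps)
    have R1: "(a e X * b e X) * (\<eta> (shift e X) * fst (?D\<phi> (shift e X))) =
      \<theta> X * (a e X + 2 * e * (k1 X * (z2 X * z2 X))) * fst (Dg X) + \<theta> X * (- (2 * e) * (k1 X * (z1 X * z2 X))) * snd (Dg X)" for X
    proof -
      have "(a e X * b e X) * (\<eta> (shift e X) * fst (?D\<phi> (shift e X))) = \<theta> X * ((a e X * b e X) * fst (pushed e Dg X))"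
        by (simp add: \<theta>_def)
      also have "\<dots> = \<theta> X * (a e X + 2 * e * (k1 X * (z2 X * z2 X))) * fst (Dg X) + \<theta> X * (- (2 * e) * (k1 X * (z1 X * z2 X))) * snd (Dg X)"
        unfolding pushed_components[OF e] unfolding b_eq' z1_def z2_def by (simp add: inner_prod_def algebra_simps)
      finally show ?thesis .
    qed
    have L2: "(a e X * b e X) * (?\<phi> (shift e X) * snd (D\<eta> (shift e X))) =
      g X * (fst (\<theta> X *\<^sub>R (- (2 * e)) *\<^sub>R (k1 X *\<^sub>R (z1 X *\<^sub>R (0, 1) + z2 X *\<^sub>R (1, 0)) + (z1 X * z2 X) *\<^sub>R (2 * k2 X) *\<^sub>R (X - X0)) + (- (2 * e) * (k1 X * (z1 X * z2 X))) *\<^sub>R D\<theta> X) +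
        snd (\<theta> X *\<^sub>R ((2 * e * k1 X) *\<^sub>R (X - X0) + (2 * e) *\<^sub>R (k1 X *\<^sub>R (z1 X *\<^sub>R (1, 0) + z1 X *\<^sub>R (1, 0)) + (z1 X * z1 X) *\<^sub>R (2 * k2 X) *\<^sub>R (X - X0))) + (a e X + 2 * e * (k1 X * (z1 X * z1 X))) *\<^sub>R D\<theta> X))" for X
      unfolding D\<theta>_def b_eq' z1_def z2_def by (simp add: inner_prod_def algebra_simps)
    have R2: "(a e X * b e X) * (\<eta> (shift e X) * snd (?D\<phi> (shift e X))) =
      \<theta> X * (- (2 * e) * (k1 X * (z1 X * z2 X))) * fst (Dg X) + \<theta> X * (a e X + 2 * e * (k1 X * (z1 X * z1 X))) * snd (Dg X)" for X
    proof -
      have "(a e X * b e X) * (\<eta> (shift e X) * snd (?D\<phi> (shift e X))) = \<theta> X * ((a e X * b e X) * snd (pushed e Dg X))"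
        by (simp add: \<theta>_def)
      also have "\<dots> = \<theta> X * (- (2 * e) * (k1 X * (z1 X * z2 X))) * fst (Dg X) + \<theta> X * (a e X + 2 * e * (k1 X * (z1 X * z1 X))) * snd (Dg X)"
        unfolding pushed_components[OF e] unfolding b_eq' z1_def z2_def by (simp add: inner_prod_def algebra_simps)
      finally show ?thesis .
    qed
    have fst_eq: "(LINT Y:?B|lebesgue. ?\<phi> Y * fst (D\<eta> Y)) = - (LINT Y:?B|lebesgue. \<eta> Y * fst (?D\<phi> Y))"
      unfolding cv(2)[of "\<lambda>Y. ?\<phi> Y * fst (D\<eta> Y)", symmetric] cv(2)[of "\<lambda>Y. \<eta> Y * fst (?D\<phi> Y)", symmetric] L1 R1
      by (rule dv1(3))
    have snd_eq: "(LINT Y:?B|lebesgue. ?\<phi> Y * snd (D\<eta> Y)) = - (LINT Y:?B|lebesgue. \<eta> Y * snd (?D\<phi> Y))"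
      unfolding cv(2)[of "\<lambda>Y. ?\<phi> Y * snd (D\<eta> Y)", symmetric] cv(2)[of "\<lambda>Y. \<eta> Y * snd (?D\<phi> Y)", symmetric] L2 R2
      by (rule dv2(3))
    have i1: "set_integrable lebesgue ?B (\<lambda>Y. ?\<phi> Y *\<^sub>R D\<eta> Y)"
    proof (rule set_integrable_pair; unfold fst_scaleR snd_scaleR real_scaleR_def)
      show "set_integrable lebesgue ?B (\<lambda>Y. ?\<phi> Y * fst (D\<eta> Y))"
        unfolding cv(1)[of "\<lambda>Y. ?\<phi> Y * fst (D\<eta> Y)", symmetric] L1 by (rule dv1(1))
      show "set_integrable lebesgue ?B (\<lambda>Y. ?\<phi> Y * snd (D\<eta> Y))"
        unfolding cv(1)[of "\<lambda>Y. ?\<phi> Y * snd (D\<eta> Y)", symmetric] L2 by (rule dv2(1))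
    qed
    have i2: "set_integrable lebesgue ?B (\<lambda>Y. \<eta> Y *\<^sub>R ?D\<phi> Y)"
    proof (rule set_integrable_pair; unfold fst_scaleR snd_scaleR real_scaleR_def)
      show "set_integrable lebesgue ?B (\<lambda>Y. \<eta> Y * fst (?D\<phi> Y))"
        unfolding cv(1)[of "\<lambda>Y. \<eta> Y * fst (?D\<phi> Y)", symmetric] R1 by (rule dv1(2))
      show "set_integrable lebesgue ?B (\<lambda>Y. \<eta> Y * snd (?D\<phi> Y))"
        unfolding cv(1)[of "\<lambda>Y. \<eta> Y * snd (?D\<phi> Y)", symmetric] R2 by (rule dv2(2))
    qed
    show "(LINT Y:?B|lebesgue. ?\<phi> Y *\<^sub>R D\<eta> Y) = - (LINT Y:?B|lebesgue. \<eta> Y *\<^sub>R ?D\<phi> Y)"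
    proof (rule prod_eqI)
      show "fst (LINT Y:?B|lebesgue. ?\<phi> Y *\<^sub>R D\<eta> Y) = fst (- (LINT Y:?B|lebesgue. \<eta> Y *\<^sub>R ?D\<phi> Y))"
        unfolding fst_uminus set_integrable_fst_snd(3)[OF i1] set_integrable_fst_snd(3)[OF i2] fst_scaleR real_scaleR_def by (rule fst_eq)
      show "snd (LINT Y:?B|lebesgue. ?\<phi> Y *\<^sub>R D\<eta> Y) = snd (- (LINT Y:?B|lebesgue. \<eta> Y *\<^sub>R ?D\<phi> Y))"
        unfolding snd_uminus set_integrable_fst_snd(4)[OF i1] set_integrable_fst_snd(4)[OF i2] snd_scaleR real_scaleR_def by (rule snd_eq)
    qed
  qed
qed

end

section \<open>The functional along the domain variation\<close>

locale domain_variation = disc_minimizer f F0 X0 R \<psi> D\<psi> h + radial_cutoff X0 R \<alpha>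
  for f F0 X0 R \<psi> D\<psi> h \<alpha>
begin

definition \<phi> :: "real \<Rightarrow> real \<times> real \<Rightarrow> real" where "\<phi> e Y = \<psi> (unshift e Y)"
definition D\<phi> :: "real \<Rightarrow> real \<times> real \<Rightarrow> real \<times> real" where "D\<phi> e Y = pushed e D\<psi> (unshift e Y)"

lemma a_nz: "small e \<Longrightarrow> a e X \<noteq> 0" and b_nz: "small e \<Longrightarrow> b e X \<noteq> 0"
  using ab_bounds[of e X] by auto

lemma phi_cont: "small e \<Longrightarrow> continuous_on B (\<phi> e)"
  unfolding \<phi>_def[abs_def] by (rule continuous_on_compose2[OF cont unshift_cont]) (use unshift_in_ball in auto)

text \<open>Pulled back to the old variables, both squares become bounded continuous coefficients
  times integrable functions of \<open>\<psi>\<close> and \<open>D\<psi>\<close>.\<close>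

lemma W12w_phi:
  assumes e: "small e"
  shows "W12w B (\<phi> e) (D\<phi> e)"
proof -
  note cv = change_variables(1)[OF e]
  note wg = weak_gradient_shift[OF e psi_weak psi_int Dpsi_int]
  have "set_integrable lebesgue B (\<lambda>X. (a e X * b e X) * (\<psi> X)\<^sup>2)"
    by (intro set_integrable_continuous_mult continuous_on_mult a_cont b_cont psi2_int)
  then have 1: "set_integrable lebesgue B (\<lambda>Y. (\<phi> e Y)\<^sup>2)"
    unfolding cv[of "\<lambda>Y. (\<phi> e Y)\<^sup>2", symmetric] unfolding \<phi>_def unshift(1)[OF e] .
  have "set_integrable lebesgue B (\<lambda>X. b e X / a e X * (norm (D\<psi> X))\<^sup>2 - 2 * e * k1 X * (a e X + b e X) / (a e X * b e X) * ((X - X0) \<bullet> D\<psi> X)\<^sup>2)"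
    by (intro set_integral_diff(1) set_integrable_continuous_mult Dpsi2_int inner_sq_int continuous_intros a_cont b_cont k1_cont ballI)
      (use a_nz[OF e] b_nz[OF e] in simp_all)
  then have 2: "set_integrable lebesgue B (\<lambda>Y. (norm (D\<phi> e Y))\<^sup>2)"
    unfolding cv[of "\<lambda>Y. (norm (D\<phi> e Y))\<^sup>2", symmetric] unfolding D\<phi>_def unshift(1)[OF e] pushed_norm[OF e] .
  show ?thesis
    unfolding W12w_ball_iff[OF disc]
    using set_integrable_imp_measurable[OF wg(1)] set_integrable_imp_measurable[OF wg(2)] wg(3) 1 2
    by (simp add: \<phi>_def[abs_def] D\<phi>_def[abs_def])
qed

lemma J_phi_ge:
  assumes e: "small e"
  shows "J_fun f X0 R \<psi> D\<psi> \<le> J_fun f X0 R (\<phi> e) (D\<phi> e)"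
proof (rule competitor[OF W12w_phi[OF e] compact_cball _ _ phi_cont[OF e]])
  show "cball X0 (sqrt \<alpha>) \<subseteq> B"
  proof -
    have "sqrt \<alpha> < R" using \<alpha> R by (simp add: real_less_lsqrt)
    then show ?thesis by auto
  qed
  show "\<phi> e X = \<psi> X" if "X \<notin> cball X0 (sqrt \<alpha>)" for X
  proof -
    have "sqrt \<alpha> < norm (X - X0)" using that by (simp add: dist_norm norm_minus_commute)
    then have "(sqrt \<alpha>)\<^sup>2 < (norm (X - X0))\<^sup>2" using \<alpha> by (intro power_strict_mono) auto
    then have "\<alpha> \<le> t X" using \<alpha> by (simp add: t_def)
    then show ?thesis unfolding \<phi>_def by (simp add: unshift_outside[OF e])
  qed
qed

definition xs :: "real \<Rightarrow> real \<times> real \<Rightarrow> real" where "xs e X = fst X + e * (k X * (fst X - fst X0))"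
definition ys :: "real \<Rightarrow> real \<times> real \<Rightarrow> real" where "ys e X = snd X + e * (k X * (snd X - snd X0))"

lemma shift_components: "fst (shift e X) = xs e X" "snd (shift e X) = ys e X"
  by (simp_all add: shift_def a_def xs_def ys_def algebra_simps)

text \<open>The closed disc matters: the difference quotients below divide by \<open>xs\<close>, and
  they are bounded by continuity on a compact set.\<close>

lemma xs_pos:
  assumes e: "small e" and X: "X \<in> cball X0 R"
  shows "0 < xs e X"
proof -
  have "shift e X \<in> cball X0 R"
  proof (cases "X \<in> B")
    case True
    then have "shift e X \<in> B" by (rule shift_in_ball[OF e])
    then show ?thesis by simp
  next
    case False
    then show ?thesis using X by (simp add: shift_outside[OF notin_ball])
  qed
  then show ?thesis using positive_discD(2)[OF disc] by (simp add: shift_components[symmetric])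
qed

text \<open>The coefficient of \<open>e\<close> in the radial eigenvalue
  \<open>b e X\<close>.\<close>

definition l :: "real \<times> real \<Rightarrow> real" where "l X = k X + 2 * t X * k1 X"

text \<open>The difference quotients in \<open>e\<close> of the four coefficients of the transformed functional.\<close>

definition r1 :: "real \<Rightarrow> real \<times> real \<Rightarrow> real" where
  "r1 e X = (2 * t X * k1 X * fst X - k X * (fst X - fst X0) * a e X) / (a e X * xs e X * fst X)"
definition r2 :: "real \<Rightarrow> real \<times> real \<Rightarrow> real" where
  "r2 e X = - (2 * k1 X * (a e X + b e X) / (a e X * b e X * xs e X))"
definition r3 :: "real \<Rightarrow> real \<times> real \<Rightarrow> real" where
  "r3 e X = - (2 * (k X * (fst X - fst X0) * (a e X * b e X) + fst X * (k X + l X + e * (k X * l X))))"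
definition r4 :: "real \<Rightarrow> real \<times> real \<Rightarrow> real" where
  "r4 e X = - ((k X * (fst X - fst X0) * snd X + fst X * (k X * (snd X - snd X0)) + e * (k X * (fst X - fst X0) * (k X * (snd X - snd X0)))) * (a e X * b e X)
     + fst X * snd X * (k X + l X + e * (k X * l X)))"

text \<open>In the variables before the shift the positivity set is that of \<open>\<psi>\<close>
  for every \<open>e\<close>. The parameter survives only in the coefficients, and each of them is
  its value at 0 plus \<open>e\<close> times a continuous function.\<close>

lemma J_phi:
  assumes e: "small e"
  shows "J_fun f X0 R (\<phi> e) (D\<phi> e) = (LINT X:B|lebesgue.
     (1 / fst X * (norm (D\<psi> X))\<^sup>2 - 2 * fst X * prim f (\<psi> X) - fst X * snd X * indicator {Y. 0 < \<psi> Y} X)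
      + (e * (r1 e X * (norm (D\<psi> X))\<^sup>2) + e * (r2 e X * ((X - X0) \<bullet> D\<psi> X)\<^sup>2)
         + e * (r3 e X * prim f (\<psi> X)) + e * (r4 e X * indicator {Y. 0 < \<psi> Y} X)))"
proof -
  let ?F = "\<lambda>Y. 1 / fst Y * (norm (D\<phi> e Y))\<^sup>2 - 2 * fst Y * prim f (\<phi> e Y) - fst Y * snd Y * indicator {Y. 0 < \<phi> e Y} Y"
  have "J_fun f X0 R (\<phi> e) (D\<phi> e) = (LINT X:B|lebesgue. (a e X * b e X) * ?F (shift e X))"
    unfolding J_fun_def change_variables(2)[OF e, of ?F] ..
  also have "\<dots> = (LINT X:B|lebesgue.
     (1 / fst X * (norm (D\<psi> X))\<^sup>2 - 2 * fst X * prim f (\<psi> X) - fst X * snd X * indicator {Y. 0 < \<psi> Y} X)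
      + (e * (r1 e X * (norm (D\<psi> X))\<^sup>2) + e * (r2 e X * ((X - X0) \<bullet> D\<psi> X)\<^sup>2)
         + e * (r3 e X * prim f (\<psi> X)) + e * (r4 e X * indicator {Y. 0 < \<psi> Y} X)))"
  proof (rule set_lebesgue_integral_cong, simp, intro allI impI)
    fix X assume X: "X \<in> B"
    let ?W = "(norm (D\<psi> X))\<^sup>2" and ?q = "((X - X0) \<bullet> D\<psi> X)\<^sup>2" and ?I = "indicat_real {Y. 0 < \<psi> Y} X"
    have nz: "a e X \<noteq> 0" "b e X \<noteq> 0" "xs e X \<noteq> 0" "fst X \<noteq> 0"
      using a_nz[OF e] b_nz[OF e] xs_pos[OF e, of X] fst_pos[OF X] X by auto
    have I: "indicat_real {Y. 0 < \<phi> e Y} (shift e X) = ?I"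
      by (simp add: indicator_def \<phi>_def unshift(1)[OF e])
    have ab: "a e X = 1 + e * k X" "b e X = 1 + e * l X" by (simp_all add: a_def b_def l_def)
    have "(a e X * b e X) * ?F (shift e X) =
      1 / xs e X * ((a e X * b e X) * (norm (pushed e D\<psi> X))\<^sup>2) - 2 * xs e X * (a e X * b e X) * prim f (\<psi> X) - xs e X * ys e X * (a e X * b e X) * ?I"
      unfolding I shift_components by (simp add: \<phi>_def D\<phi>_def unshift(1)[OF e] algebra_simps)
    also have "1 / xs e X * ((a e X * b e X) * (norm (pushed e D\<psi> X))\<^sup>2) = 1 / fst X * ?W + (e * (r1 e X * ?W) + e * (r2 e X * ?q))"
    proof -
      have "b e X / (a e X * xs e X) = 1 / fst X + e * r1 e X"
      proof -
        \<comment> \<open>The Dirichlet coefficient \<open>b / (a * xs)\<close> minus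
          \<open>1 / fst X\<close>, brought to a common denominator; the bracket after
          \<open>e\<close> is the numerator of \<open>r1\<close>.\<close>
        have "b e X * fst X = a e X * xs e X + e * (2 * t X * k1 X * fst X - k X * (fst X - fst X0) * a e X)"
          by (simp add: ab xs_def l_def algebra_simps)
        then show ?thesis unfolding r1_def using nz by (simp add: field_simps)
      qed
      then have 1: "b e X / (a e X * xs e X) * ?W = 1 / fst X * ?W + e * (r1 e X * ?W)"
        by (simp add: distrib_right)
      have 2: "- (2 * e * k1 X * (a e X + b e X) / (a e X * b e X * xs e X)) = e * r2 e X"
        unfolding r2_def by simp
      have "1 / xs e X * ((a e X * b e X) * (norm (pushed e D\<psi> X))\<^sup>2) =
          b e X / (a e X * xs e X) * ?W + - (2 * e * k1 X * (a e X + b e X) / (a e X * b e X * xs e X)) * ?q"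
        unfolding pushed_norm[OF e] using nz by (simp add: field_simps)
      then show ?thesis unfolding 1 2 by simp
    qed
    also have "2 * xs e X * (a e X * b e X) * prim f (\<psi> X) = 2 * fst X * prim f (\<psi> X) - e * (r3 e X * prim f (\<psi> X))"
      unfolding r3_def ab xs_def by (simp add: algebra_simps)
    also have "xs e X * ys e X * (a e X * b e X) * ?I = fst X * snd X * ?I - e * (r4 e X * ?I)"
      unfolding r4_def ab xs_def ys_def by (simp add: algebra_simps)
    finally show "(a e X * b e X) * ?F (shift e X) = (1 / fst X * ?W - 2 * fst X * prim f (\<psi> X) - fst X * snd X * ?I)
      + (e * (r1 e X * ?W) + e * (r2 e X * ?q) + e * (r3 e X * prim f (\<psi> X)) + e * (r4 e X * ?I))"
      by simp
  qed
  finally show ?thesis .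
qed

lemma inner_variation:
  "(LINT X:B|lebesgue. k X * (- ((fst X - fst X0) / (fst X)\<^sup>2 * (norm (D\<psi> X))\<^sup>2) - 2 * prim f (\<psi> X) * (fst X - fst X0) - 4 * fst X * prim f (\<psi> X)
        - ((fst X - fst X0) * snd X + (snd X - snd X0) * fst X) * indicator {Y. 0 < \<psi> Y} X - 2 * (fst X * snd X * indicator {Y. 0 < \<psi> Y} X))
      + 2 * k1 X * (t X * (1 / fst X * (norm (D\<psi> X))\<^sup>2 - 2 * fst X * prim f (\<psi> X) - fst X * snd X * indicator {Y. 0 < \<psi> Y} X)
        - 2 / fst X * ((X - X0) \<bullet> D\<psi> X)\<^sup>2)) = 0"
proof -
  \<comment> \<open>Half of the inverse of \<open>7 * R ^ 6\<close>, so that all \<open>e\<close>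
    with \<open>\<bar>e\<bar> \<le> d\<close> satisfy \<open>small\<close>.\<close>
  define d where "d = 1 / (14 * R ^ 6)"
  have d: "0 < d" using R by (simp add: d_def)
  have sm: "small e" if "\<bar>e\<bar> \<le> d" for e
  proof -
    have "\<bar>e\<bar> * (7 * R ^ 6) \<le> d * (7 * R ^ 6)" using that R by (intro mult_right_mono) auto
    also have "\<dots> = 1 / 2" using R by (simp add: d_def)
    finally show ?thesis unfolding small_def .
  qed
  \<comment> \<open>Joint continuity on this compact set is what
    \<open>DERIV_integral_linear_perturbation\<close> asks of the four quotients.\<close>
  let ?D = "{-d..d} \<times> cball X0 R"
  have smD: "small (fst p)" if "p \<in> ?D" for p by (rule sm) (use that in auto)
  have kc: "continuous_on ?D (\<lambda>p. k (snd p))" "continuous_on ?D (\<lambda>p. k1 (snd p))" "continuous_on ?D (\<lambda>p. t (snd p))"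
    by (rule continuous_on_compose2[OF k_cont[of UNIV]] continuous_on_compose2[OF k1_cont[of UNIV]] continuous_on_compose2[OF t_cont[of UNIV]];
        intro continuous_on_snd continuous_on_id subset_UNIV)+
  have lc: "continuous_on ?D (\<lambda>p. l (snd p))" unfolding l_def by (intro continuous_intros kc)
  have ac: "continuous_on ?D (\<lambda>p. a (fst p) (snd p))" "continuous_on ?D (\<lambda>p. b (fst p) (snd p))" "continuous_on ?D (\<lambda>p. xs (fst p) (snd p))"
    unfolding a_def b_def xs_def by (intro continuous_intros kc)+
  have nz: "a (fst p) (snd p) \<noteq> 0" "b (fst p) (snd p) \<noteq> 0" "xs (fst p) (snd p) \<noteq> 0" "fst (snd p) \<noteq> 0" if "p \<in> ?D" for p
    using a_nz[OF smD[OF that]] b_nz[OF smD[OF that]] xs_pos[OF smD[OF that], of "snd p"] positive_discD(2)[OF disc, of "snd p"] that by force+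
  have rc: "continuous_on ?D (\<lambda>p. r1 (fst p) (snd p))" "continuous_on ?D (\<lambda>p. r2 (fst p) (snd p))"
      "continuous_on ?D (\<lambda>p. r3 (fst p) (snd p))" "continuous_on ?D (\<lambda>p. r4 (fst p) (snd p))"
    unfolding r1_def r2_def r3_def r4_def by (intro continuous_intros kc ac lc ballI; use nz in simp)+
  let ?W = "\<lambda>X. (norm (D\<psi> X))\<^sup>2" and ?q = "\<lambda>X. ((X - X0) \<bullet> D\<psi> X)\<^sup>2" and ?F = "\<lambda>X. prim f (\<psi> X)" and ?I = "\<lambda>X. indicat_real {Y. 0 < \<psi> Y} X"
  note F_int = prim_int[OF cont psi2_int] and I_int = indicator_int[OF cont]
  note D1 = DERIV_integral_linear_perturbation[OF d rc(1) Dpsi2_int]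
    and D2 = DERIV_integral_linear_perturbation[OF d rc(2) inner_sq_int]
    and D3 = DERIV_integral_linear_perturbation[OF d rc(3) F_int]
    and D4 = DERIV_integral_linear_perturbation[OF d rc(4) I_int]
  let ?E = "\<lambda>e. (LINT X:B|lebesgue. e * (r1 e X * ?W X)) + (LINT X:B|lebesgue. e * (r2 e X * ?q X))
     + (LINT X:B|lebesgue. e * (r3 e X * ?F X)) + (LINT X:B|lebesgue. e * (r4 e X * ?I X))"
  have J: "J_fun f X0 R (\<phi> e) (D\<phi> e) = J_fun f X0 R \<psi> D\<psi> + ?E e" if e: "\<bar>e\<bar> \<le> d" for e
  proof -
    note i = D1(2)[OF e] D2(2)[OF e] D3(2)[OF e] D4(2)[OF e]
    show ?thesis
      unfolding J_phi[OF sm[OF e]]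
        set_integral_add(2)[OF J_integrand_int[OF cont W12w_psi] set_integral_add(1)[OF set_integral_add(1)[OF set_integral_add(1)[OF i(1,2)] i(3)] i(4)]]
        set_integral_add(2)[OF set_integral_add(1)[OF set_integral_add(1)[OF i(1,2)] i(3)] i(4)]
        set_integral_add(2)[OF set_integral_add(1)[OF i(1,2)] i(3)]
        set_integral_add(2)[OF i(1,2)] J_fun_def[symmetric] ..
  qed
  have ge: "0 \<le> ?E e" if "\<bar>e\<bar> \<le> d" for e
    using J_phi_ge[OF sm[OF that]] J[OF that] by linarith
  have E0: "?E 0 = 0" by simp
  have D: "(?E has_real_derivative (LINT X:B|lebesgue. r1 0 X * ?W X) + (LINT X:B|lebesgue. r2 0 X * ?q X)
     + (LINT X:B|lebesgue. r3 0 X * ?F X) + (LINT X:B|lebesgue. r4 0 X * ?I X)) (at 0)"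
    by (intro DERIV_add D1(1) D2(1) D3(1) D4(1))
  have z: "(LINT X:B|lebesgue. r1 0 X * ?W X) + (LINT X:B|lebesgue. r2 0 X * ?q X)
     + (LINT X:B|lebesgue. r3 0 X * ?F X) + (LINT X:B|lebesgue. r4 0 X * ?I X) = 0"
    \<comment> \<open>The increment of the functional is nonnegative for both signs of
      \<open>e\<close> and zero at 0.\<close>
    by (rule DERIV_local_min[OF D d]) (use ge E0 in \<open>simp only: abs_minus_commute diff_0 abs_minus_cancel\<close>, auto)
  have r0c: "continuous_on (cball X0 R) (r 0)" if "continuous_on ?D (\<lambda>p. r (fst p) (snd p))" for r :: "real \<Rightarrow> real \<times> real \<Rightarrow> real"
  proof -
    have "continuous_on (cball X0 R) ((\<lambda>p. r (fst p) (snd p)) \<circ> (\<lambda>X. (0::real, X)))"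
    proof (rule continuous_on_compose)
      show "continuous_on (cball X0 R) (\<lambda>X. (0::real, X))" by (intro continuous_intros)
      show "continuous_on ((\<lambda>X. (0::real, X)) ` cball X0 R) (\<lambda>p. r (fst p) (snd p))"
        by (rule continuous_on_subset[OF that]) (use d in auto)
    qed
    then show ?thesis by (simp add: comp_def)
  qed
  note i0 = set_integrable_continuous_mult[OF r0c[OF rc(1)] Dpsi2_int] set_integrable_continuous_mult[OF r0c[OF rc(2)] inner_sq_int]
    set_integrable_continuous_mult[OF r0c[OF rc(3)] F_int] set_integrable_continuous_mult[OF r0c[OF rc(4)] I_int]
  have "(LINT X:B|lebesgue. r1 0 X * ?W X + r2 0 X * ?q X + r3 0 X * ?F X + r4 0 X * ?I X) = 0"
    unfolding set_integral_add(2)[OF set_integral_add(1)[OF set_integral_add(1)[OF i0(1,2)] i0(3)] i0(4)]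
        set_integral_add(2)[OF set_integral_add(1)[OF i0(1,2)] i0(3)]
        set_integral_add(2)[OF i0(1,2)] by (rule z)
  \<comment> \<open>At \<open>e = 0\<close> both eigenvalues are 1 and \<open>xs\<close> is
    \<open>fst X\<close>; the coefficients are then sorted by \<open>k\<close> and
    \<open>k1\<close>.\<close>
  moreover have "(LINT X:B|lebesgue. r1 0 X * ?W X + r2 0 X * ?q X + r3 0 X * ?F X + r4 0 X * ?I X) =
    (LINT X:B|lebesgue. k X * (- ((fst X - fst X0) / (fst X)\<^sup>2 * ?W X) - 2 * ?F X * (fst X - fst X0) - 4 * fst X * ?F X
        - ((fst X - fst X0) * snd X + (snd X - snd X0) * fst X) * ?I X - 2 * (fst X * snd X * ?I X))
      + 2 * k1 X * (t X * (1 / fst X * ?W X - 2 * fst X * ?F X - fst X * snd X * ?I X) - 2 / fst X * ?q X))"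
  proof (rule set_lebesgue_integral_cong, simp, intro allI impI)
    fix X assume "X \<in> B"
    then have x: "fst X \<noteq> 0" using fst_pos[of X] by simp
    have 1: "r1 0 X * ?W X = k X * (- ((fst X - fst X0) / (fst X)\<^sup>2 * ?W X)) + 2 * k1 X * (t X * (1 / fst X * ?W X))"
      unfolding r1_def a_def xs_def using x by (simp add: field_simps power2_eq_square)
    have 2: "r2 0 X * ?q X = 2 * k1 X * (- (2 / fst X * ?q X))"
      unfolding r2_def a_def b_def xs_def using x by (simp add: field_simps)
    have 3: "r3 0 X * ?F X = k X * (- 2 * ?F X * (fst X - fst X0) - 4 * fst X * ?F X) + 2 * k1 X * (t X * (- 2 * fst X * ?F X))"
      unfolding r3_def a_def b_def l_def by (simp add: algebra_simps)
    have 4: "r4 0 X * ?I X = k X * (- ((fst X - fst X0) * snd X + (snd X - snd X0) * fst X) * ?I X - 2 * (fst X * snd X * ?I X))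
        + 2 * k1 X * (t X * (- (fst X * snd X * ?I X)))"
      unfolding r4_def a_def b_def l_def by (simp add: algebra_simps)
    show "r1 0 X * ?W X + r2 0 X * ?q X + r3 0 X * ?F X + r4 0 X * ?I X =
      k X * (- ((fst X - fst X0) / (fst X)\<^sup>2 * ?W X) - 2 * ?F X * (fst X - fst X0) - 4 * fst X * ?F X
        - ((fst X - fst X0) * snd X + (snd X - snd X0) * fst X) * ?I X - 2 * (fst X * snd X * ?I X))
      + 2 * k1 X * (t X * (1 / fst X * ?W X - 2 * fst X * ?F X - fst X * snd X * ?I X) - 2 / fst X * ?q X)"
      unfolding 1 2 3 4 by (simp only: distrib_left right_diff_distrib mult_minus_right mult_minus_left)
  qed
  ultimately show ?thesis by simp
qed

end


subsection \<open>Derivative of the frequency quantity\<close>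

lemma circle_integral_cong:
  assumes "0 \<le> r" "\<And>X. norm (X - X0) = r \<Longrightarrow> g X = h X"
  shows "circle_integral X0 r g = circle_integral X0 r h"
  unfolding circle_integral_def by (simp add: assms(2)[OF norm_circ[OF assms(1)]])

text \<open>Sums of circle integrals may be split only where the summands are integrable over that
  circle; for expressions in \<open>D\<psi>\<close> this is available for almost every
  radius.\<close>

definition circle_integrable :: "real \<times> real \<Rightarrow> real \<Rightarrow> (real \<times> real \<Rightarrow> real) \<Rightarrow> bool" where
  "circle_integrable X0 r g \<longleftrightarrow> set_integrable lebesgue {0..2*pi} (\<lambda>\<theta>. g (circ X0 r \<theta>))"

lemma circle_integral_add:
  assumes "circle_integrable X0 r g" "circle_integrable X0 r h"
  shows "circle_integrable X0 r (\<lambda>X. g X + h X)"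
    "circle_integral X0 r (\<lambda>X. g X + h X) = circle_integral X0 r g + circle_integral X0 r h"
  using assms unfolding circle_integrable_def circle_integral_def set_integral_mult_left
  by (simp_all only: set_integral_add distrib_right)

lemma circle_integral_diff:
  assumes "circle_integrable X0 r g" "circle_integrable X0 r h"
  shows "circle_integrable X0 r (\<lambda>X. g X - h X)"
    "circle_integral X0 r (\<lambda>X. g X - h X) = circle_integral X0 r g - circle_integral X0 r h"
  using assms unfolding circle_integrable_def circle_integral_def set_integral_mult_left
  by (simp_all only: set_integral_diff left_diff_distrib)

lemma circle_integrable_cmult:
  "circle_integrable X0 r g \<Longrightarrow> circle_integrable X0 r (\<lambda>X. c * g X)"
  unfolding circle_integrable_def by (rule set_integrable_mult_right)

lemma circle_integral_cmult:
  "circle_integral X0 r (\<lambda>X. c * g X) = c * circle_integral X0 r g"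
  unfolding circle_integral_def mult.assoc set_integral_mult_right ..

lemma AE_circle_integrable:
  assumes "0 < R" "set_integrable lebesgue (ball X0 R) g"
  shows "AE r in lebesgue. 0 < r \<and> r < R \<longrightarrow> circle_integrable X0 r g"
  using polar_coordinates(1)[OF assms] by (simp add: circle_integrable_def)

section \<open>The Pohozaev identity and the final computation\<close>

context disc_minimizer
begin

text \<open>\<open>W - P - S\<close> is the density in the disc term of \<open>D_fun\<close>;
  \<open>E\<close> and \<open>L\<close> are the disc densities of \<open>J0_fun\<close> and
  \<open>K1_fun\<close>; \<open>Q\<close> and \<open>T\<close> arise from expanding the square in
  the result.\<close>

abbreviation "W X \<equiv> 1 / fst X * (norm (D\<psi> X))\<^sup>2"
abbreviation "Q X \<equiv> 1 / fst X * ((X - X0) \<bullet> D\<psi> X)\<^sup>2"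
abbreviation "G X \<equiv> fst X * prim f (\<psi> X)"
abbreviation "P X \<equiv> fst X * snd X * indicat_real {Y. 0 < \<psi> Y} X"
abbreviation "S X \<equiv> fst X * \<psi> X * f (\<psi> X)"
abbreviation "T X \<equiv> 2 * \<psi> X / fst X * ((X - X0) \<bullet> D\<psi> X)"
abbreviation "E X \<equiv> (fst X - fst X0) / (fst X)\<^sup>2 * (norm (D\<psi> X))\<^sup>2
  + ((fst X - fst X0) * snd X + (snd X - snd X0) * fst X) * indicat_real {Y. 0 < \<psi> Y} X"
abbreviation "L X \<equiv> 2 * prim f (\<psi> X) * (fst X - fst X0) + 4 * fst X * prim f (\<psi> X)"

lemma W_int: "set_integrable lebesgue B W"
  by (intro set_integrable_continuous_mult inverse_fst_cont Dpsi2_int)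

lemma Q_int: "set_integrable lebesgue B Q"
  by (intro set_integrable_continuous_mult inverse_fst_cont inner_sq_int)

lemma G_int: "set_integrable lebesgue B G"
  by (intro set_integrable_continuous_mult prim_int[OF cont psi2_int] continuous_intros)

lemma P_int: "set_integrable lebesgue B P"
  by (intro set_integrable_continuous_mult indicator_int[OF cont] continuous_intros)

lemma S_int: "set_integrable lebesgue B S"
  unfolding mult.assoc by (intro set_integrable_continuous_mult psi_f_int continuous_intros)

lemma E_int: "set_integrable lebesgue B E"
proof -
  have c: "continuous_on (cball X0 R) (\<lambda>X. (fst X - fst X0) / (fst X)\<^sup>2)"
    by (intro continuous_intros ballI) (use positive_discD(2)[OF disc] in force)
  have "continuous_on (cball X0 R) (\<lambda>X. (fst X - fst X0) * snd X + (snd X - snd X0) * fst X)"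
    by (intro continuous_intros)
  from set_integral_add(1)[OF set_integrable_continuous_mult[OF c Dpsi2_int]
      set_integrable_continuous_mult[OF this indicator_int[OF cont]]]
  show ?thesis .
qed

lemma L_int: "set_integrable lebesgue B L"
proof -
  have "set_integrable lebesgue B (\<lambda>X. (2 * (fst X - fst X0) + 4 * fst X) * prim f (\<psi> X))"
    by (intro set_integrable_continuous_mult prim_int[OF cont psi2_int] continuous_intros)
  then show ?thesis by (simp add: algebra_simps)
qed

text \<open>The Pohozaev identity. It expresses the circle integral of the full squared gradient by
  that of its radial part and by integrals over the disc.\<close>

lemma inner_variation_circles:
  "AE r in lebesgue. 0 < r \<and> r < R \<longrightarrow>
    circle_integral X0 r (\<lambda>X. (norm (X - X0))\<^sup>2 * (W X - 2 * G X - P X) - 2 * Q X) =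
    r * (LINT X:ball X0 r|lebesgue. - E X - L X - 2 * P X)"
proof (rule radial_variation_identity[OF R_pos])
  show "set_integrable lebesgue B (\<lambda>X. - E X - L X - 2 * P X)"
    using set_integrable_mult_right[of "-1" lebesgue B E] E_int
    by (intro set_integral_diff(1) L_int P_int set_integrable_mult_right) simp
  show "set_integrable lebesgue B (\<lambda>X. (norm (X - X0))\<^sup>2 * (W X - 2 * G X - P X) - 2 * Q X)"
    by (intro set_integral_diff(1) set_integrable_mult_right Q_int)
       (rule set_integrable_continuous_mult, intro continuous_intros, intro set_integral_diff(1) set_integrable_mult_right W_int G_int P_int)
  fix \<alpha> :: real assume \<alpha>: "0 < \<alpha>" "\<alpha> < R\<^sup>2"
  interpret v: domain_variation f F0 X0 R \<psi> D\<psi> h \<alpha>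
    by unfold_locales (use R_pos \<alpha> in auto)
  let ?p = "\<lambda>X. max 0 (\<alpha> - (norm (X - X0))\<^sup>2)"
  show "(LINT X:B|lebesgue. ?p X ^ 3 * (- E X - L X - 2 * P X)
      - 6 * ?p X ^ 2 * ((norm (X - X0))\<^sup>2 * (W X - 2 * G X - P X) - 2 * Q X)) = 0"
  proof (rule trans[OF set_lebesgue_integral_cong v.inner_variation], simp, intro allI impI)
    fix X
    have eq: "p * (- E X - L X - 2 * P X) - 6 * q * (s * (W X - 2 * G X - P X) - 2 * Q X) =
       p * (- ((fst X - fst X0) / (fst X)\<^sup>2 * (norm (D\<psi> X))\<^sup>2) - 2 * prim f (\<psi> X) * (fst X - fst X0) - 4 * fst X * prim f (\<psi> X)
        - ((fst X - fst X0) * snd X + (snd X - snd X0) * fst X) * indicator {Y. 0 < \<psi> Y} X - 2 * (fst X * snd X * indicator {Y. 0 < \<psi> Y} X))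
      + 2 * (- 3 * q) * (s * (1 / fst X * (norm (D\<psi> X))\<^sup>2 - 2 * fst X * prim f (\<psi> X) - fst X * snd X * indicator {Y. 0 < \<psi> Y} X)
        - 2 / fst X * ((X - X0) \<bullet> D\<psi> X)\<^sup>2)" for p q s
    proof -
      \<comment> \<open>The densities are replaced by variables, so that this is an identity of
        polynomials.\<close>
      have "p * (- (e + J * i) - (2 * F * d + 4 * x * F) - 2 * (x * y * i)) - 6 * q * (s * (w - 2 * (x * F) - x * y * i) - 2 * c) =
         p * (- e - 2 * F * d - 4 * x * F - J * i - 2 * (x * y * i)) + 2 * (- 3 * q) * (s * (w - 2 * x * F - x * y * i) - 2 * c)"
        for e J i F d x y w c :: real
        by algebra
      from this[where c = "Q X"] show ?thesis by (simp only: times_divide_eq_left times_divide_eq_right mult_1_right mult_1_left)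
    qed
    show "?p X ^ 3 * (- E X - L X - 2 * P X) - 6 * ?p X ^ 2 * ((norm (X - X0))\<^sup>2 * (W X - 2 * G X - P X) - 2 * Q X) =
      v.k X * (- ((fst X - fst X0) / (fst X)\<^sup>2 * (norm (D\<psi> X))\<^sup>2) - 2 * prim f (\<psi> X) * (fst X - fst X0) - 4 * fst X * prim f (\<psi> X)
        - ((fst X - fst X0) * snd X + (snd X - snd X0) * fst X) * indicator {Y. 0 < \<psi> Y} X - 2 * (fst X * snd X * indicator {Y. 0 < \<psi> Y} X))
      + 2 * v.k1 X * (v.t X * (1 / fst X * (norm (D\<psi> X))\<^sup>2 - 2 * fst X * prim f (\<psi> X) - fst X * snd X * indicator {Y. 0 < \<psi> Y} X)
        - 2 / fst X * ((X - X0) \<bullet> D\<psi> X)\<^sup>2)"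
      unfolding v.k_def v.k1_def v.t_def by (rule eq)
  qed
qed

text \<open>After the product rule, the Pohozaev identity replaces the circle integral of
  \<open>W - P\<close> and the energy identity the disc integral of \<open>W - S\<close>. The two
  contributions of twice the disc integral of \<open>P\<close> cancel, and the circle integrals of
  \<open>Q\<close>, \<open>T\<close> and \<psi>^2 / x get the coefficients 2, -2 and 2 over r^4,
  which is the completed square.\<close>

lemma frequency_derivative:
  "AE r in lebesgue. 0 < r \<and> r < R / 2 \<longrightarrow>
    (D_fun f X0 \<psi> D\<psi> has_real_derivative
       2 / r^2 * circle_integral X0 r (\<lambda>X. 1 / fst X * (D\<psi> X \<bullet> ((X - X0) /\<^sub>R r) - \<psi> X / r)\<^sup>2)
       + 1 / r^4 * circle_integral X0 r (\<lambda>X. (fst X - fst X0) / (fst X)\<^sup>2 * (\<psi> X)\<^sup>2)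
       - 1 / r^3 * J0_fun X0 \<psi> D\<psi> r - 1 / r^3 * K1_fun f X0 \<psi> r) (at r)"
proof -
  have Aint: "set_integrable lebesgue B (\<lambda>X. W X - P X - S X)"
    by (intro set_integral_diff(1) W_int P_int S_int)
  have half: "R / 2 < R" using R_pos by simp
  have "set_integrable lebesgue B (\<lambda>X. 1 / fst X * (\<psi> X)\<^sup>2)"
    by (intro set_integrable_continuous_mult inverse_fst_cont psi2_int)
  note ae = AE_circle_integrable[OF R_pos W_int] AE_circle_integrable[OF R_pos Q_int] AE_circle_integrable[OF R_pos G_int]
    AE_circle_integrable[OF R_pos P_int] AE_circle_integrable[OF R_pos S_int] AE_circle_integrable[OF R_pos psi_inner_int]
    AE_circle_integrable[OF R_pos this]
    inner_variation_circles outer_variation_circles AE_has_derivative_ball_integral[OF R_pos Aint]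
    AE_has_derivative_circle_square[OF R_pos psi_weak psi_int Dpsi_int cont _ half]
  have pos: "\<forall>X\<in>B. 0 < fst X" using fst_pos by blast
  show ?thesis
    using ae(1-10) ae(11)[OF pos]
  proof eventually_elim
    case (elim r)
    show ?case
    proof
      assume r2: "0 < r \<and> r < R / 2"
      then have r: "0 < r \<and> r < R" using half by auto
      note i = elim(1-7)[rule_format, OF r]
      let ?C = "circle_integral X0 r"
      have sub: "set_integrable lebesgue (ball X0 r) w" if "set_integrable lebesgue B w" for w :: "real \<times> real \<Rightarrow> real"
        by (rule set_integrable_subset[OF that]) (use r in auto)
      let ?N = "\<lambda>w. LINT X:ball X0 r|lebesgue. w X"
      define A where "A = ?N (\<lambda>X. W X - P X - S X)"
      have A: "A = ?N W - ?N P - ?N S"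
        unfolding A_def set_integral_diff(2)[OF set_integral_diff(1)[OF sub[OF W_int] sub[OF P_int]] sub[OF S_int]]
          set_integral_diff(2)[OF sub[OF W_int] sub[OF P_int]] ..
      have E1: "r\<^sup>2 * (?C W - 2 * ?C G - ?C P) - 2 * ?C Q = r * (- ?N E - ?N L - 2 * ?N P)"
      proof -
        have "?C (\<lambda>X. (norm (X - X0))\<^sup>2 * (W X - 2 * G X - P X) - 2 * Q X) = ?C (\<lambda>X. r\<^sup>2 * (W X - 2 * G X - P X) - 2 * Q X)"
          by (rule circle_integral_cong) (use r in simp_all)
        also have "\<dots> = r\<^sup>2 * (?C W - 2 * ?C G - ?C P) - 2 * ?C Q"
        proof -
          note d1 = circle_integral_diff[OF i(1) circle_integrable_cmult[OF i(3), of 2]]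
          note d2 = circle_integral_diff[OF d1(1) i(4)]
          note d3 = circle_integral_diff[OF circle_integrable_cmult[OF d2(1), of "r\<^sup>2"] circle_integrable_cmult[OF i(2), of 2]]
          show ?thesis unfolding d3(2) circle_integral_cmult d2(2) d1(2) ..
        qed
        finally have l: "?C (\<lambda>X. (norm (X - X0))\<^sup>2 * (W X - 2 * G X - P X) - 2 * Q X) = r\<^sup>2 * (?C W - 2 * ?C G - ?C P) - 2 * ?C Q" .
        have mE: "set_integrable lebesgue (ball X0 r) (\<lambda>X. - E X)" "?N (\<lambda>X. - E X) = - ?N E"
          using set_integrable_mult_right[of "-1" lebesgue "ball X0 r" E] sub[OF E_int] set_integral_uminus[OF sub[OF E_int]] by simp_all
        note n1 = set_integral_diff[OF mE(1) sub[OF L_int]]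
        have n2: "set_integrable lebesgue (ball X0 r) (\<lambda>X. 2 * P X)" by (intro set_integrable_mult_right sub P_int)
        have "?N (\<lambda>X. - E X - L X - 2 * P X) = - ?N E - ?N L - 2 * ?N P"
          unfolding set_integral_diff(2)[OF n1(1) n2] n1(2) mE(2) set_integral_mult_right ..
        with elim(8)[rule_format, OF r] l show ?thesis by simp
      qed
      have E2: "?C T = r * (2 * (?N W - ?N S))"
        using elim(9)[rule_format, OF r] unfolding set_integral_mult_right set_integral_diff(2)[OF sub[OF W_int] sub[OF S_int]] .
      have A': "?C (\<lambda>X. W X - P X - S X) = ?C W - ?C P - ?C S"
        unfolding circle_integral_diff(2)[OF circle_integral_diff(1)[OF i(1,4)] i(5)] circle_integral_diff(2)[OF i(1,4)] ..
      have J0: "J0_fun X0 \<psi> D\<psi> r = ?N E" unfolding J0_fun_def ..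
      have K1: "K1_fun f X0 \<psi> r = ?N L - r * (2 * ?C G - ?C S)"
      proof -
        have "?C (\<lambda>X. 2 * fst X * prim f (\<psi> X) - fst X * \<psi> X * f (\<psi> X)) = ?C (\<lambda>X. 2 * G X - S X)"
          by (rule circle_integral_cong) (use r in simp_all)
        also have "\<dots> = 2 * ?C G - ?C S"
          unfolding circle_integral_diff(2)[OF circle_integrable_cmult[OF i(3), of 2] i(5)] circle_integral_cmult ..
        finally show ?thesis unfolding K1_fun_def by simp
      qed
      let ?B = "\<lambda>X. 1 / fst X * (\<psi> X)\<^sup>2" and ?X = "\<lambda>X. (fst X - fst X0) / (fst X)\<^sup>2 * (\<psi> X)\<^sup>2"
      have sq: "?C (\<lambda>X. 1 / fst X * (D\<psi> X \<bullet> ((X - X0) /\<^sub>R r) - \<psi> X / r)\<^sup>2) = 1 / r\<^sup>2 * (?C Q - ?C T + ?C ?B)"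
      proof -
        have "?C (\<lambda>X. 1 / fst X * (D\<psi> X \<bullet> ((X - X0) /\<^sub>R r) - \<psi> X / r)\<^sup>2) = ?C (\<lambda>X. 1 / r\<^sup>2 * (Q X - T X + ?B X))"
        proof (rule circle_integral_cong)
          fix X
          define q where "q = (X - X0) \<bullet> D\<psi> X"
          have e: "D\<psi> X \<bullet> ((X - X0) /\<^sub>R r) - \<psi> X / r = (q - \<psi> X) / r"
            by (simp add: q_def inner_commute divide_inverse algebra_simps)
          show "1 / fst X * (D\<psi> X \<bullet> ((X - X0) /\<^sub>R r) - \<psi> X / r)\<^sup>2 = 1 / r\<^sup>2 * (Q X - T X + ?B X)"
            unfolding e power_divide power2_diff unfolding q_def[symmetric]
            by (simp add: add_divide_distrib diff_divide_distrib algebra_simps)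
        qed (use r in simp)
        also have "\<dots> = 1 / r\<^sup>2 * (?C Q - ?C T + ?C ?B)"
          unfolding circle_integral_cmult circle_integral_add(2)[OF circle_integral_diff(1)[OF i(2,6)] i(7)] circle_integral_diff(2)[OF i(2,6)] ..
        finally show ?thesis .
      qed
      have dA: "((\<lambda>r. LINT X:ball X0 r|lebesgue. W X - P X - S X) has_real_derivative ?C W - ?C P - ?C S) (at r)"
        using elim(10)[rule_format, OF r] unfolding A' .
      have dB: "((\<lambda>r. circle_integral X0 r ?B) has_real_derivative ?C ?B / r + ?C T / r - ?C ?X / r) (at r)"
        using elim(11)[rule_format, OF r2] .
      have r0: "r \<noteq> 0" using r by simp
      have Df: "D_fun f X0 \<psi> D\<psi> = (\<lambda>r. 1 / r^2 * (LINT X:ball X0 r|lebesgue. W X - P X - S X) - 1 / r^3 * circle_integral X0 r ?B)"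
        by (rule ext) (simp only: D_fun_def)
      have d2: "((\<lambda>r. 1 / r^2) has_real_derivative - 2 / r^3) (at r)"
        by (rule derivative_eq_intros refl | use r0 in \<open>simp add: field_simps power2_eq_square power3_eq_cube\<close>)+
      have d3: "((\<lambda>r. 1 / r^3) has_real_derivative - 3 / r^4) (at r)"
        by (rule derivative_eq_intros refl | use r0 in \<open>simp add: field_simps eval_nat_numeral\<close>)+
      show "(D_fun f X0 \<psi> D\<psi> has_real_derivative
       2 / r^2 * ?C (\<lambda>X. 1 / fst X * (D\<psi> X \<bullet> ((X - X0) /\<^sub>R r) - \<psi> X / r)\<^sup>2)
       + 1 / r^4 * ?C ?X - 1 / r^3 * J0_fun X0 \<psi> D\<psi> r - 1 / r^3 * K1_fun f X0 \<psi> r) (at r)"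
        unfolding Df
      proof (rule DERIV_cong[OF DERIV_diff[OF DERIV_mult[OF d2 dA] DERIV_mult[OF d3 dB]]])
        \<comment> \<open>Every integral is named, so that the remaining identity is rational in
          \<open>r\<close> and linear in these names.\<close>
        define cW cP cS cT cQ cG cB cX nE nL nP nW nS where defs: "cW = ?C W" "cP = ?C P" "cS = ?C S" "cT = ?C T" "cQ = ?C Q"
          "cG = ?C G" "cB = ?C ?B" "cX = ?C ?X" "nE = ?N E" "nL = ?N L" "nP = ?N P" "nW = ?N W" "nS = ?N S"
        have e1: "2 * cQ = r\<^sup>2 * (cW - 2 * cG - cP) + r * (nE + nL + 2 * nP)"
          using E1 unfolding defs[symmetric] by (simp add: algebra_simps)
        have e2: "cT = r * (2 * (nW - nS))" using E2 unfolding defs[symmetric] .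
        \<comment> \<open>The Pohozaev identity is solved for twice \<open>cQ\<close>, so the square
          is brought to a form that contains this expression literally.\<close>
        have "2 / r^2 * (1 / r\<^sup>2 * (cQ - cT + cB)) = 1 / r\<^sup>2 * (1 / r\<^sup>2 * (2 * cQ - 2 * cT + 2 * cB))"
          using r0 by (simp add: field_simps)
        moreover have "- 2 / r^3 * (nW - nP - nS) + (cW - cP - cS) * (1 / r\<^sup>2) - (- 3 / r^4 * cB + (cB / r + cT / r - cX / r) * (1 / r^3)) =
          1 / r\<^sup>2 * (1 / r\<^sup>2 * (2 * cQ - 2 * cT + 2 * cB)) + 1 / r^4 * cX - 1 / r^3 * nE - 1 / r^3 * (nL - r * (2 * cG - cS))"
          unfolding e1 e2 using r0 by (simp add: field_simps eval_nat_numeral)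
        ultimately show "- 2 / r^3 * ?N (\<lambda>X. W X - P X - S X) + (?C W - ?C P - ?C S) * (1 / r\<^sup>2) -
            (- 3 / r^4 * ?C ?B + (?C ?B / r + ?C T / r - ?C ?X / r) * (1 / r^3)) =
          2 / r^2 * ?C (\<lambda>X. 1 / fst X * (D\<psi> X \<bullet> ((X - X0) /\<^sub>R r) - \<psi> X / r)\<^sup>2)
       + 1 / r^4 * ?C ?X - 1 / r^3 * J0_fun X0 \<psi> D\<psi> r - 1 / r^3 * K1_fun f X0 \<psi> r"
          unfolding J0 K1 sq A_def[symmetric] A unfolding defs[symmetric] by (simp only:)
      qed
    qed
  qed
qed

end

theorem lemma4p3:
  fixes f :: "real \<Rightarrow> real" and \<beta> F0 :: real
    and \<Omega> :: "(real \<times> real) set"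
    and \<psi> :: "real \<times> real \<Rightarrow> real" and D\<psi> :: "real \<times> real \<Rightarrow> real \<times> real"
    and x\<^sub>0 y\<^sub>0 R\<^sub>0 :: real and X\<^sub>0 :: "real \<times> real"
  assumes beta: "0 < \<beta>" "\<beta> < 1"
    and f_C1: "C1_holder \<beta> f"
    and F0: "0 \<le> F0"
    and f_bound: "\<And>z. z \<le> 0 \<Longrightarrow> 0 \<le> f z \<and> f z \<le> F0"
    and f'_bound: "\<And>z. - F0 \<le> deriv f z \<and> deriv f z \<le> 0"
    and Omega: "connected \<Omega>" "openin (top_of_set {X. 0 \<le> fst X}) \<Omega>"
    and fb: "free_boundary \<Omega> \<psi> \<subseteq> {X. 0 \<le> fst X \<and> snd X \<le> 0}"
    and X0: "X\<^sub>0 = (x\<^sub>0, y\<^sub>0)" "X\<^sub>0 \<in> nondegenerate_points \<Omega> \<psi>"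
    and R0: "R\<^sub>0 = 1/2 * min (x\<^sub>0 / 2) (- (y\<^sub>0 / 2))"
    and ball: "ball X\<^sub>0 R\<^sub>0 \<subseteq> \<Omega>"
    and minimizer: "local_minimizer f X\<^sub>0 R\<^sub>0 \<psi> D\<psi>"
    and trace: "nonneg_trace X\<^sub>0 R\<^sub>0 \<psi> D\<psi>"
    and cont: "continuous_on (ball X\<^sub>0 R\<^sub>0) \<psi>"
  shows "AE r in lebesgue. 0 < r \<and> r < R\<^sub>0 / 2 \<longrightarrow>
    (D_fun f X\<^sub>0 \<psi> D\<psi> has_real_derivative
       2 / r^2 * circle_integral X\<^sub>0 r
                   (\<lambda>X. 1 / fst X * (D\<psi> X \<bullet> ((X - X\<^sub>0) /\<^sub>R r) - \<psi> X / r)\<^sup>2)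
       + 1 / r^4 * circle_integral X\<^sub>0 r (\<lambda>X. (fst X - x\<^sub>0) / (fst X)\<^sup>2 * (\<psi> X)\<^sup>2)
       - 1 / r^3 * J0_fun X\<^sub>0 \<psi> D\<psi> r
       - 1 / r^3 * K1_fun f X\<^sub>0 \<psi> r) (at r)"
proof -
  have xy: "0 < x\<^sub>0" "y\<^sub>0 < 0" using X0 by (auto simp: nondegenerate_points_def)
  \<comment> \<open>One half of \<open>x\<^sub>0 / 2\<close>: on the closed disc the first
    coordinate is therefore at least three quarters of \<open>x\<^sub>0\<close>.\<close>
  have R: "0 < R\<^sub>0" "R\<^sub>0 \<le> x\<^sub>0 / 4" using xy unfolding R0 by (auto simp: min_def)
  have "0 < fst X" if "X \<in> cball X\<^sub>0 R\<^sub>0" for X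
  proof -
    have "\<bar>fst X - x\<^sub>0\<bar> \<le> norm (X - X\<^sub>0)" using norm_fst_le[of "fst X - x\<^sub>0" "snd X - y\<^sub>0"] by (cases X) (simp add: X0(1))
    also have "\<dots> \<le> R\<^sub>0" using that by (simp add: dist_norm norm_minus_commute)
    finally show ?thesis using R xy by linarith
  qed
  then have disc: "positive_disc X\<^sub>0 R\<^sub>0" unfolding positive_disc_def using R by blast
  \<comment> \<open>The trace hypothesis supplies the trace that all competitors share with
    \<open>\<psi>\<close>.\<close>
  obtain h where h: "has_trace X\<^sub>0 R\<^sub>0 \<psi> D\<psi> h" using trace unfolding nonneg_trace_def by blast
  interpret disc_minimizer f F0 X\<^sub>0 R\<^sub>0 \<psi> D\<psi> h
    by unfold_locales (use disc f_C1 f'_bound F0 minimizer h cont in \<open>auto simp: C1_holder_def\<close>)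
  show ?thesis using frequency_derivative unfolding X0(1) by simp
qed

end
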